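(* Let $\beta>0$ and let $\omega:[a,b]\to\mathbb{R}^d$ be a stochastic process with continuous paths. For $a\le s,t\le b$, let $\nu_{st}=\mathrm{Law}(\omega_{st})$ and suppose that there is a constant $C_\nu$ such that for every interval $J\subseteq[a,b]$, $$\iint_{J\times J}\|\nu_{st}\|_{C^\beta}\,ds\,dt\le C_\nu|J|.$$ Then for every $0<\alpha<\frac\beta2$ with $2\alpha\notin\mathbb{N}$, the occupation measure $\mu$ of $\omega$ satisfies $$\mu_{a,\cdot}\in V^2(a,b;\mathrm{SBE}^{\alpha,2}_2).$$ More precisely, for every $\delta\in(0,1)$ and for every $1\le q<2$, $$\mathbb{E}\Big[\|\mu_{a,\cdot}\|^q_{V^2(\mathrm{SBE}^{\alpha,2}_2)}\big(1+\sup_{s}|\omega_s|\big)^{-d}\Big]\lesssim 1+C_\nu^{(1-\delta)\frac q2}.$$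
   Context: The symbol $\lesssim$ denotes an inequality up to numerical factors that do not depend on the main quantities of the problem (here, in particular, not on $C_\nu$). $\omega_{st}=\omega_t-\omega_s$. $\nu_{st}$ is identified with its density on $\mathbb{R}^d$, and $\|\cdot\|_{C^\beta}$ is the Hölder norm on $\mathbb{R}^d$. The occupation measure of $\omega$ is $\mu_{s,t}=\int_s^t\delta_{\omega_\tau}\,d\tau$, i.e. $\mu_{s,t}(A)=\mathrm{Leb}\{\tau\in[s,t]:\omega_\tau\in A\}$, and $\mu_{a,\cdot}$ denotes $t\mapsto\mu_{a,t}$. For a normed space $E$, $V^p(a,b;E)$ is the set of $f:[a,b]\to E$ of finite $p$-variation, with semi-norm $\|f\|_{V^p(E)}=\big(\sup\sum_{h=1}^n\|f(t_h)-f(t_{h-1})\|_E^p\big)^{1/p}$, the supremum being over all finite partitions $a=t_0<\dots<t_n=b$. $\mathbb{R}^+=(0,\infty)$. For a finite measure $\mu$ on $\mathbb{R}^d$ set $F_\mu(r,y)=\mu(\{x\in\mathbb{R}^d:|x-y|\le r\})$. For a function $F$ of $r$ define recursively $\Delta_0F(r)=F(r)-F(r/2)$, $\Delta_{k+1}F(r)=\Delta_kF(r)-2^{k+1}\Delta_kF(r/2)$. For $\alpha>0$, $1\le p,q\le\infty$ and $k=\lceil\alpha+d-1\rceil$, set $$\|\mu\|_{\mathrm{SBE}^{\alpha,p}_q}=\big\|r^{-\alpha-d}(\Delta_k)_rF_\mu(r,y)\big\|_{L^q_yL^p_r(\mathbb{R}^d\times\mathbb{R}^+,\,dy\otimes\frac{dr}{r})},$$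 where $(\Delta_k)_r$ acts in $r$, the $L^p$ norm in $r$ (w.r.t. $dr/r$) is taken first and then the $L^q$ norm in $y$. A compactly supported finite measure is in $\mathrm{SBE}^{\alpha,p}_q$ if this quantity is finite.
   Formalization: The moment bound with a constant uniform over all processes is stated only for δ(β+d) ≤ β−2α, since it fails for larger δ (scale a rough fractional Brownian motion by ε→0); for other δ in (0,1) the constant may depend on the process ω. *)

theory Defs
  imports "HOL-Probability.Probability"
begin

definition epowr :: "ennreal \<Rightarrow> real \<Rightarrow> ennreal" where
  "epowr x p = (if x = \<top> then \<top> else ennreal (enn2real x powr p))"

(* The exponent p is meant to lie in [1, \<infinity>]. *)
definition Lp_norm :: "ennreal \<Rightarrow> 'c measure \<Rightarrow> ('c \<Rightarrow> ennreal) \<Rightarrow> ennreal" where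
  "Lp_norm p M f =
     (if p = \<top> then esssup M f
      else epowr (\<integral>\<^sup>+ x. epowr (f x) (enn2real p) \<partial>M) (1 / enn2real p))"

definition partial :: "'a::euclidean_space \<Rightarrow> ('a \<Rightarrow> real) \<Rightarrow> 'a \<Rightarrow> real" where
  "partial i f x = frechet_derivative f (at x) i"

definition iter_partial :: "'a::euclidean_space list \<Rightarrow> ('a \<Rightarrow> real) \<Rightarrow> 'a \<Rightarrow> real" where
  "iter_partial is f = foldr partial is f"

primrec Ck :: "nat \<Rightarrow> ('a::euclidean_space \<Rightarrow> real) \<Rightarrow> bool" where
  "Ck 0 f \<longleftrightarrow> continuous_on UNIV f"
| "Ck (Suc n) f \<longleftrightarrow> (\<forall>x. f differentiable at x) \<and> (\<forall>i\<in>Basis. Ck n (partial i f))"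

(* beta = m + gamma with m a natural number and gamma in (0, 1]; for non-integer beta, m is the
   floor of beta.  For an integer beta = m + 1 the m-th derivatives are required to be Lipschitz,
   so that this norm is at most a constant times the usual norm of m + 1 times continuously
   differentiable functions. *)
definition holder_norm :: "real \<Rightarrow> ('a::euclidean_space \<Rightarrow> real) \<Rightarrow> ennreal" where
  "holder_norm \<beta> f =
     (let m = nat \<lceil>\<beta>\<rceil> - 1; \<gamma> = \<beta> - real m in
      if Ck m f then
        (SUP is \<in> {is. set is \<subseteq> Basis \<and> length is \<le> m}. SUP x. ennreal \<bar>iter_partial is f x\<bar>)
        + (SUP is \<in> {is. set is \<subseteq> Basis \<and> length is = m}. SUP (x, y) \<in> {(x, y). x \<noteq> y}.
             ennreal (\<bar>iter_partial is f x - iter_partial is f y\<bar> / norm (x - y) powr \<gamma>))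
      else \<top>)"

(* The Hoelder norm of the density of a measure: infinite if there is no density, and otherwise
   the infimum over the versions of the density, of which at most one is continuous. *)
definition density_holder_norm :: "real \<Rightarrow> 'a::euclidean_space measure \<Rightarrow> ennreal" where
  "density_holder_norm \<beta> \<nu> =
     (INF f \<in> {f. f \<in> borel_measurable borel \<and> (\<forall>x. 0 \<le> f x)
                 \<and> \<nu> = density lborel (\<lambda>x. ennreal (f x))}. holder_norm \<beta> f)"

primrec Delta :: "nat \<Rightarrow> (real \<Rightarrow> real) \<Rightarrow> real \<Rightarrow> real" where
  "Delta 0 F r = F r - F (r / 2)"
| "Delta (Suc k) F r = Delta k F r - 2 ^ (k + 1) * Delta k F (r / 2)"

definition log_measure :: "real measure" where
  "log_measure = density lborel (\<lambda>r. indicator {0<..} r * ennreal (1 / r))"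

(* Finite signed measures are represented by real-valued set functions, so that differences of
   measures are defined; a finite measure \<mu> is represented by "measure \<mu>". *)
definition SBE_norm ::
    "real \<Rightarrow> ennreal \<Rightarrow> ennreal \<Rightarrow> ('a::euclidean_space set \<Rightarrow> real) \<Rightarrow> ennreal" where
  "SBE_norm \<alpha> p q m =
     (let d = real DIM('a); k = nat \<lceil>\<alpha> + d - 1\<rceil> in
      Lp_norm q lborel (\<lambda>y.
        Lp_norm p log_measure (\<lambda>r.
          ennreal (r powr (- \<alpha> - d) * \<bar>Delta k (\<lambda>r. m (cball y r)) r\<bar>))))"

definition compact_finite_measure :: "'a::euclidean_space measure \<Rightarrow> bool" where
  "compact_finite_measure \<mu> \<longleftrightarrow>
     sets \<mu> = sets borel \<and> finite_measure \<mu> \<and> (\<exists>S. compact S \<and> emeasure \<mu> (- S) = 0)"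

definition SBE :: "real \<Rightarrow> ennreal \<Rightarrow> ennreal \<Rightarrow> ('a::euclidean_space set \<Rightarrow> real) set" where
  "SBE \<alpha> p q =
     {m. (\<exists>\<mu>1 \<mu>2. compact_finite_measure \<mu>1 \<and> compact_finite_measure \<mu>2
            \<and> m = (\<lambda>A. measure \<mu>1 A - measure \<mu>2 A))
         \<and> SBE_norm \<alpha> p q m < \<top>}"

definition partitions :: "real \<Rightarrow> real \<Rightarrow> (nat \<times> (nat \<Rightarrow> real)) set" where
  "partitions a b = {(n, t). t 0 = a \<and> t n = b \<and> (\<forall>h<n. t h < t (Suc h))}"

definition Vp_norm :: "('e::minus \<Rightarrow> ennreal) \<Rightarrow> real \<Rightarrow> real \<Rightarrow> real \<Rightarrow> (real \<Rightarrow> 'e) \<Rightarrow> ennreal" where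
  "Vp_norm N p a b f =
     epowr (SUP (n, t) \<in> partitions a b. \<Sum>h=1..n. epowr (N (f (t h) - f (t (h - 1)))) p) (1 / p)"

definition Vp :: "'e::minus set \<Rightarrow> ('e \<Rightarrow> ennreal) \<Rightarrow> real \<Rightarrow> real \<Rightarrow> real \<Rightarrow> (real \<Rightarrow> 'e) set" where
  "Vp E N p a b = {f. (\<forall>t\<in>{a..b}. f t \<in> E) \<and> Vp_norm N p a b f < \<top>}"

definition continuous_process ::
    "real \<Rightarrow> real \<Rightarrow> 'w measure \<Rightarrow> (real \<Rightarrow> 'w \<Rightarrow> 'a::euclidean_space) \<Rightarrow> bool" where
  "continuous_process a b M \<omega> \<longleftrightarrow>
     prob_space M \<and> (\<forall>t\<in>{a..b}. \<omega> t \<in> borel_measurable M)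
     \<and> (\<forall>w\<in>space M. continuous_on {a..b} (\<lambda>t. \<omega> t w))"

definition increment_law ::
    "'w measure \<Rightarrow> (real \<Rightarrow> 'w \<Rightarrow> 'a::euclidean_space) \<Rightarrow> real \<Rightarrow> real \<Rightarrow> 'a measure" where
  "increment_law M \<omega> s t = distr M borel (\<lambda>w. \<omega> t w - \<omega> s w)"

definition increment_density_bound ::
    "real \<Rightarrow> real \<Rightarrow> real \<Rightarrow> 'w measure \<Rightarrow> (real \<Rightarrow> 'w \<Rightarrow> 'a::euclidean_space) \<Rightarrow> real \<Rightarrow> bool" where
  "increment_density_bound a b \<beta> M \<omega> C \<longleftrightarrow>
     (\<forall>J. is_interval J \<and> J \<subseteq> {a..b} \<longrightarrow>
        (\<integral>\<^sup>+ (s, t) \<in> J \<times> J. density_holder_norm \<beta> (increment_law M \<omega> s t) \<partial>(lborel \<Otimes>\<^sub>M lborel))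
          \<le> ennreal (C * measure lborel J))"

definition occupation_measure ::
    "(real \<Rightarrow> 'a::euclidean_space) \<Rightarrow> real \<Rightarrow> real \<Rightarrow> 'a measure" where
  "occupation_measure x s t = distr (restrict_space lborel {s..t}) borel x"

(* The path t \<mapsto> \<mu>_{a,t} of the occupation measure of \<omega> at the outcome w. *)
definition occupation_path ::
    "real \<Rightarrow> (real \<Rightarrow> 'w \<Rightarrow> 'a::euclidean_space) \<Rightarrow> 'w \<Rightarrow> real \<Rightarrow> 'a set \<Rightarrow> real" where
  "occupation_path a \<omega> w = (\<lambda>t. measure (occupation_measure (\<lambda>\<tau>. \<omega> \<tau> w) a t))"

definition weighted_moment ::
    "real \<Rightarrow> real \<Rightarrow> real \<Rightarrow> real \<Rightarrow> 'w measure \<Rightarrow> (real \<Rightarrow> 'w \<Rightarrow> 'a::euclidean_space) \<Rightarrow> ennreal" where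
  "weighted_moment a b \<alpha> q M \<omega> =
     (\<integral>\<^sup>+ w. epowr (Vp_norm (SBE_norm \<alpha> 2 2) 2 a b (occupation_path a \<omega> w)) q
          * ennreal ((1 + (SUP s\<in>{a..b}. norm (\<omega> s w))) powr (- real DIM('a))) \<partial>M)"

end

theory Submission
  imports Defs
begin

text \<open>
  Let \<open>\<mu>\<close> be the occupation measure of a path \<open>x\<close> over \<open>[s, t]\<close>. The difference \<open>\<Delta>\<^sub>k\<close> of
  \<open>r \<mapsto> \<mu>(cball y r)\<close> is \<open>\<integral> \<phi>\<^sub>r(y - x\<^sub>\<tau>) d\<tau>\<close> over \<open>[s, t]\<close>, where the kernel \<open>\<phi>\<^sub>r(z)\<close> is
  \<open>\<Delta>\<^sub>k\<close> at \<open>r\<close> of the indicator of \<open>cball 0 \<rho>\<close> at \<open>z\<close>, as a function of \<open>\<rho>\<close>.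
  The squared \<open>SBE\<close> norm of \<open>\<mu>\<close> is therefore the energy
  \<open>\<integral>\<integral> r powr (-2\<alpha> - 2d - 1) (\<integral> \<phi>\<^sub>r(y - x\<^sub>\<tau>) d\<tau>)\<^sup>2 dr dy\<close>. The proof bounds its mean for a
  short interval and then sums over all intervals of a partition by chaining.

  Cancellation. \<open>\<Delta>\<^sub>k\<close> annihilates \<open>1, r, \<dots>, r^k\<close>. The mass that a density gives to a ball of
  radius \<open>r\<close> is \<open>r^d\<close> times the integral of the rescaled density over the unit ball; Taylor
  expansion along the rays from the centre thus makes \<open>\<Delta>\<^sub>k\<close> of this mass at most a constant times
  \<open>r powr (d + \<beta>)\<close> times the Hoelder norm, as soon as \<open>k \<ge> d + \<lceil>\<beta>\<rceil> - 1\<close>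
  (\<open>abs_Delta_measure_cball_le_density_holder_norm\<close>). The order \<open>\<lceil>\<alpha> + d - 1\<rceil>\<close> of the norm may be
  smaller than that. But whenever \<open>k + 1 > \<alpha> + d\<close>, the energy of order \<open>k\<close> is controlled by the one
  of order \<open>k + 1\<close> (\<open>nn_integral_Delta_le_Suc\<close>), so the order may be raised at will. The strict
  inequality holds for \<open>k = \<lceil>\<alpha> + d - 1\<rceil>\<close> because \<open>\<alpha>\<close> is not an integer.

  Mean energy. Expanding the square and exchanging integrals, the mean of
  \<open>\<integral> (\<integral> \<phi>\<^sub>r(y - \<omega>\<^sub>\<tau>) d\<tau>)\<^sup>2 dy\<close> over an interval \<open>J\<close> becomes a double integral over \<open>J \<times> J\<close> of
  \<open>\<phi>\<^sub>r\<close> against \<open>\<Delta>\<^sub>k\<close> of the law of the increment; by cancellation and the hypothesis on the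
  densities it is at most a constant times \<open>r powr (2d + \<beta>) C |J|\<close>. It is also at most a constant
  times \<open>r^d |J|\<^sup>2\<close>, for any path. Using the first bound for \<open>r \<le> \<rho>\<close> and the second for \<open>r > \<rho>\<close>,
  with \<open>\<rho> powr (\<beta> + d) = |J| / C\<close>, gives a mean energy of at most a constant times
  \<open>C powr (1 - \<theta>) |J| powr (1 + \<theta>)\<close>, where \<open>\<theta> = (\<beta> - 2\<alpha>) / (\<beta> + d)\<close>
  (\<open>expectation_energy_le\<close>).

  Chaining. For fixed \<open>y\<close> and \<open>r\<close> the map \<open>t \<mapsto> \<integral> \<phi>\<^sub>r(y - \<omega>\<^sub>\<tau>) d\<tau>\<close> over \<open>[a, t]\<close> is real-valued and
  Lipschitz. The sum of the squared increments of a continuous real function over any partition is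
  at most a constant times \<open>\<Sum>\<^sub>n \<kappa>^n\<close> (sum of the squared increments over the dyadic intervals of
  level \<open>n\<close>), for each \<open>\<kappa> > 1\<close> (\<open>square_variation_le_dyadic\<close>). Integrating this inequality in \<open>y\<close>
  and \<open>r\<close> yields a random variable \<open>Z\<close> that dominates the squared 2-variation of
  \<open>t \<mapsto> \<mu>\<close> pathwise. There are \<open>2^n\<close> intervals of level \<open>n\<close>, and the excess \<open>\<theta>\<close> in the exponent
  \<open>1 + \<theta>\<close> makes the series of means converge for \<open>\<kappa> = 2 powr (\<theta>/2)\<close>: the mean of \<open>Z\<close> is at most
  a constant times \<open>C powr (1 - \<theta>)\<close>.

  Hence \<open>Z\<close> is finite almost surely, and its moments of order \<open>q / 2 < 1\<close> are at most a constant
  times \<open>C powr ((1 - \<theta>) q / 2)\<close> when \<open>C \<ge> 1\<close>; the weight is at most \<open>1\<close>. For \<open>\<delta> \<le> \<theta>\<close> this is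
  the uniform moment bound. For a fixed process that satisfies the hypothesis with some \<open>C\<close>, the moment
  is a finite number, which provides a constant for every \<open>\<delta>\<close> and every \<open>C\<close>.
\<close>

section \<open>Iterated differences\<close>

primrec Delta_coeff :: "nat \<Rightarrow> nat \<Rightarrow> real" where
  "Delta_coeff 0 = (\<lambda>j. if j = 0 then 1 else if j = 1 then -1 else 0)"
| "Delta_coeff (Suc k) =
     (\<lambda>j. Delta_coeff k j - 2 ^ (k + 1) * (case j of 0 \<Rightarrow> 0 | Suc i \<Rightarrow> Delta_coeff k i))"

lemma Delta_coeff_eq_0: "j > Suc k \<Longrightarrow> Delta_coeff k j = 0"
  by (induction k arbitrary: j) (auto split: nat.split)

lemma Delta_eq_sum: "Delta k F r = (\<Sum>j\<le>Suc k. Delta_coeff k j * F (r / 2 ^ j))"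
proof (induction k arbitrary: r)
  case 0
  show ?case by simp
next
  case (Suc k)
  have "(\<Sum>j\<le>Suc (Suc k). Delta_coeff (Suc k) j * F (r / 2 ^ j))
      = (\<Sum>j\<le>Suc (Suc k). Delta_coeff k j * F (r / 2 ^ j))
        - 2 ^ (k + 1) * (\<Sum>j\<le>Suc (Suc k). (case j of 0 \<Rightarrow> 0 | Suc i \<Rightarrow> Delta_coeff k i) * F (r / 2 ^ j))"
    by (simp add: sum_subtractf left_diff_distrib sum_distrib_left mult.assoc del: sum.atMost_Suc)
  also have "(\<Sum>j\<le>Suc (Suc k). Delta_coeff k j * F (r / 2 ^ j)) = Delta k F r"
    by (simp add: Suc.IH Delta_coeff_eq_0)
  also have "(\<Sum>j\<le>Suc (Suc k). (case j of 0 \<Rightarrow> 0 | Suc i \<Rightarrow> Delta_coeff k i) * F (r / 2 ^ j))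
      = Delta k F (r / 2)"
    unfolding Suc.IH by (subst sum.atMost_Suc_shift) simp
  finally show ?case by simp
qed

text \<open>
  The total variation of \<open>\<Delta>\<^sub>k\<close> as a combination of evaluations: the constant in every crude bound.
\<close>
definition Delta_mass :: "nat \<Rightarrow> real" where
  "Delta_mass k = (\<Sum>j\<le>Suc k. \<bar>Delta_coeff k j\<bar>)"

lemma Delta_mass_pos: "0 < Delta_mass k"
proof -
  have "Delta_coeff k 0 = 1" by (induction k) auto
  moreover have "\<bar>Delta_coeff k 0\<bar> \<le> Delta_mass k"
    unfolding Delta_mass_def by (rule member_le_sum) auto
  ultimately show ?thesis by simp
qed

lemma abs_Delta_le:
  assumes "\<And>j. \<bar>F (r / 2 ^ j)\<bar> \<le> B"
  shows "\<bar>Delta k F r\<bar> \<le> Delta_mass k * B"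
proof -
  have "\<bar>Delta k F r\<bar> \<le> (\<Sum>j\<le>Suc k. \<bar>Delta_coeff k j * F (r / 2 ^ j)\<bar>)"
    unfolding Delta_eq_sum by (rule sum_abs)
  also have "\<dots> \<le> (\<Sum>j\<le>Suc k. \<bar>Delta_coeff k j\<bar> * B)"
    by (intro sum_mono) (simp add: abs_mult mult_left_mono assms)
  finally show ?thesis by (simp only: Delta_mass_def sum_distrib_right)
qed

lemma Delta_power_scale:
  "Delta k (\<lambda>r. r ^ n) (r / 2) = Delta k (\<lambda>r. r ^ n) r / 2 ^ n"
proof (induction k arbitrary: r)
  case 0
  show ?case by (simp add: power_divide diff_divide_distrib flip: power_mult_distrib)
next
  case (Suc k)
  show ?case
    unfolding Delta.simps Suc by (simp add: diff_divide_distrib)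
qed

text \<open>
  On \<open>r ^ n\<close> the dilation \<open>r \<mapsto> r / 2\<close> acts as multiplication by \<open>2 ^ -n\<close>, which is what the
  factor \<open>2 ^ n\<close> in the \<open>n\<close>-th recursion step cancels; every later step preserves the zero.
\<close>
lemma Delta_power_eq_0: "n \<le> k \<Longrightarrow> Delta k (\<lambda>r. r ^ n) r = 0"
proof (induction k arbitrary: r)
  case (Suc k)
  show ?case
  proof (cases "n = Suc k")
    case True
    then show ?thesis by (simp add: Delta_power_scale del: power_Suc)
  next
    case False
    then show ?thesis using Suc by simp
  qed
qed simp

lemma Delta_diff: "Delta k (\<lambda>r. F r - G r) r = Delta k F r - Delta k G r"
  unfolding Delta_eq_sum by (simp add: sum_subtractf right_diff_distrib del: sum.atMost_Suc)

lemma Delta_polynomial_eq_0: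
  assumes "d + m \<le> k"
  shows "Delta k (\<lambda>r. r ^ d * (\<Sum>n\<le>m. c n * r ^ n)) r = 0"
proof -
  have "Delta k (\<lambda>r. r ^ d * (\<Sum>n\<le>m. c n * r ^ n)) r
      = (\<Sum>j\<le>Suc k. \<Sum>n\<le>m. c n * (Delta_coeff k j * (r / 2 ^ j) ^ (d + n)))"
    unfolding Delta_eq_sum
    by (intro sum.cong refl) (simp add: sum_distrib_left power_add mult_ac)
  also have "\<dots> = (\<Sum>n\<le>m. c n * Delta k (\<lambda>r. r ^ (d + n)) r)"
    unfolding Delta_eq_sum by (subst sum.swap) (simp only: sum_distrib_left)
  also have "\<dots> = 0"
    using assms by (intro sum.neutral) (auto simp: Delta_power_eq_0)
  finally show ?thesis .
qed

section \<open>Densities of Hoelder class on balls\<close>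

lemma Ck_continuous: "Ck m f \<Longrightarrow> continuous_on UNIV f"
  by (cases m) (auto simp: continuous_on_eq_continuous_within differentiable_imp_continuous_within)

text \<open>
  Only the restriction of \<open>f\<close> to a ray is expanded, which avoids multivariate Taylor
  polynomials. By induction on \<open>m\<close>: the derivative along the ray is a combination of partial
  derivatives, each of which has an expansion of order one less, and integrating raises the order.
  The sum over the basis costs one factor of the dimension at each step.
\<close>
lemma Ck_ray_Taylor:
  fixes f :: "'a::euclidean_space \<Rightarrow> real"
  assumes "Ck m f" "0 < \<gamma>" "0 \<le> H"
    and "\<And>is x y. set is \<subseteq> Basis \<Longrightarrow> length is = m \<Longrightarrow>
           \<bar>iter_partial is f x - iter_partial is f y\<bar> \<le> H * norm (x - y) powr \<gamma>"
    and "norm x \<le> 1"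
  shows "\<exists>c. \<forall>t\<ge>0. \<bar>f (p + t *\<^sub>R x) - (\<Sum>n\<le>m. c n * t ^ n)\<bar>
           \<le> real DIM('a) ^ m * H * t powr (real m + \<gamma>)"
  using assms(1,4)
proof (induction m arbitrary: f)
  case 0
  have "\<bar>f (p + t *\<^sub>R x) - f p\<bar> \<le> H * t powr \<gamma>" if "0 \<le> t" for t
  proof -
    have "\<bar>f (p + t *\<^sub>R x) - f p\<bar> \<le> H * norm (t *\<^sub>R x) powr \<gamma>"
      using 0(2)[of "[]" "p + t *\<^sub>R x" p] by (simp add: iter_partial_def)
    also have "\<dots> \<le> H * t powr \<gamma>"
      using that assms(2,3,5)
      by (intro mult_left_mono powr_mono2) (auto intro: mult_left_le)
    finally show ?thesis .
  qed
  then show ?case by (intro exI[of _ "\<lambda>_. f p"]) simp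
next
  case (Suc m)
  let ?D = "real DIM('a) ^ m * H"
  have "\<forall>i\<in>Basis. \<exists>c. \<forall>t\<ge>0. \<bar>partial i f (p + t *\<^sub>R x) - (\<Sum>n\<le>m. c n * t ^ n)\<bar>
           \<le> ?D * t powr (real m + \<gamma>)"
  proof
    fix i :: 'a assume i: "i \<in> Basis"
    have "\<bar>iter_partial is (partial i f) y - iter_partial is (partial i f) z\<bar> \<le> H * norm (y - z) powr \<gamma>"
      if "set is \<subseteq> Basis" "length is = m" for "is" y z
      using Suc.prems(2)[of "is @ [i]" y z] that i by (simp add: iter_partial_def)
    then show "\<exists>c. \<forall>t\<ge>0. \<bar>partial i f (p + t *\<^sub>R x) - (\<Sum>n\<le>m. c n * t ^ n)\<bar>
           \<le> ?D * t powr (real m + \<gamma>)"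
      using Suc.prems(1) i by (intro Suc.IH) auto
  qed
  then obtain c where c: "\<And>i t. i \<in> Basis \<Longrightarrow> 0 \<le> t \<Longrightarrow>
      \<bar>partial i f (p + t *\<^sub>R x) - (\<Sum>n\<le>m. c i n * t ^ n)\<bar> \<le> ?D * t powr (real m + \<gamma>)"
    by (auto simp: bchoice_iff)
  \<comment> \<open>The expansion of the derivative has coefficients \<open>b\<close>; its primitive with value \<open>f p\<close> at \<open>0\<close> has coefficients \<open>e\<close>.\<close>
  define b where "b n = (\<Sum>i\<in>Basis. (x \<bullet> i) * c i n)" for n
  define e where "e n = (case n of 0 \<Rightarrow> f p | Suc n \<Rightarrow> b n / real (Suc n))" for n
  define h where "h t = f (p + t *\<^sub>R x) - (\<Sum>n\<le>Suc m. e n * t ^ n)" for t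
  define h' where "h' t = (\<Sum>i\<in>Basis. (x \<bullet> i) * (partial i f (p + t *\<^sub>R x) - (\<Sum>n\<le>m. c i n * t ^ n)))" for t
  have h': "(h has_real_derivative h' t) (at t)" for t
  proof -
    let ?F = "frechet_derivative f (at (p + t *\<^sub>R x))"
    have F: "(f has_derivative ?F) (at (p + t *\<^sub>R x))"
      using Suc.prems(1) by (simp add: frechet_derivative_works)
    have lin: "linear ?F" by (rule has_derivative_linear[OF F])
    have "((\<lambda>t. f (p + t *\<^sub>R x)) has_derivative (\<lambda>s. ?F (s *\<^sub>R x))) (at t)"
      by (rule has_derivative_compose[where f = "\<lambda>t. p + t *\<^sub>R x", OF _ F])
         (auto intro!: derivative_eq_intros)
    also have "(\<lambda>s. ?F (s *\<^sub>R x)) = (*) (?F x)"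
      by (auto simp: linear_cmul[OF lin])
    finally have 1: "((\<lambda>t. f (p + t *\<^sub>R x)) has_real_derivative ?F x) (at t)"
      by (simp add: has_field_derivative_def)
    have "?F x = ?F (\<Sum>i\<in>Basis. (x \<bullet> i) *\<^sub>R i)" by (simp add: euclidean_representation)
    also have "\<dots> = (\<Sum>i\<in>Basis. (x \<bullet> i) * partial i f (p + t *\<^sub>R x))"
      by (simp add: linear_sum[OF lin] linear_cmul[OF lin] partial_def)
    finally have Fx: "?F x = \<dots>" .
    have 2: "((\<lambda>t. \<Sum>n\<le>Suc m. e n * t ^ n) has_real_derivative (\<Sum>n\<le>m. b n * t ^ n)) (at t)"
    proof -
      have "((\<lambda>t. f p + (\<Sum>n\<le>m. b n / real (Suc n) * t ^ Suc n)) has_real_derivative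
         (\<Sum>n\<le>m. b n * t ^ n)) (at t)"
        by (auto intro!: derivative_eq_intros sum.cong simp: divide_simps simp del: power_Suc of_nat_Suc)
      then show ?thesis
        by (subst sum.atMost_Suc_shift) (simp add: e_def)
    qed
    have "(\<Sum>n\<le>m. b n * t ^ n) = (\<Sum>i\<in>Basis. (x \<bullet> i) * (\<Sum>n\<le>m. c i n * t ^ n))"
      unfolding b_def sum_distrib_left sum_distrib_right by (subst sum.swap) (simp add: mult.assoc)
    then have "?F x - (\<Sum>n\<le>m. b n * t ^ n) = h' t"
      by (simp add: Fx h'_def right_diff_distrib sum_subtractf)
    then show ?thesis
      using DERIV_diff[OF 1 2] by (simp add: h_def[abs_def])
  qed
  have h'_bound: "\<bar>h' t\<bar> \<le> real DIM('a) * ?D * t powr (real m + \<gamma>)" if "0 \<le> t" for t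
  proof -
    have "\<bar>h' t\<bar> \<le> (\<Sum>i\<in>Basis. \<bar>(x \<bullet> i) * (partial i f (p + t *\<^sub>R x) - (\<Sum>n\<le>m. c i n * t ^ n))\<bar>)"
      unfolding h'_def by (rule sum_abs)
    also have "\<dots> \<le> (\<Sum>i\<in>(Basis::'a set). 1 * (?D * t powr (real m + \<gamma>)))"
      unfolding abs_mult using c that assms(3,5)
      by (intro sum_mono mult_mono) (auto intro: order_trans[OF Basis_le_norm])
    finally show ?thesis by simp
  qed
  have "\<bar>h T\<bar> \<le> real DIM('a) ^ Suc m * H * T powr (real (Suc m) + \<gamma>)" if T: "0 \<le> T" for T
  proof (cases "T = 0")
    case True
    then show ?thesis by (simp add: h_def e_def sum.atMost_Suc_shift del: sum.atMost_Suc)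
  next
    case False
    then have "0 < T" using T by simp
    then obtain z where z: "0 < z" "z < T" "h T - h 0 = (T - 0) * h' z"
      using MVT2[of 0 T h h'] h' by blast
    have "h 0 = 0" by (simp add: h_def e_def sum.atMost_Suc_shift del: sum.atMost_Suc)
    then have "\<bar>h T\<bar> = T * \<bar>h' z\<bar>" using z \<open>0 < T\<close> by (simp add: abs_mult)
    also have "\<dots> \<le> T * (real DIM('a) * ?D * T powr (real m + \<gamma>))"
      using h'_bound[of z] z assms(2,3) \<open>0 < T\<close>
      by (intro mult_left_mono order_trans[OF h'_bound[of z]] powr_mono2) auto
    also have "\<dots> = real DIM('a) ^ Suc m * H * (T powr 1 * T powr (real m + \<gamma>))"
      using \<open>0 < T\<close> by simp
    also have "T powr 1 * T powr (real m + \<gamma>) = T powr (real (Suc m) + \<gamma>)"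
      by (simp only: powr_add[symmetric]) (simp add: add_ac)
    finally show ?thesis .
  qed
  then show ?case unfolding h_def by blast
qed

lemma lborel_integral_affine:
  fixes f :: "'a::euclidean_space \<Rightarrow> real"
  assumes [measurable]: "f \<in> borel_measurable borel" and "0 < \<rho>"
  shows "(LINT x|lborel. f x) = \<rho> ^ DIM('a) * (LINT x|lborel. f (z + \<rho> *\<^sub>R x))"
proof -
  have "(LINT x|lborel. f x)
      = (LINT x|density (distr lborel borel (\<lambda>x. z + \<rho> *\<^sub>R x)) (\<lambda>_. ennreal (\<rho> ^ DIM('a))). f x)"
    using lborel_affine[of \<rho> z] assms by simp
  also have "\<dots> = \<rho> ^ DIM('a) * (LINT x|lborel. f (z + \<rho> *\<^sub>R x))"
    using assms by (subst integral_density) (auto simp: integral_distr)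
  finally show ?thesis .
qed

lemma measure_density_cball:
  fixes f :: "'a::euclidean_space \<Rightarrow> real"
  assumes f [measurable]: "f \<in> borel_measurable borel" and nonneg: "\<And>x. 0 \<le> f x" and "0 < \<rho>"
  shows "measure (density lborel (\<lambda>x. ennreal (f x))) (cball z \<rho>)
           = \<rho> ^ DIM('a) * (LINT x|lborel. indicat_real (cball 0 1) x * f (z + \<rho> *\<^sub>R x))"
proof -
  have [measurable]: "cball z \<rho> \<in> sets borel" by simp
  have "measure (density lborel (\<lambda>x. ennreal (f x))) (cball z \<rho>)
      = (LINT x|density lborel (\<lambda>x. ennreal (f x)). indicator (cball z \<rho>) x)"
    by simp
  also have "\<dots> = (LINT x|lborel. f x * indicat_real (cball z \<rho>) x)"
    using nonneg by (subst integral_density) auto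
  also have "\<dots> = \<rho> ^ DIM('a) * (LINT x|lborel. f (z + \<rho> *\<^sub>R x) * indicator (cball z \<rho>) (z + \<rho> *\<^sub>R x))"
    by (rule lborel_integral_affine) (use assms in auto)
  also have "(\<lambda>x. f (z + \<rho> *\<^sub>R x) * indicator (cball z \<rho>) (z + \<rho> *\<^sub>R x))
      = (\<lambda>x::'a. indicat_real (cball 0 1) x * f (z + \<rho> *\<^sub>R x))"
    using \<open>0 < \<rho>\<close> by (auto simp: indicator_def fun_eq_iff dist_norm)
  finally show ?thesis .
qed

text \<open>
  After rescaling to the unit ball, the mass of \<open>cball z \<rho>\<close> is the integral over unit vectors
  \<open>x\<close> of \<open>\<rho> ^ d * f (z + \<rho> x)\<close>. For each \<open>x\<close> this is a polynomial in \<open>\<rho>\<close> of degree at most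
  \<open>d + m \<le> k\<close>, annihilated by \<open>\<Delta>\<^sub>k\<close>, plus the Taylor remainder. Applying \<open>\<Delta>\<^sub>k\<close> before
  integrating in \<open>x\<close> means that the coefficients need not depend measurably on \<open>x\<close>.
\<close>
lemma abs_Delta_measure_cball_le:
  fixes f :: "'a::euclidean_space \<Rightarrow> real"
  assumes Ck: "Ck m f" and nonneg: "\<And>x. 0 \<le> f x" and "0 < \<gamma>" "0 \<le> H" "0 < r"
    and Holder: "\<And>is x y. set is \<subseteq> Basis \<Longrightarrow> length is = m \<Longrightarrow>
           \<bar>iter_partial is f x - iter_partial is f y\<bar> \<le> H * norm (x - y) powr \<gamma>"
    and k: "DIM('a) + m \<le> k"
  shows "\<bar>Delta k (\<lambda>\<rho>. measure (density lborel (\<lambda>x. ennreal (f x))) (cball z \<rho>)) r\<bar>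
           \<le> measure lborel (cball (0::'a) 1) * Delta_mass k * real DIM('a) ^ m * H
               * r powr (real DIM('a) + real m + \<gamma>)"
proof -
  let ?d = "DIM('a)" and ?B = "real DIM('a) ^ m * H * r powr (real DIM('a) + real m + \<gamma>)"
  have cont: "continuous_on UNIV f" by (rule Ck_continuous[OF Ck])
  then have [measurable]: "f \<in> borel_measurable borel" by (rule borel_measurable_continuous_onI)
  have int: "integrable lborel (\<lambda>x. indicat_real (cball 0 1) x * f (z + \<rho> *\<^sub>R x))" for \<rho>
  proof -
    have "continuous_on (cball 0 1) (\<lambda>x. f (z + \<rho> *\<^sub>R x))"
      by (rule continuous_on_compose2[OF cont]) (auto intro!: continuous_intros)
    from borel_integrable_compact[OF compact_cball this] show ?thesis
      by (simp add: mult.commute indicator_times_eq_if)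
  qed
  define g where "g x \<rho> = \<rho> ^ ?d * f (z + \<rho> *\<^sub>R x)" for x \<rho>
  have g_le: "\<bar>Delta k (g x) r\<bar> \<le> Delta_mass k * ?B" if x: "norm x \<le> 1" for x
  proof -
    obtain c where c: "\<And>t. 0 \<le> t \<Longrightarrow> \<bar>f (z + t *\<^sub>R x) - (\<Sum>n\<le>m. c n * t ^ n)\<bar>
           \<le> real ?d ^ m * H * t powr (real m + \<gamma>)"
      using Ck_ray_Taylor[OF Ck \<open>0 < \<gamma>\<close> \<open>0 \<le> H\<close> Holder x] by metis
    have "Delta k (g x) r = Delta k (\<lambda>\<rho>. g x \<rho> - \<rho> ^ ?d * (\<Sum>n\<le>m. c n * \<rho> ^ n)) r"
      unfolding Delta_diff by (simp add: Delta_polynomial_eq_0[OF k])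
    also have "\<bar>\<dots>\<bar> \<le> Delta_mass k * ?B"
    proof (rule abs_Delta_le)
      fix j
      let ?\<rho> = "r / 2 ^ j"
      have \<rho>: "0 < ?\<rho>" "?\<rho> \<le> r" using \<open>0 < r\<close> by (auto simp: divide_le_eq)
      have "\<bar>g x ?\<rho> - ?\<rho> ^ ?d * (\<Sum>n\<le>m. c n * ?\<rho> ^ n)\<bar>
          = ?\<rho> ^ ?d * \<bar>f (z + ?\<rho> *\<^sub>R x) - (\<Sum>n\<le>m. c n * ?\<rho> ^ n)\<bar>"
        unfolding g_def right_diff_distrib[symmetric] abs_mult using \<rho> by simp
      also have "\<dots> \<le> ?\<rho> ^ ?d * (real ?d ^ m * H * ?\<rho> powr (real m + \<gamma>))"
        using \<rho> by (intro mult_left_mono c) auto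
      also have "\<dots> = real ?d ^ m * H * ?\<rho> powr (real ?d + real m + \<gamma>)"
        using \<rho> by (simp add: powr_add powr_realpow)
      also have "\<dots> \<le> ?B"
        using \<rho> \<open>0 < \<gamma>\<close> \<open>0 \<le> H\<close> by (intro mult_left_mono powr_mono2) auto
      finally show "\<bar>g x ?\<rho> - ?\<rho> ^ ?d * (\<Sum>n\<le>m. c n * ?\<rho> ^ n)\<bar> \<le> ?B" .
    qed
    finally show ?thesis .
  qed
  have "Delta k (\<lambda>\<rho>. measure (density lborel (\<lambda>x. ennreal (f x))) (cball z \<rho>)) r
      = (\<Sum>j\<le>Suc k. Delta_coeff k j * ((r / 2 ^ j) ^ ?d *
          (LINT x|lborel. indicat_real (cball 0 1) x * f (z + (r / 2 ^ j) *\<^sub>R x))))"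
    unfolding Delta_eq_sum using \<open>0 < r\<close> nonneg by (intro sum.cong refl) (simp add: measure_density_cball)
  also have "\<dots> = (LINT x|lborel. (\<Sum>j\<le>Suc k. Delta_coeff k j * ((r / 2 ^ j) ^ ?d *
          (indicat_real (cball 0 1) x * f (z + (r / 2 ^ j) *\<^sub>R x)))))"
    by (subst Bochner_Integration.integral_sum) (use int in \<open>auto intro!: integrable_mult_right\<close>)
  also have "\<dots> = (LINT x|lborel. indicat_real (cball 0 1) x * Delta k (g x) r)"
    unfolding Delta_eq_sum g_def sum_distrib_left
    by (intro Bochner_Integration.integral_cong refl sum.cong) (simp add: mult_ac)
  also have "\<bar>\<dots>\<bar> \<le> (LINT x|lborel. indicat_real (cball (0::'a) 1) x * (Delta_mass k * ?B))"
  proof -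
    have "\<bar>LINT x|lborel. indicat_real (cball 0 1) x * Delta k (g x) r\<bar>
        \<le> (LINT x|lborel. \<bar>indicat_real (cball 0 1) x * Delta k (g x) r\<bar>)"
      by (rule integral_abs_bound)
    also have "\<dots> \<le> (LINT x|lborel. indicat_real (cball (0::'a) 1) x * (Delta_mass k * ?B))"
      using g_le Delta_mass_pos[of k] \<open>0 \<le> H\<close>
      by (intro integral_mono_AE' integrable_mult_left integrable_real_indicator)
         (auto simp: abs_mult indicator_def emeasure_bounded_finite[unfolded infinity_ennreal_def])
    finally show ?thesis .
  qed
  also have "\<dots> = measure lborel (cball (0::'a) 1) * (Delta_mass k * ?B)" by simp
  finally show ?thesis by (simp add: mult.assoc)
qed

lemma ceiling_split:
  fixes \<beta> :: real assumes "0 < \<beta>"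
  shows "0 < \<beta> - real (nat \<lceil>\<beta>\<rceil> - 1)"
proof -
  have "1 \<le> nat \<lceil>\<beta>\<rceil>" using assms by linarith
  then have "real (nat \<lceil>\<beta>\<rceil> - 1) = real (nat \<lceil>\<beta>\<rceil>) - 1" by (simp only: of_nat_diff of_nat_1)
  also have "real (nat \<lceil>\<beta>\<rceil>) = of_int \<lceil>\<beta>\<rceil>" using assms by simp
  finally show ?thesis by linarith
qed

text \<open>
  With the constant in the denominator the estimate holds version by version of the density and
  passes to the infimum directly; versions of infinite norm are harmless.
\<close>
lemma abs_Delta_measure_cball_le_density_holder_norm:
  fixes \<nu> :: "'a::euclidean_space measure"
  assumes "0 < \<beta>" "0 < r" and k: "DIM('a) + (nat \<lceil>\<beta>\<rceil> - 1) \<le> k"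
  shows "ennreal (\<bar>Delta k (\<lambda>\<rho>. measure \<nu> (cball z \<rho>)) r\<bar>
             / (measure lborel (cball (0::'a) 1) * Delta_mass k * real DIM('a) ^ (nat \<lceil>\<beta>\<rceil> - 1)
                * r powr (real DIM('a) + \<beta>)))
           \<le> density_holder_norm \<beta> \<nu>"
    (is "ennreal (?\<Delta> / ?c) \<le> _")
  unfolding density_holder_norm_def
proof (rule INF_greatest)
  fix f :: "'a \<Rightarrow> real"
  assume "f \<in> {f. f \<in> borel_measurable borel \<and> (\<forall>x. 0 \<le> f x) \<and> \<nu> = density lborel (\<lambda>x. ennreal (f x))}"
  then have nonneg: "\<And>x. 0 \<le> f x" and \<nu>: "\<nu> = density lborel (\<lambda>x. ennreal (f x))" by auto
  show "ennreal (?\<Delta> / ?c) \<le> holder_norm \<beta> f"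
  proof (cases "holder_norm \<beta> f = \<top>")
    case False
    define m where "m = nat \<lceil>\<beta>\<rceil> - 1"
    define H where "H = enn2real (holder_norm \<beta> f)"
    have H: "holder_norm \<beta> f = ennreal H" "0 \<le> H" using False by (auto simp: H_def less_top)
    have Ck: "Ck m f" using False by (auto simp: holder_norm_def m_def Let_def split: if_splits)
    have \<gamma>: "0 < \<beta> - real m" unfolding m_def by (rule ceiling_split) fact
    have Holder: "\<bar>iter_partial is f x - iter_partial is f y\<bar> \<le> H * norm (x - y) powr (\<beta> - real m)"
      if "is": "set is \<subseteq> Basis" "length is = m" for "is" x y
    proof (cases "x = y")
      case False
      have "ennreal (\<bar>iter_partial is f x - iter_partial is f y\<bar> / norm (x - y) powr (\<beta> - real m))
         \<le> (SUP is \<in> {is. set is \<subseteq> Basis \<and> length is = m}. SUP (x, y) \<in> {(x, y). x \<noteq> y}.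
               ennreal (\<bar>iter_partial is f x - iter_partial is f y\<bar> / norm (x - y) powr (\<beta> - real m)))"
        using "is" False by (intro SUP_upper2[of "is"] SUP_upper2[of "(x, y)"]) auto
      also have "\<dots> \<le> holder_norm \<beta> f"
        using Ck by (simp add: holder_norm_def m_def Let_def)
      finally have "\<bar>iter_partial is f x - iter_partial is f y\<bar> / norm (x - y) powr (\<beta> - real m) \<le> H"
        unfolding H using H(2) by (simp add: ennreal_le_iff)
      then show ?thesis using False by (simp add: divide_le_eq mult.commute)
    qed simp
    have "?\<Delta> \<le> measure lborel (cball (0::'a) 1) * Delta_mass k * real DIM('a) ^ m * H
               * r powr (real DIM('a) + real m + (\<beta> - real m))"
      unfolding \<nu>
      by (rule abs_Delta_measure_cball_le[OF Ck nonneg \<gamma> H(2) \<open>0 < r\<close> Holder]) (use k m_def in auto)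
    also have "\<dots> = H * ?c" by (simp add: m_def)
    finally have "?\<Delta> / ?c \<le> H"
      using H(2) Delta_mass_pos[of k] \<open>0 < r\<close> content_cball_pos[of 1 "0::'a"]
      by (subst pos_divide_le_eq) (auto intro!: mult_pos_pos)
    then show ?thesis using H by (simp add: ennreal_leI)
  qed simp
qed

section \<open>Independence of the order of the difference\<close>

lemma nn_integral_powr_Ioc:
  assumes "-1 < p" "0 \<le> \<rho>"
  shows "(\<integral>\<^sup>+ r. ennreal (indicator {0<..\<rho>} r * r powr p) \<partial>lborel) = ennreal (\<rho> powr (p + 1) / (p + 1))"
proof -
  have "((\<lambda>r. if r \<in> {0..\<rho>} then r powr p else 0) has_integral (\<rho> powr (p + 1) / (p + 1))) UNIV"
    using has_integral_powr_from_0[OF assms] unfolding has_integral_restrict_UNIV by simp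
  then have "(\<integral>\<^sup>+ r. ennreal (if r \<in> {0..\<rho>} then r powr p else 0) \<partial>lborel) = ennreal (\<rho> powr (p + 1) / (p + 1))"
    by (intro nn_integral_has_integral_lborel) auto
  moreover have "(\<integral>\<^sup>+ r. ennreal (indicator {0<..\<rho>} r * r powr p) \<partial>lborel)
      = (\<integral>\<^sup>+ r. ennreal (if r \<in> {0..\<rho>} then r powr p else 0) \<partial>lborel)"
    by (intro nn_integral_cong) (auto simp: indicator_def)
  ultimately show ?thesis by simp
qed

lemma nn_integral_powr_Ioi:
  assumes "p < -1" "0 < \<rho>"
  shows "(\<integral>\<^sup>+ r. ennreal (indicator {\<rho><..} r * r powr p) \<partial>lborel) = ennreal (\<rho> powr (p + 1) / - (p + 1))"
proof -
  have "((\<lambda>r. if r \<in> {\<rho>..} then r powr p else 0) has_integral (- (\<rho> powr (p + 1)) / (p + 1))) UNIV"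
    using has_integral_powr_to_inf[OF assms] unfolding has_integral_restrict_UNIV by simp
  then have "(\<integral>\<^sup>+ r. ennreal (if r \<in> {\<rho>..} then r powr p else 0) \<partial>lborel) = ennreal (- (\<rho> powr (p + 1)) / (p + 1))"
    by (intro nn_integral_has_integral_lborel) auto
  moreover have "(\<integral>\<^sup>+ r. ennreal (indicator {\<rho><..} r * r powr p) \<partial>lborel)
      = (\<integral>\<^sup>+ r. ennreal (if r \<in> {\<rho>..} then r powr p else 0) \<partial>lborel)"
    by (intro nn_integral_cong_AE, rule AE_I[where N = "{\<rho>}"]) (auto simp: indicator_def)
  moreover have "- (\<rho> powr (p + 1)) / (p + 1) = \<rho> powr (p + 1) / - (p + 1)"
    by (metis minus_divide_left minus_divide_right)
  ultimately show ?thesis by (simp only:)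
qed

lemma measurable_Delta:
  assumes [measurable]: "F \<in> borel_measurable borel"
  shows "Delta k F \<in> borel_measurable borel"
proof -
  have "Delta k F = (\<lambda>r. \<Sum>j\<le>Suc k. Delta_coeff k j * F (r / 2 ^ j))"
    by (simp only: Delta_eq_sum fun_eq_iff simp_thms)
  then show ?thesis by simp
qed

text \<open>
  Absorption of a finite quantity that occurs on both sides of an inequality.
\<close>
lemma ennreal_absorb:
  fixes x y :: ennreal
  assumes "ennreal A * x \<le> ennreal B * x + ennreal C * y" "x < \<top>" "B < A" "0 \<le> B" "0 \<le> C"
  shows "x \<le> ennreal (C / (A - B)) * y"
proof (cases "y = \<top>")
  case True
  show ?thesis
  proof (cases "C = 0")
    case False
    then show ?thesis using True assms by (simp add: ennreal_mult_top)
  next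
    case C: True
    obtain x' where x': "x = ennreal x'" "0 \<le> x'" using assms(2) by (cases x) auto
    have "A * x' \<le> B * x'" using assms(1,3,4) C x' by (simp add: ennreal_mult[symmetric] ennreal_le_iff)
    moreover have "B * x' < A * x'" if "x' \<noteq> 0"
      using assms(3) x' that by (intro mult_strict_right_mono) auto
    ultimately have "x' = 0" by fastforce
    then show ?thesis using x' by simp
  qed
next
  case False
  then obtain y' where y': "y = ennreal y'" "0 \<le> y'" by (cases y) auto
  obtain x' where x': "x = ennreal x'" "0 \<le> x'" using assms(2) by (cases x) auto
  have "A * x' \<le> B * x' + C * y'"
    using assms x' y' by (simp add: ennreal_mult[symmetric] ennreal_plus[symmetric] ennreal_le_iff del: ennreal_plus)
  then have "x' \<le> C / (A - B) * y'" using assms by (simp add: field_simps)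
  then show ?thesis using assms x' y' by (simp add: ennreal_mult[symmetric] ennreal_leI)
qed

text \<open>
  Since \<open>2 ^ (k+1) \<Delta>\<^sub>k F(r/2) = \<Delta>\<^sub>k F(r) - \<Delta>\<^sub>k\<^sub>+\<^sub>1 F(r)\<close> and the dilation by \<open>2\<close> multiplies the
  weighted integral of a square by \<open>2 powr (2 s)\<close>, the integral \<open>I\<close> of order \<open>k\<close> and the integral
  \<open>J\<close> of order \<open>k + 1\<close> satisfy \<open>A I \<le> (1 + \<eta>) I + (1 + 1/\<eta>) J\<close> for every \<open>\<eta> > 0\<close>. The condition
  \<open>s < k + 1\<close> says that \<open>A > 1\<close>, so \<open>I\<close> can be absorbed for small \<open>\<eta>\<close>. To know that \<open>I\<close> is finite
  beforehand, it is truncated to \<open>r > \<epsilon>\<close>; halving the radius respects this truncation.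
\<close>
lemma nn_integral_Delta_le_Suc:
  fixes F :: "real \<Rightarrow> real"
  assumes [measurable]: "F \<in> borel_measurable borel" and bounded: "\<And>r. \<bar>F r\<bar> \<le> B"
    and s: "0 < s" "s < real (k + 1)"
  defines "A \<equiv> 2 powr (2 * (real (k + 1) - s))"
  shows "(\<integral>\<^sup>+ r. ennreal (indicator {0<..} r * r powr (- 2 * s - 1) * (Delta k F r)\<^sup>2) \<partial>lborel)
     \<le> ennreal (2 * (A + 1) / (A - 1)\<^sup>2)
        * (\<integral>\<^sup>+ r. ennreal (indicator {0<..} r * r powr (- 2 * s - 1) * (Delta (Suc k) F r)\<^sup>2) \<partial>lborel)"
    (is "_ \<le> ennreal ?K * ?J")
proof -
  have [measurable]: "Delta k F \<in> borel_measurable borel" "Delta (Suc k) F \<in> borel_measurable borel"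
    by (intro measurable_Delta assms)+
  have A: "1 < A" unfolding A_def using s by simp
  define I where "I \<epsilon> = (\<integral>\<^sup>+ r. ennreal (indicator {\<epsilon><..} r * r powr (- 2 * s - 1) * (Delta k F r)\<^sup>2) \<partial>lborel)" for \<epsilon>
  have trunc: "I \<epsilon> \<le> ennreal ?K * ?J" if \<epsilon>: "0 < \<epsilon>" for \<epsilon>
  proof -
    have "\<bar>Delta k F r\<bar> \<le> Delta_mass k * B" for r by (rule abs_Delta_le) (rule bounded)
    then have Delta_sq: "(Delta k F r)\<^sup>2 \<le> (Delta_mass k * B)\<^sup>2" for r
      by (metis abs_ge_zero power2_abs power_mono)
    have "I \<epsilon> \<le> (\<integral>\<^sup>+ r. ennreal ((Delta_mass k * B)\<^sup>2) * ennreal (indicator {\<epsilon><..} r * r powr (- 2 * s - 1)) \<partial>lborel)"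
      unfolding I_def
    proof (intro nn_integral_mono)
      fix r
      have "(indicator {\<epsilon><..} r * r powr (- 2 * s - 1)) * (Delta k F r)\<^sup>2
          \<le> (indicator {\<epsilon><..} r * r powr (- 2 * s - 1)) * (Delta_mass k * B)\<^sup>2"
        using Delta_sq by (intro mult_left_mono) auto
      then show "ennreal (indicator {\<epsilon><..} r * r powr (- 2 * s - 1) * (Delta k F r)\<^sup>2)
          \<le> ennreal ((Delta_mass k * B)\<^sup>2) * ennreal (indicator {\<epsilon><..} r * r powr (- 2 * s - 1))"
        by (subst ennreal_mult''[symmetric]) (auto intro: ennreal_leI simp: mult.commute)
    qed
    also have "\<dots> = ennreal ((Delta_mass k * B)\<^sup>2) * ennreal (\<epsilon> powr (- 2 * s - 1 + 1) / - (- 2 * s - 1 + 1))"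
      using s \<epsilon> by (simp add: nn_integral_cmult nn_integral_powr_Ioi)
    also have "\<dots> < \<top>" by (simp add: ennreal_mult_less_top)
    finally have fin: "I \<epsilon> < \<top>" .
    define L :: real where "L = 2 ^ (k + 1)"
    have L: "0 < L" by (simp add: L_def)
    have LA: "L\<^sup>2 * 2 powr (- 2 * s) = A"
    proof -
      have "L\<^sup>2 = 2 ^ (2 * (k + 1))" unfolding L_def power_mult[symmetric] by (simp only: mult.commute)
      also have "\<dots> = 2 powr (2 * real (k + 1))"
        by (subst powr_realpow[symmetric]) (simp_all only: of_nat_mult of_nat_numeral zero_less_numeral)
      finally have "L\<^sup>2 = 2 powr (2 * real (k + 1))" .
      then show ?thesis unfolding A_def by (simp add: powr_add[symmetric] right_diff_distrib)
    qed
    have "(\<integral>\<^sup>+ r. ennreal (indicator {2 * \<epsilon><..} r * r powr (- 2 * s - 1) * (L * Delta k F (r / 2))\<^sup>2) \<partial>lborel)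
        = ennreal 2 * (\<integral>\<^sup>+ r. ennreal (indicator {2 * \<epsilon><..} (2 * r) * (2 * r) powr (- 2 * s - 1) * (L * Delta k F r)\<^sup>2) \<partial>lborel)"
      by (subst nn_integral_real_affine[of _ 2 0]) auto
    also have "\<dots> = (\<integral>\<^sup>+ r. ennreal A * ennreal (indicator {\<epsilon><..} r * r powr (- 2 * s - 1) * (Delta k F r)\<^sup>2) \<partial>lborel)"
    proof (subst nn_integral_cmult[symmetric], simp, intro nn_integral_cong)
      fix r :: real
      show "ennreal 2 * ennreal (indicator {2 * \<epsilon><..} (2 * r) * (2 * r) powr (- 2 * s - 1) * (L * Delta k F r)\<^sup>2)
          = ennreal A * ennreal (indicator {\<epsilon><..} r * r powr (- 2 * s - 1) * (Delta k F r)\<^sup>2)"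
      proof (cases "\<epsilon> < r")
        case True
        then have "0 < r" using \<epsilon> by simp
        have "2 * (2 * r) powr (- 2 * s - 1) = 2 powr 1 * (2 powr (- 2 * s - 1) * r powr (- 2 * s - 1))"
          using \<open>0 < r\<close> by (simp add: powr_mult)
        also have "\<dots> = 2 powr (- 2 * s) * r powr (- 2 * s - 1)"
          unfolding mult.assoc[symmetric] powr_add[symmetric] by simp
        finally have "2 * (2 * r) powr (- 2 * s - 1) * (L * Delta k F r)\<^sup>2
           = A * (r powr (- 2 * s - 1) * (Delta k F r)\<^sup>2)"
          unfolding LA[symmetric] by (simp add: power_mult_distrib mult_ac)
        then have "ennreal (2 * ((2 * r) powr (- 2 * s - 1) * (L * Delta k F r)\<^sup>2))
           = ennreal (A * (r powr (- 2 * s - 1) * (Delta k F r)\<^sup>2))" by (simp only: mult.assoc)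
        then show ?thesis using True A by (simp only: ennreal_mult' ennreal_mult) (simp add: ennreal_mult)
      qed simp
    qed
    also have "\<dots> = ennreal A * I \<epsilon>" by (simp add: I_def nn_integral_cmult)
    finally have scaled: "ennreal A * I \<epsilon> = (\<integral>\<^sup>+ r. ennreal (indicator {2 * \<epsilon><..} r * r powr (- 2 * s - 1) * (L * Delta k F (r / 2))\<^sup>2) \<partial>lborel)"
      by simp
    \<comment> \<open>This \<open>\<eta>\<close> puts \<open>1 + \<eta>\<close> halfway between \<open>1\<close> and \<open>A\<close>.\<close>
    define \<eta> where "\<eta> = (A - 1) / 2"
    have \<eta>: "0 < \<eta>" using A by (simp add: \<eta>_def)
    have "ennreal A * I \<epsilon> \<le> (\<integral>\<^sup>+ r. ennreal (1 + \<eta>) * ennreal (indicator {\<epsilon><..} r * r powr (- 2 * s - 1) * (Delta k F r)\<^sup>2)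
            + ennreal (1 + 1 / \<eta>) * ennreal (indicator {0<..} r * r powr (- 2 * s - 1) * (Delta (Suc k) F r)\<^sup>2) \<partial>lborel)"
      unfolding scaled
    proof (intro nn_integral_mono)
      fix r :: real
      have ineq: "(u - v)\<^sup>2 \<le> (1 + \<eta>) * u\<^sup>2 + (1 + 1 / \<eta>) * v\<^sup>2" for u v :: real
      proof -
        have "(1 + \<eta>) * u\<^sup>2 + (1 + 1 / \<eta>) * v\<^sup>2 - (u - v)\<^sup>2 = (\<eta> * u + v)\<^sup>2 / \<eta>"
          using \<eta> by (simp add: field_simps power2_eq_square)
        then show ?thesis using \<eta> by (smt (verit) divide_nonneg_pos zero_le_power2)
      qed
      have "L * Delta k F (r / 2) = Delta k F r - Delta (Suc k) F r" by (simp add: L_def)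
      then have *: "(L * Delta k F (r / 2))\<^sup>2 \<le> (1 + \<eta>) * (Delta k F r)\<^sup>2 + (1 + 1 / \<eta>) * (Delta (Suc k) F r)\<^sup>2"
        by (simp only: ineq)
      show "ennreal (indicator {2 * \<epsilon><..} r * r powr (- 2 * s - 1) * (L * Delta k F (r / 2))\<^sup>2)
         \<le> ennreal (1 + \<eta>) * ennreal (indicator {\<epsilon><..} r * r powr (- 2 * s - 1) * (Delta k F r)\<^sup>2)
            + ennreal (1 + 1 / \<eta>) * ennreal (indicator {0<..} r * r powr (- 2 * s - 1) * (Delta (Suc k) F r)\<^sup>2)"
      proof (cases "2 * \<epsilon> < r")
        case True
        have "r powr (- 2 * s - 1) * (L * Delta k F (r / 2))\<^sup>2
            \<le> r powr (- 2 * s - 1) * ((1 + \<eta>) * (Delta k F r)\<^sup>2 + (1 + 1 / \<eta>) * (Delta (Suc k) F r)\<^sup>2)"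
          by (intro mult_left_mono *) simp
        also have "\<dots> = (1 + \<eta>) * (r powr (- 2 * s - 1) * (Delta k F r)\<^sup>2)
              + (1 + 1 / \<eta>) * (r powr (- 2 * s - 1) * (Delta (Suc k) F r)\<^sup>2)"
          by (simp add: algebra_simps)
        finally show ?thesis
          using True \<epsilon> \<eta>
          by (simp add: ennreal_mult[symmetric] ennreal_plus[symmetric] del: ennreal_plus Delta.simps)
      qed simp
    qed
    also have "\<dots> = ennreal (1 + \<eta>) * I \<epsilon> + ennreal (1 + 1 / \<eta>) * ?J"
      by (simp add: I_def nn_integral_add nn_integral_cmult del: Delta.simps)
    finally have "ennreal A * I \<epsilon> \<le> ennreal (1 + \<eta>) * I \<epsilon> + ennreal (1 + 1 / \<eta>) * ?J" .
    then have "I \<epsilon> \<le> ennreal ((1 + 1 / \<eta>) / (A - (1 + \<eta>))) * ?J"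
    proof (rule ennreal_absorb)
      show "1 + \<eta> < A" using A by (simp add: \<eta>_def field_simps)
    qed (use \<eta> fin in auto)
    also have "(1 + 1 / \<eta>) / (A - (1 + \<eta>)) = ?K"
      using A by (simp add: \<eta>_def field_simps power2_eq_square)
    finally show ?thesis .
  qed
  have "(\<integral>\<^sup>+ r. ennreal (indicator {0<..} r * r powr (- 2 * s - 1) * (Delta k F r)\<^sup>2) \<partial>lborel)
      = (\<integral>\<^sup>+ r. (SUP n. ennreal (indicator {1 / real (Suc n)<..} r * r powr (- 2 * s - 1) * (Delta k F r)\<^sup>2)) \<partial>lborel)"
  proof (intro nn_integral_cong antisym SUP_least)
    fix r :: real
    show "ennreal (indicator {0<..} r * r powr (- 2 * s - 1) * (Delta k F r)\<^sup>2)
       \<le> (SUP n. ennreal (indicator {1 / real (Suc n)<..} r * r powr (- 2 * s - 1) * (Delta k F r)\<^sup>2))"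
    proof (cases "0 < r")
      case True
      then obtain n where "1 / real (Suc n) < r" using reals_Archimedean[of r] by (auto simp: inverse_eq_divide)
      then show ?thesis using True by (intro SUP_upper2[of n]) auto
    qed simp
  next
    fix r :: real and n
    have "(0::real) < r" if "1 / real (Suc n) < r" by (rule less_trans[OF _ that]) simp
    then show "ennreal (indicator {1 / real (Suc n)<..} r * r powr (- 2 * s - 1) * (Delta k F r)\<^sup>2)
       \<le> ennreal (indicator {0<..} r * r powr (- 2 * s - 1) * (Delta k F r)\<^sup>2)"
      by (intro ennreal_leI mult_right_mono) (auto simp: indicator_def)
  qed
  also have "\<dots> = (SUP n. I (1 / real (Suc n)))"
    unfolding I_def
  proof (rule nn_integral_monotone_convergence_SUP)
    show "incseq (\<lambda>n r. ennreal (indicator {1 / real (Suc n)<..} r * r powr (- 2 * s - 1) * (Delta k F r)\<^sup>2))"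
    proof (intro incseq_SucI le_funI ennreal_leI mult_right_mono)
      fix n and r :: real
      have "1 / real (Suc (Suc n)) \<le> 1 / real (Suc n)" by (intro divide_left_mono) auto
      then show "indicator {1 / real (Suc n)<..} r \<le> (indicator {1 / real (Suc (Suc n))<..} r :: real)"
        by (auto simp: indicator_def)
    qed auto
  qed auto
  also have "\<dots> \<le> ennreal ?K * ?J"
    by (intro SUP_least trunc) simp
  finally show ?thesis .
qed

lemma nn_integral_Delta_le_higher:
  assumes "0 < s" "s < real (k + 1)" "k \<le> l"
  shows "\<exists>K>0. \<forall>F B. F \<in> borel_measurable borel \<longrightarrow> (\<forall>r. \<bar>F r\<bar> \<le> B) \<longrightarrow>
     (\<integral>\<^sup>+ r. ennreal (indicator {0<..} r * r powr (- 2 * s - 1) * (Delta k F r)\<^sup>2) \<partial>lborel)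
     \<le> ennreal K
        * (\<integral>\<^sup>+ r. ennreal (indicator {0<..} r * r powr (- 2 * s - 1) * (Delta l F r)\<^sup>2) \<partial>lborel)"
  using \<open>k \<le> l\<close>
proof (induction l rule: dec_induct)
  case base
  show ?case by (intro exI[of _ 1]) simp
next
  case (step l)
  then obtain K where K: "0 < K" "\<And>F B. F \<in> borel_measurable borel \<Longrightarrow> (\<And>r. \<bar>F r\<bar> \<le> B) \<Longrightarrow>
     (\<integral>\<^sup>+ r. ennreal (indicator {0<..} r * r powr (- 2 * s - 1) * (Delta k F r)\<^sup>2) \<partial>lborel)
     \<le> ennreal K
        * (\<integral>\<^sup>+ r. ennreal (indicator {0<..} r * r powr (- 2 * s - 1) * (Delta l F r)\<^sup>2) \<partial>lborel)"
    by blast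
  define A where "A = 2 powr (2 * (real (l + 1) - s))"
  define K' where "K' = 2 * (A + 1) / (A - 1)\<^sup>2"
  have "1 < A" unfolding A_def using assms step by simp
  then have "0 < K'" by (simp add: K'_def)
  show ?case
  proof (intro exI[of _ "K * K'"] conjI allI impI)
    fix F :: "real \<Rightarrow> real" and B
    assume F: "F \<in> borel_measurable borel" "\<forall>r. \<bar>F r\<bar> \<le> B"
    have "(\<integral>\<^sup>+ r. ennreal (indicator {0<..} r * r powr (- 2 * s - 1) * (Delta k F r)\<^sup>2) \<partial>lborel)
     \<le> ennreal K
        * (\<integral>\<^sup>+ r. ennreal (indicator {0<..} r * r powr (- 2 * s - 1) * (Delta l F r)\<^sup>2) \<partial>lborel)"
      using F by (intro K) auto
    also have "\<dots> \<le> ennreal K * (ennreal K'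
        * (\<integral>\<^sup>+ r. ennreal (indicator {0<..} r * r powr (- 2 * s - 1) * (Delta (Suc l) F r)\<^sup>2) \<partial>lborel))"
      unfolding K'_def A_def using F assms step
      by (intro mult_left_mono nn_integral_Delta_le_Suc[where B = B]) auto
    finally show "(\<integral>\<^sup>+ r. ennreal (indicator {0<..} r * r powr (- 2 * s - 1) * (Delta k F r)\<^sup>2) \<partial>lborel)
     \<le> ennreal (K * K')
        * (\<integral>\<^sup>+ r. ennreal (indicator {0<..} r * r powr (- 2 * s - 1) * (Delta (Suc l) F r)\<^sup>2) \<partial>lborel)"
      using \<open>0 < K\<close> \<open>0 < K'\<close> by (simp add: ennreal_mult mult.assoc)
  qed (use \<open>0 < K\<close> \<open>0 < K'\<close> in simp)
qed

section \<open>Square variation along dyadic points\<close>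

text \<open>
  The indices \<open>k\<close> of the dyadic intervals \<open>[k / 2^n, (k+1) / 2^n]\<close> that lie in
  \<open>[i / 2^N, j / 2^N]\<close>, with denominators cleared so that only natural numbers occur.
\<close>
definition dyadic_inside :: "nat \<Rightarrow> nat \<Rightarrow> nat \<Rightarrow> nat \<Rightarrow> nat set" where
  "dyadic_inside N i j n = {k. i * 2 ^ n \<le> k * 2 ^ N \<and> (k + 1) * 2 ^ N \<le> j * 2 ^ n}"

lemma finite_dyadic_inside: "finite (dyadic_inside N i j n)"
proof (rule finite_subset)
  show "dyadic_inside N i j n \<subseteq> {..<j * 2 ^ n}"
  proof
    fix k assume "k \<in> dyadic_inside N i j n"
    then have "(k + 1) * 2 ^ N \<le> j * 2 ^ n" by (simp add: dyadic_inside_def)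
    moreover have "(k + 1) * 1 \<le> (k + 1) * 2 ^ N" by (intro mult_left_mono) simp_all
    ultimately show "k \<in> {..<j * 2 ^ n}" by simp
  qed
qed simp

lemma dyadic_inside_halve:
  assumes "i \<le> 2 * i'" "2 * j' \<le> j"
  shows "dyadic_inside N i' j' n \<subseteq> dyadic_inside (Suc N) i j n"
proof
  fix k assume "k \<in> dyadic_inside N i' j' n"
  then have 1: "i' * 2 ^ n \<le> k * 2 ^ N" "(k + 1) * 2 ^ N \<le> j' * 2 ^ n"
    by (auto simp: dyadic_inside_def)
  have "i * 2 ^ n \<le> 2 * (i' * 2 ^ n)" "2 * (j' * 2 ^ n) \<le> j * 2 ^ n"
    using mult_right_mono[OF assms(1), of "2 ^ n"] mult_right_mono[OF assms(2), of "2 ^ n"] by simp_all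
  moreover have "2 * (i' * 2 ^ n) \<le> 2 * (k * 2 ^ N)" "2 * ((k + 1) * 2 ^ N) \<le> 2 * (j' * 2 ^ n)"
    using 1 by simp_all
  ultimately show "k \<in> dyadic_inside (Suc N) i j n"
    unfolding dyadic_inside_def mem_Collect_eq power_Suc
    by (metis (no_types, lifting) le_trans mult.left_commute)
qed

lemma dyadic_inside_subset: "j \<le> 2 ^ N \<Longrightarrow> dyadic_inside N i j n \<subseteq> {..<2 ^ n}"
proof
  fix k assume "j \<le> 2 ^ N" "k \<in> dyadic_inside N i j n"
  then have "(k + 1) * 2 ^ N \<le> 2 ^ N * 2 ^ n"
    by (auto simp: dyadic_inside_def intro: order_trans[OF _ mult_right_mono[of j "2 ^ N"]])
  then have "(k + 1) * 2 ^ N \<le> 2 ^ n * 2 ^ N" by (simp only: mult.commute)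
  then show "k \<in> {..<2 ^ n}" unfolding mult_le_cancel2 by simp
qed

lemma dyadic_inside_disjoint:
  assumes "j \<le> i'"
  shows "dyadic_inside N i j n \<inter> dyadic_inside N i' j' n = {}"
proof (rule ccontr)
  assume "\<not> ?thesis"
  then obtain k where k: "(k + 1) * 2 ^ N \<le> j * 2 ^ n" "i' * 2 ^ n \<le> k * 2 ^ N"
    by (auto simp: dyadic_inside_def)
  have "j * 2 ^ n \<le> i' * 2 ^ n" using assms by simp
  with k have "(k + 1) * 2 ^ N \<le> k * 2 ^ N" by linarith
  then show False by simp
qed

text \<open>
  Chaining, downwards from the finest level: rounding \<open>i\<close> up and \<open>j\<close> down to even numbers costs at
  most one increment of level \<open>N\<close> at each end, and the rounded points belong to level \<open>N - 1\<close>.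
  All intervals used remain inside the given one, which is what makes the bound additive over
  disjoint intervals later.
\<close>
lemma grid_increment_le_dyadic:
  fixes G :: "nat \<Rightarrow> nat \<Rightarrow> real"
  assumes refine: "\<And>n i. G (Suc n) (2 * i) = G n i" and "i \<le> j" "j \<le> 2 ^ N"
  shows "\<bar>G N j - G N i\<bar> \<le> 2 * (\<Sum>n\<le>N. sqrt (\<Sum>k\<in>dyadic_inside N i j n. (G n (k + 1) - G n k)\<^sup>2))"
  using assms(2,3)
proof (induction N arbitrary: i j)
  case 0
  show ?case
  proof (cases "i = j")
    case False
    then have "i = 0" "j = 1" using 0 by auto
    moreover have "dyadic_inside 0 0 1 0 = {0}" by (auto simp: dyadic_inside_def)
    ultimately show ?thesis by simp
  qed (auto intro!: sum_nonneg)
next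
  case (Suc N)
  define q where "q n k = (G n (k + 1) - G n k)\<^sup>2" for n k
  define A where "A n = (\<Sum>k\<in>dyadic_inside (Suc N) i j n. q n k)" for n
  have A_nonneg: "0 \<le> A n" for n by (simp add: A_def q_def sum_nonneg)
  have one: "\<bar>G (Suc N) (k + 1) - G (Suc N) k\<bar> \<le> sqrt (A (Suc N))" if "i \<le> k" "k + 1 \<le> j" for k
  proof -
    have "(k + 1) * 2 ^ Suc N \<le> j * 2 ^ Suc N" by (rule mult_right_mono[OF that(2) zero_le])
    then have "k \<in> dyadic_inside (Suc N) i j (Suc N)"
      using that(1) by (simp add: dyadic_inside_def del: power_Suc)
    then have "q (Suc N) k \<le> A (Suc N)" unfolding A_def
      by (rule member_le_sum) (simp_all add: q_def finite_dyadic_inside)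
    then show ?thesis by (simp add: q_def real_le_rsqrt)
  qed
  show ?case
  proof (cases "i = j")
    case True
    then show ?thesis by (simp add: sum_nonneg del: sum.atMost_Suc)
  next
    case False
    \<comment> \<open>\<open>i' \<le> j'\<close> since \<open>i < j\<close>; for \<open>i = j\<close> odd it would fail, hence the separate case.\<close>
    define i' j' where "i' = (i + 1) div 2" and "j' = j div 2"
    have ij: "i \<le> 2 * i'" "2 * i' \<le> i + 1" "2 * j' \<le> j" "j \<le> 2 * j' + 1" "i' \<le> j'" "j' \<le> 2 ^ N"
      using False Suc.prems by (auto simp: i'_def j'_def)
    have "\<bar>G N j' - G N i'\<bar> \<le> 2 * (\<Sum>n\<le>N. sqrt (\<Sum>k\<in>dyadic_inside N i' j' n. q n k))"
      using Suc.IH[OF ij(5,6)] by (simp add: q_def)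
    also have "\<dots> \<le> 2 * (\<Sum>n\<le>N. sqrt (A n))"
      unfolding A_def
      by (intro mult_left_mono sum_mono real_sqrt_le_mono sum_mono2 finite_dyadic_inside
                dyadic_inside_halve ij) (auto simp: q_def)
    finally have mid: "\<bar>G (Suc N) (2 * j') - G (Suc N) (2 * i')\<bar> \<le> 2 * (\<Sum>n\<le>N. sqrt (A n))"
      by (simp only: refine)
    have left: "\<bar>G (Suc N) (2 * i') - G (Suc N) i\<bar> \<le> sqrt (A (Suc N))"
    proof (cases "2 * i' = i")
      case True
      then show ?thesis by (simp add: A_nonneg)
    next
      case False
      then have "2 * i' = i + 1" using ij by simp
      then show ?thesis using one[of i] \<open>i \<noteq> j\<close> Suc.prems by simp
    qed
    have right: "\<bar>G (Suc N) j - G (Suc N) (2 * j')\<bar> \<le> sqrt (A (Suc N))"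
    proof (cases "2 * j' = j")
      case True
      then show ?thesis by (simp add: A_nonneg)
    next
      case False
      then have "j = 2 * j' + 1" using ij by simp
      then show ?thesis using one[of "2 * j'"] ij by simp
    qed
    have "\<bar>G (Suc N) j - G (Suc N) i\<bar> \<le> 2 * (\<Sum>n\<le>Suc N. sqrt (A n))"
      using left mid right by simp
    then show ?thesis by (simp only: A_def q_def)
  qed
qed

text \<open>
  Cauchy-Schwarz against the geometric weights \<open>\<kappa> powr (-n)\<close>.
\<close>
lemma square_sum_le_geometric:
  fixes a :: "nat \<Rightarrow> real"
  assumes "1 < \<kappa>"
  shows "(\<Sum>n\<le>N. a n)\<^sup>2 \<le> \<kappa> / (\<kappa> - 1) * (\<Sum>n\<le>N. \<kappa> ^ n * (a n)\<^sup>2)"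
proof -
  have "(\<Sum>n\<le>N. a n)\<^sup>2 = (\<Sum>n\<le>N. sqrt (1 / \<kappa> ^ n) * (sqrt (\<kappa> ^ n) * a n))\<^sup>2"
    using assms by (intro arg_cong[where f = "\<lambda>x. x\<^sup>2"] sum.cong) (auto simp: real_sqrt_divide)
  also have "\<dots> \<le> (\<Sum>n\<le>N. (sqrt (1 / \<kappa> ^ n))\<^sup>2) * (\<Sum>n\<le>N. (sqrt (\<kappa> ^ n) * a n)\<^sup>2)"
    by (rule Cauchy_Schwarz_ineq_sum)
  also have "\<dots> = (\<Sum>n\<le>N. (1 / \<kappa>) ^ n) * (\<Sum>n\<le>N. \<kappa> ^ n * (a n)\<^sup>2)"
    using assms by (simp add: power_mult_distrib power_one_over)
  also have "\<dots> \<le> \<kappa> / (\<kappa> - 1) * (\<Sum>n\<le>N. \<kappa> ^ n * (a n)\<^sup>2)"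
  proof (rule mult_right_mono)
    have "(\<Sum>n\<le>N. (1 / \<kappa>) ^ n) \<le> (\<Sum>n. (1 / \<kappa>) ^ n)"
      using assms by (intro sum_le_suminf summable_geometric) auto
    also have "\<dots> = \<kappa> / (\<kappa> - 1)"
      using assms by (subst suminf_geometric) (auto simp: field_simps)
    finally show "(\<Sum>n\<le>N. (1 / \<kappa>) ^ n) \<le> \<kappa> / (\<kappa> - 1)" .
  qed (use assms in \<open>auto intro!: sum_nonneg\<close>)
  finally show ?thesis .
qed

text \<open>
  The dyadic intervals inside different intervals \<open>[i h, i (Suc h)]\<close> are different, so the
  individual chaining bounds add up to at most the sum over all dyadic intervals.
\<close>
lemma grid_sequence_square_sum_le_dyadic:
  fixes G :: "nat \<Rightarrow> nat \<Rightarrow> real"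
  assumes refine: "\<And>n i. G (Suc n) (2 * i) = G n i" and "1 < \<kappa>"
    and mono: "\<And>h. h < l \<Longrightarrow> i h \<le> i (Suc h)" and last: "i l \<le> 2 ^ N"
  shows "(\<Sum>h<l. (G N (i (Suc h)) - G N (i h))\<^sup>2)
           \<le> 4 * \<kappa> / (\<kappa> - 1) * (\<Sum>n\<le>N. \<kappa> ^ n * (\<Sum>k<2 ^ n. (G n (k + 1) - G n k)\<^sup>2))"
proof -
  define q where "q n k = (G n (k + 1) - G n k)\<^sup>2" for n k
  define D where "D h n = dyadic_inside N (i h) (i (Suc h)) n" for h n
  have i_mono: "i h \<le> i h'" if "h \<le> h'" "h' \<le> l" for h h'
    using that
  proof (induction h' rule: dec_induct)
    case (step h')
    then show ?case using mono[of h'] by auto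
  qed simp
  have one: "(G N (i (Suc h)) - G N (i h))\<^sup>2 \<le> 4 * \<kappa> / (\<kappa> - 1) * (\<Sum>n\<le>N. \<kappa> ^ n * (\<Sum>k\<in>D h n. q n k))"
    if h: "h < l" for h
  proof -
    have "\<bar>G N (i (Suc h)) - G N (i h)\<bar> \<le> 2 * (\<Sum>n\<le>N. sqrt (\<Sum>k\<in>D h n. q n k))"
      unfolding D_def q_def
      using i_mono[of "Suc h" l] h last by (intro grid_increment_le_dyadic refine mono) auto
    then have "(G N (i (Suc h)) - G N (i h))\<^sup>2 \<le> (2 * (\<Sum>n\<le>N. sqrt (\<Sum>k\<in>D h n. q n k)))\<^sup>2"
      by (rule abs_le_square_iff[THEN iffD1, OF order_trans[OF _ abs_ge_self]])
    also have "\<dots> = 4 * (\<Sum>n\<le>N. sqrt (\<Sum>k\<in>D h n. q n k))\<^sup>2"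
      by (simp add: power_mult_distrib)
    also have "\<dots> \<le> 4 * (\<kappa> / (\<kappa> - 1) * (\<Sum>n\<le>N. \<kappa> ^ n * (sqrt (\<Sum>k\<in>D h n. q n k))\<^sup>2))"
      by (intro mult_left_mono square_sum_le_geometric assms) simp
    also have "\<dots> = 4 * \<kappa> / (\<kappa> - 1) * (\<Sum>n\<le>N. \<kappa> ^ n * (\<Sum>k\<in>D h n. q n k))"
      by (simp add: q_def sum_nonneg)
    finally show ?thesis .
  qed
  have "(\<Sum>h<l. (G N (i (Suc h)) - G N (i h))\<^sup>2)
      \<le> (\<Sum>h<l. 4 * \<kappa> / (\<kappa> - 1) * (\<Sum>n\<le>N. \<kappa> ^ n * (\<Sum>k\<in>D h n. q n k)))"
    by (intro sum_mono one) simp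
  also have "\<dots> = 4 * \<kappa> / (\<kappa> - 1) * (\<Sum>n\<le>N. \<kappa> ^ n * (\<Sum>h<l. \<Sum>k\<in>D h n. q n k))"
    unfolding sum_distrib_left by (rule sum.swap)
  also have "\<dots> \<le> 4 * \<kappa> / (\<kappa> - 1) * (\<Sum>n\<le>N. \<kappa> ^ n * (\<Sum>k<2 ^ n. q n k))"
  proof (intro mult_left_mono sum_mono)
    fix n
    have disj: "D h n \<inter> D h' n = {}" if "h < h'" "h' < l" for h h'
      unfolding D_def using that by (intro dyadic_inside_disjoint i_mono) auto
    have "(\<Sum>h<l. \<Sum>k\<in>D h n. q n k) = sum (q n) (\<Union>h<l. D h n)"
      using disj by (intro sum.UNION_disjoint[symmetric])
        (auto simp: D_def finite_dyadic_inside, metis disjoint_iff linorder_neqE_nat)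
    also have "\<dots> \<le> (\<Sum>k<2 ^ n. q n k)"
    proof (rule sum_mono2)
      show "(\<Union>h<l. D h n) \<subseteq> {..<2 ^ n}"
        unfolding D_def using i_mono[of _ l] last
        by (intro UN_least dyadic_inside_subset) (metis Suc_leI le_trans lessThan_iff order_refl)
    qed (auto simp: q_def)
    finally show "(\<Sum>h<l. \<Sum>k\<in>D h n. q n k) \<le> (\<Sum>k<2 ^ n. q n k)" .
  qed (use assms in auto)
  finally show ?thesis by (simp only: q_def)
qed

lemma floor_dyadic_tendsto:
  fixes x :: real
  shows "(\<lambda>n. of_int \<lfloor>x * 2 ^ n\<rfloor> / 2 ^ n) \<longlonglongrightarrow> x"
proof (rule real_tendsto_sandwich)
  show "\<forall>\<^sub>F n in sequentially. x - (1 / 2) ^ n \<le> of_int \<lfloor>x * 2 ^ n\<rfloor> / 2 ^ n"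
  proof (intro always_eventually allI)
    fix n
    have "(x * 2 ^ n - 1) / 2 ^ n \<le> of_int \<lfloor>x * 2 ^ n\<rfloor> / 2 ^ n"
      by (intro divide_right_mono) (linarith, simp)
    then show "x - (1 / 2) ^ n \<le> of_int \<lfloor>x * 2 ^ n\<rfloor> / 2 ^ n"
      by (simp add: diff_divide_distrib power_one_over)
  qed
  show "\<forall>\<^sub>F n in sequentially. of_int \<lfloor>x * 2 ^ n\<rfloor> / 2 ^ n \<le> x"
  proof (intro always_eventually allI)
    fix n
    have "of_int \<lfloor>x * 2 ^ n\<rfloor> / 2 ^ n \<le> (x * 2 ^ n) / 2 ^ n"
      by (intro divide_right_mono) (linarith, simp)
    then show "of_int \<lfloor>x * 2 ^ n\<rfloor> / 2 ^ n \<le> x" by simp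
  qed
  show "(\<lambda>n. x - (1 / 2) ^ n) \<longlonglongrightarrow> x"
    by (auto intro!: tendsto_eq_intros LIMSEQ_realpow_zero)
qed simp

text \<open>
  Round the points of the partition down to the grid of level \<open>N\<close> and let \<open>N\<close> tend to infinity;
  the bound for grid points does not depend on \<open>N\<close>, and \<open>g\<close> is continuous.
\<close>
lemma square_variation_le_dyadic:
  fixes g :: "real \<Rightarrow> real"
  assumes "a \<le> b" and cont: "continuous_on {a..b} g" and "1 < \<kappa>"
    and mono: "\<And>h. h < l \<Longrightarrow> t h \<le> t (Suc h)" and first: "a \<le> t 0" and last: "t l \<le> b"
  shows "(\<Sum>h<l. ennreal ((g (t (Suc h)) - g (t h))\<^sup>2))
           \<le> (\<Sum>n. \<Sum>k<2 ^ n. ennreal (4 * \<kappa> / (\<kappa> - 1) * \<kappa> ^ n *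
                 (g (a + (b - a) * real (k + 1) / 2 ^ n) - g (a + (b - a) * real k / 2 ^ n))\<^sup>2))"
    (is "?L \<le> ?R")
proof -
  define G where "G n k = g (a + (b - a) * real k / 2 ^ n)" for n k
  define i where "i N h = nat \<lfloor>(t h - a) / (b - a) * 2 ^ N\<rfloor>" for N h
  have t_mono: "t h \<le> t h'" if "h \<le> h'" "h' \<le> l" for h h'
    using that
  proof (induction h' rule: dec_induct)
    case (step h')
    then show ?case using mono[of h'] by auto
  qed simp
  have t_in: "a \<le> t h" "t h \<le> b" if "h \<le> l" for h
    using t_mono[of 0 h] t_mono[of h l] that first last by auto
  have i_real: "real (i N h) = of_int \<lfloor>(t h - a) / (b - a) * 2 ^ N\<rfloor>" if "h \<le> l" for N h
    using t_in[OF that] by (simp add: i_def)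
  have fin: "(\<Sum>h<l. (G N (i N (Suc h)) - G N (i N h))\<^sup>2)
      \<le> 4 * \<kappa> / (\<kappa> - 1) * (\<Sum>n\<le>N. \<kappa> ^ n * (\<Sum>k<2 ^ n. (G n (k + 1) - G n k)\<^sup>2))" for N
  proof (rule grid_sequence_square_sum_le_dyadic[OF _ \<open>1 < \<kappa>\<close>])
    show "G (Suc n) (2 * k) = G n k" for n k by (simp add: G_def)
    show "i N h \<le> i N (Suc h)" if "h < l" for h
      unfolding i_def using mono[OF that] \<open>a \<le> b\<close>
      by (intro nat_mono floor_mono mult_right_mono divide_right_mono) auto
    have "(t l - a) / (b - a) \<le> 1" using t_in[of l] \<open>a \<le> b\<close> by (cases "a = b") auto
    then have "(t l - a) / (b - a) * 2 ^ N \<le> 1 * 2 ^ N" by (intro mult_right_mono) auto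
    then have "real (i N l) \<le> 2 ^ N" using i_real[of l N] by linarith
    then show "i N l \<le> 2 ^ N" using of_nat_le_iff[of "i N l" "2 ^ N", where 'a = real] by simp
  qed
  have fin': "(\<Sum>h<l. ennreal ((G N (i N (Suc h)) - G N (i N h))\<^sup>2)) \<le> ?R" for N
  proof -
    have "(\<Sum>h<l. ennreal ((G N (i N (Suc h)) - G N (i N h))\<^sup>2))
        = ennreal (\<Sum>h<l. (G N (i N (Suc h)) - G N (i N h))\<^sup>2)"
      by (simp add: sum_ennreal)
    also have "\<dots> \<le> ennreal (4 * \<kappa> / (\<kappa> - 1) * (\<Sum>n\<le>N. \<kappa> ^ n * (\<Sum>k<2 ^ n. (G n (k + 1) - G n k)\<^sup>2)))"
      by (intro ennreal_leI fin)
    also have "\<dots> = (\<Sum>n\<le>N. \<Sum>k<2 ^ n. ennreal (4 * \<kappa> / (\<kappa> - 1) * \<kappa> ^ n * (G n (k + 1) - G n k)\<^sup>2))"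
      using \<open>1 < \<kappa>\<close>
      by (simp add: sum_ennreal sum_distrib_left mult.assoc sum_nonneg del: sum.lessThan_Suc)
    also have "\<dots> \<le> ?R" unfolding G_def by (rule sum_le_suminf) auto
    finally show ?thesis .
  qed
  have conv: "(\<lambda>N. a + (b - a) * real (i N h) / 2 ^ N) \<longlonglongrightarrow> t h" if "h \<le> l" for h
  proof (cases "a = b")
    case True
    then show ?thesis using t_in[OF that] by simp
  next
    case False
    with \<open>a \<le> b\<close> have "a < b" by simp
    let ?\<theta> = "(t h - a) / (b - a)"
    have "(\<lambda>N. of_int \<lfloor>?\<theta> * 2 ^ N\<rfloor> / 2 ^ N) \<longlonglongrightarrow> ?\<theta>"
      by (rule floor_dyadic_tendsto)
    then have "(\<lambda>N. a + (b - a) * (of_int \<lfloor>?\<theta> * 2 ^ N\<rfloor> / 2 ^ N)) \<longlonglongrightarrow> a + (b - a) * ?\<theta>"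
      by (intro tendsto_add tendsto_mult tendsto_const)
    then show ?thesis using \<open>a < b\<close> i_real[OF that] by simp
  qed
  have grid_in: "a + (b - a) * real (i N h) / 2 ^ N \<in> {a..b}" if "h \<le> l" for N h
  proof -
    let ?\<theta> = "(t h - a) / (b - a)"
    have \<theta>: "0 \<le> ?\<theta>" "?\<theta> \<le> 1" using t_in[OF that] \<open>a \<le> b\<close> by (auto simp: divide_le_eq_1)
    have "real (i N h) \<le> ?\<theta> * 2 ^ N" unfolding i_real[OF that] by linarith
    also have "\<dots> \<le> 1 * 2 ^ N" by (intro mult_right_mono \<theta>) simp
    finally have 2: "real (i N h) / 2 ^ N \<le> 1" by simp
    have "(b - a) * (real (i N h) / 2 ^ N) \<le> (b - a) * 1" using 2 \<open>a \<le> b\<close> by (intro mult_left_mono) auto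
    then show ?thesis using \<open>a \<le> b\<close> by simp
  qed
  have G_lim: "(\<lambda>N. G N (i N h)) \<longlonglongrightarrow> g (t h)" if "h \<le> l" for h
    unfolding G_def
    using continuous_on_tendsto_compose[OF cont conv[OF that]] t_in[OF that] grid_in[OF that] by simp
  have "(\<lambda>N. \<Sum>h<l. ennreal ((G N (i N (Suc h)) - G N (i N h))\<^sup>2)) \<longlonglongrightarrow> ?L"
    by (intro tendsto_intros tendsto_ennrealI G_lim) auto
  then show ?thesis
    by (rule LIMSEQ_le_const2) (use fin' in auto)
qed

section \<open>Energies of occupation measures\<close>

lemma emeasure_Icc_finite: "emeasure lborel {s..t::real} < \<infinity>"
  by (simp add: emeasure_lborel_Icc_eq)

lemma integrable_mult_indicator_Icc: "integrable lborel (\<lambda>\<tau>. c * indicat_real {s..t::real} \<tau>)"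
  by (intro integrable_mult_right integrable_real_indicator emeasure_Icc_finite) simp

text \<open>
  The kernel whose convolution with a measure gives \<open>\<Delta>\<^sub>k\<close> of the ball masses.
\<close>
definition Delta_kernel :: "nat \<Rightarrow> real \<Rightarrow> 'a::euclidean_space \<Rightarrow> real" where
  "Delta_kernel k r z = Delta k (\<lambda>\<rho>. indicat_real (cball 0 \<rho>) z) r"

lemma Delta_kernel_eq_sum: "Delta_kernel k r z = (\<Sum>j\<le>Suc k. Delta_coeff k j * indicat_real (cball 0 (r / 2 ^ j)) z)"
  unfolding Delta_kernel_def by (rule Delta_eq_sum)

lemma measurable_Delta_kernel [measurable (raw)]:
  fixes g :: "'b \<Rightarrow> 'a::euclidean_space"
  assumes [measurable]: "f \<in> borel_measurable N" "g \<in> borel_measurable N"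
  shows "(\<lambda>x. Delta_kernel k (f x) (g x)) \<in> borel_measurable N"
proof -
  have "(\<lambda>x. Delta_kernel k (f x) (g x))
      = (\<lambda>x. \<Sum>j\<le>Suc k. Delta_coeff k j * (if norm (g x) \<le> f x / 2 ^ j then 1 else 0))"
    unfolding Delta_kernel_eq_sum by (intro ext sum.cong) (auto simp: indicator_def)
  then show ?thesis by simp
qed

lemma abs_Delta_kernel_le: "\<bar>Delta_kernel k r z\<bar> \<le> Delta_mass k"
  using abs_Delta_le[of "\<lambda>\<rho>. indicat_real (cball 0 \<rho>) z" r 1 k] by (simp add: Delta_kernel_def indicator_def)

lemma abs_Delta_kernel_le_indicator:
  assumes "0 < r" shows "\<bar>Delta_kernel k r z\<bar> \<le> Delta_mass k * indicat_real (cball 0 r) z"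
proof (cases "norm z \<le> r")
  case True
  then show ?thesis using abs_Delta_kernel_le[of k r z] by simp
next
  case False
  have "r / 2 ^ j \<le> r" for j :: nat using assms by (simp add: divide_le_eq)
  then have "indicat_real (cball 0 (r / 2 ^ j)) z = 0" for j
    using False by (smt (verit) indicator_simps(2) mem_cball_0)
  then show ?thesis using Delta_mass_pos[of k] by (simp add: Delta_kernel_eq_sum del: sum.atMost_Suc)
qed

lemma integral_Delta_kernel_eq_Delta:
  fixes \<nu> :: "'a::euclidean_space measure"
  assumes "finite_measure \<nu>" and [measurable_cong]: "sets \<nu> = sets borel"
  shows "(LINT x|\<nu>. Delta_kernel k r (z - x)) = Delta k (\<lambda>\<rho>. measure \<nu> (cball z \<rho>)) r"
proof -
  interpret finite_measure \<nu> by fact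
  have [measurable]: "cball z \<rho> \<in> sets \<nu>" for \<rho> by (simp add: assms)
  have "(LINT x|\<nu>. Delta_kernel k r (z - x))
     = (LINT x|\<nu>. (\<Sum>j\<le>Suc k. Delta_coeff k j * indicat_real (cball z (r / 2 ^ j)) x))"
    unfolding Delta_kernel_eq_sum
    by (intro Bochner_Integration.integral_cong sum.cong) (auto simp: indicator_def dist_norm norm_minus_commute)
  also have "\<dots> = (\<Sum>j\<le>Suc k. Delta_coeff k j * measure \<nu> (cball z (r / 2 ^ j)))"
    by (subst Bochner_Integration.integral_sum)
       (auto intro!: integrable_mult_right integrable_real_indicator simp: less_top[symmetric] simp del: sum.atMost_Suc)
  finally show ?thesis by (simp only: Delta_eq_sum)
qed

text \<open>
  By \<open>Delta_occupation_eq_Delta_measure\<close> below this is \<open>\<Delta>\<^sub>k\<close> of the ball masses of the occupation measure; as an integral over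
  time it is visibly additive and Lipschitz in the end point and measurable in all parameters.
\<close>
definition Delta_occupation :: "nat \<Rightarrow> (real \<Rightarrow> 'a::euclidean_space) \<Rightarrow> real \<Rightarrow> real \<Rightarrow> 'a \<Rightarrow> real \<Rightarrow> real" where
  "Delta_occupation k x s t y r = (LINT \<tau>|lborel. indicator {s..t} \<tau> * Delta_kernel k r (y - x \<tau>))"

lemma measurable_Delta_occupation:
  assumes X [measurable]: "(\<lambda>(n, \<tau>). X n \<tau>) \<in> borel_measurable (N \<Otimes>\<^sub>M borel)"
    and [measurable]: "f \<in> borel_measurable N" "g \<in> borel_measurable N"
  shows "(\<lambda>n. Delta_occupation k (X n) s t (f n) (g n)) \<in> borel_measurable N"
  unfolding Delta_occupation_def by measurable

lemma integrable_Delta_occupation: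
  fixes x :: "real \<Rightarrow> 'a::euclidean_space"
  assumes [measurable]: "x \<in> borel_measurable borel"
  shows "integrable lborel (\<lambda>\<tau>. indicator {s..t} \<tau> * Delta_kernel k r (y - x \<tau>))"
proof (rule Bochner_Integration.integrable_bound)
  show "integrable lborel (\<lambda>\<tau>. Delta_mass k * indicat_real {s..t} \<tau>)"
    by (rule integrable_mult_indicator_Icc)
  show "AE \<tau> in lborel. norm (indicator {s..t} \<tau> * Delta_kernel k r (y - x \<tau>)) \<le> norm (Delta_mass k * indicat_real {s..t} \<tau>)"
    using abs_Delta_kernel_le[of k r] Delta_mass_pos[of k] by (auto simp: indicator_def)
qed measurable

lemma abs_Delta_occupation_le:
  assumes "x \<in> borel_measurable borel" "s \<le> t"
  shows "\<bar>Delta_occupation k x s t y r\<bar> \<le> Delta_mass k * (t - s)"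
proof -
  have "\<bar>Delta_occupation k x s t y r\<bar> \<le> (LINT \<tau>|lborel. \<bar>indicator {s..t} \<tau> * Delta_kernel k r (y - x \<tau>)\<bar>)"
    unfolding Delta_occupation_def by (rule integral_abs_bound)
  also have "\<dots> \<le> (LINT \<tau>|lborel. Delta_mass k * indicat_real {s..t} \<tau>)"
    using abs_Delta_kernel_le[of k r] Delta_mass_pos[of k] integrable_Delta_occupation[OF assms(1)]
    by (intro integral_mono integrable_mult_indicator_Icc integrable_abs)
       (auto simp: indicator_def)
  also have "\<dots> = Delta_mass k * (t - s)" using assms by simp
  finally show ?thesis .
qed

lemma Delta_occupation_diff:
  assumes x [measurable]: "x \<in> borel_measurable borel" and "a \<le> s" "s \<le> t"
  shows "Delta_occupation k x a t y r - Delta_occupation k x a s y r = Delta_occupation k x s t y r"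
proof -
  have "Delta_occupation k x a t y r - Delta_occupation k x a s y r
      = (LINT \<tau>|lborel. indicator {a..t} \<tau> * Delta_kernel k r (y - x \<tau>) - indicator {a..s} \<tau> * Delta_kernel k r (y - x \<tau>))"
    unfolding Delta_occupation_def by (subst Bochner_Integration.integral_diff) (auto intro: integrable_Delta_occupation)
  also have "\<dots> = Delta_occupation k x s t y r"
    unfolding Delta_occupation_def
  proof (rule integral_cong_AE)
    show "AE \<tau> in lborel. indicator {a..t} \<tau> * Delta_kernel k r (y - x \<tau>) - indicator {a..s} \<tau> * Delta_kernel k r (y - x \<tau>)
        = indicator {s..t} \<tau> * Delta_kernel k r (y - x \<tau>)"
      using AE_lborel_singleton[of s] by eventually_elim (use assms in \<open>auto simp: indicator_def\<close>)
  qed auto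
  finally show ?thesis .
qed

lemma continuous_on_Delta_occupation:
  assumes "x \<in> borel_measurable borel"
  shows "continuous_on {a..b} (\<lambda>t. Delta_occupation k x a t y r)"
proof (rule lipschitz_on_continuous_on)
  have *: "dist (Delta_occupation k x a t y r) (Delta_occupation k x a s y r) \<le> Delta_mass k * dist t s"
    if "a \<le> s" "s \<le> t" for s t
    using abs_Delta_occupation_le[OF assms that(2), of k y r] that
    by (simp add: dist_real_def Delta_occupation_diff[OF assms])
  show "lipschitz_on (Delta_mass k) {a..b} (\<lambda>t. Delta_occupation k x a t y r)"
  proof (rule lipschitz_onI)
    fix s t assume "s \<in> {a..b}" "t \<in> {a..b}"
    then show "dist (Delta_occupation k x a s y r) (Delta_occupation k x a t y r) \<le> Delta_mass k * dist s t"
      using *[of s t] *[of t s] by (cases "s \<le> t") (auto simp: dist_commute)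
  qed (use Delta_mass_pos[of k] in simp)
qed

lemma occupation_measure_finite:
  assumes "x \<in> borel_measurable (restrict_space lborel {s..t})"
  shows "finite_measure (occupation_measure x s t)"
proof -
  have "finite_measure (restrict_space lborel {s..t})"
    by (rule finite_measureI) (simp add: emeasure_restrict_space space_restrict_space emeasure_lborel_Icc_eq)
  then show ?thesis
    unfolding occupation_measure_def by (rule finite_measure.finite_measure_distr) fact
qed

lemma Delta_occupation_eq_Delta_measure:
  assumes [measurable]: "x \<in> borel_measurable borel"
  shows "Delta_occupation k x s t y r = Delta k (\<lambda>\<rho>. measure (occupation_measure x s t) (cball y \<rho>)) r"
proof -
  have x: "x \<in> borel_measurable (restrict_space lborel {s..t})"
    by (rule measurable_restrict_space1) simp
  have "Delta k (\<lambda>\<rho>. measure (occupation_measure x s t) (cball y \<rho>)) r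
      = (LINT z|occupation_measure x s t. Delta_kernel k r (y - z))"
    using occupation_measure_finite[OF x]
    by (subst integral_Delta_kernel_eq_Delta) (auto simp: occupation_measure_def)
  also have "\<dots> = (LINT \<tau>|restrict_space lborel {s..t}. Delta_kernel k r (y - x \<tau>))"
    unfolding occupation_measure_def using x by (subst integral_distr) auto
  also have "\<dots> = Delta_occupation k x s t y r"
    unfolding Delta_occupation_def by (subst integral_restrict_space) (auto simp: mult.commute)
  finally show ?thesis by simp
qed

text \<open>
  The squared norm of the occupation measure over \<open>[s, t]\<close>, with the order \<open>k\<close> of the difference
  decoupled from the exponent \<open>\<sigma> = \<alpha> + d\<close>.
\<close>
definition energy :: "nat \<Rightarrow> real \<Rightarrow> (real \<Rightarrow> 'a::euclidean_space) \<Rightarrow> real \<Rightarrow> real \<Rightarrow> ennreal" where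
  "energy k \<sigma> x s t = (\<integral>\<^sup>+ y. \<integral>\<^sup>+ r. ennreal (indicator {0<..} r * r powr (- 2 * \<sigma> - 1) * (Delta_occupation k x s t y r)\<^sup>2) \<partial>lborel \<partial>lborel)"

lemma measurable_Delta_occupation_pair [measurable]:
  assumes [measurable]: "x \<in> borel_measurable borel"
  shows "(\<lambda>p. Delta_occupation k x s t (fst p) (snd p)) \<in> borel_measurable (borel \<Otimes>\<^sub>M borel)"
  by (rule measurable_Delta_occupation[where X = "\<lambda>_. x"]) measurable

lemma measurable_Delta_occupation_radius [measurable]:
  assumes [measurable]: "x \<in> borel_measurable borel"
  shows "(\<lambda>r. Delta_occupation k x s t y r) \<in> borel_measurable borel"
  by (rule measurable_Delta_occupation[where X = "\<lambda>_. x"]) measurable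

lemma measurable_energy_integrand:
  assumes [measurable]: "x \<in> borel_measurable borel"
  shows "(\<lambda>y. \<integral>\<^sup>+ r. ennreal (indicator {0<..} r * r powr p * (Delta_occupation k x s t y r)\<^sup>2) \<partial>lborel) \<in> borel_measurable borel"
proof -
  have [measurable]: "(\<lambda>(y, r). Delta_occupation k x s t y r) \<in> borel_measurable (borel \<Otimes>\<^sub>M borel)"
    using measurable_Delta_occupation_pair[OF assms] by (simp add: case_prod_unfold)
  show ?thesis by measurable
qed

lemma energy_le_higher:
  assumes "0 < \<sigma>" "\<sigma> < real (k + 1)" "k \<le> l"
  shows "\<exists>K>0. \<forall>(x :: real \<Rightarrow> 'a::euclidean_space) s t. x \<in> borel_measurable borel \<longrightarrow>
           energy k \<sigma> x s t \<le> ennreal K * energy l \<sigma> x s t"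
proof -
  obtain K where K: "0 < K" "\<And>F B. F \<in> borel_measurable borel \<Longrightarrow> (\<And>r. \<bar>F r\<bar> \<le> B) \<Longrightarrow>
     (\<integral>\<^sup>+ r. ennreal (indicator {0<..} r * r powr (- 2 * \<sigma> - 1) * (Delta k F r)\<^sup>2) \<partial>lborel)
     \<le> ennreal K
        * (\<integral>\<^sup>+ r. ennreal (indicator {0<..} r * r powr (- 2 * \<sigma> - 1) * (Delta l F r)\<^sup>2) \<partial>lborel)"
    using nn_integral_Delta_le_higher[OF assms] by blast
  show ?thesis
  proof (intro exI[of _ K] conjI allI impI K)
    fix x :: "real \<Rightarrow> 'a" and s t
    assume x [measurable]: "x \<in> borel_measurable borel"
    have x': "x \<in> borel_measurable (restrict_space lborel {s..t})"
      by (rule measurable_restrict_space1) simp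
    interpret finite_measure "occupation_measure x s t" by (rule occupation_measure_finite[OF x'])
    have "energy k \<sigma> x s t \<le> (\<integral>\<^sup>+ y. ennreal K * (\<integral>\<^sup>+ r. ennreal (indicator {0<..} r * r powr (- 2 * \<sigma> - 1) * (Delta_occupation l x s t y r)\<^sup>2) \<partial>lborel) \<partial>lborel)"
      unfolding energy_def Delta_occupation_eq_Delta_measure[OF x]
    proof (intro nn_integral_mono K)
      fix y
      show "(\<lambda>\<rho>. measure (occupation_measure x s t) (cball y \<rho>)) \<in> borel_measurable borel"
        by (intro borel_measurable_mono monoI finite_measure_mono) (auto simp: occupation_measure_def)
      show "\<bar>measure (occupation_measure x s t) (cball y \<rho>)\<bar> \<le> measure (occupation_measure x s t) (space (occupation_measure x s t))" for \<rho>
        by (simp add: bounded_measure)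
    qed
    also have "\<dots> = ennreal K * energy l \<sigma> x s t"
      unfolding energy_def by (rule nn_integral_cmult) (use measurable_energy_integrand[OF x] in simp)
    finally show "energy k \<sigma> x s t \<le> ennreal K * energy l \<sigma> x s t" .
  qed
qed

lemma epowr_half_two: "epowr (epowr z (1 / 2)) 2 = z"
proof (cases "z = \<top>")
  case False
  then obtain u where "z = ennreal u" "0 \<le> u" by (cases z) auto
  then show ?thesis by (simp add: epowr_def powr_powr)
qed (simp add: epowr_def)

lemma epowr_two: "epowr (ennreal u) 2 = ennreal (u\<^sup>2)" if "0 \<le> u"
  using that by (simp add: epowr_def)

lemma epowr_mono: "x \<le> y \<Longrightarrow> 0 \<le> p \<Longrightarrow> epowr x p \<le> epowr y p"
  by (cases x; cases y) (auto simp: epowr_def top_unique ennreal_le_iff intro!: ennreal_leI powr_mono2)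

lemma Lp_norm_2: "epowr (Lp_norm 2 M f) 2 = (\<integral>\<^sup>+ x. epowr (f x) 2 \<partial>M)"
  by (simp add: Lp_norm_def epowr_half_two)

text \<open>
  The hypothesis on \<open>m\<close> concerns balls only, so the lemma applies both to an occupation measure
  and to a difference of two of them.
\<close>
lemma SBE_norm_square_eq_energy:
  fixes x :: "real \<Rightarrow> 'a::euclidean_space"
  assumes x [measurable]: "x \<in> borel_measurable borel" and "0 < \<alpha>"
    and k: "k = nat \<lceil>\<alpha> + real DIM('a) - 1\<rceil>"
    and m: "\<And>y r. Delta k (\<lambda>r. m (cball y r)) r = Delta_occupation k x s t y r"
  shows "epowr (SBE_norm \<alpha> 2 2 m) 2 = energy k (\<alpha> + real DIM('a)) x s t"
proof -
  have "epowr (SBE_norm \<alpha> 2 2 m) 2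
      = (\<integral>\<^sup>+ y. \<integral>\<^sup>+ r. ennreal ((r powr (- \<alpha> - real DIM('a)) * \<bar>Delta_occupation k x s t y r\<bar>)\<^sup>2) \<partial>log_measure \<partial>lborel)"
    unfolding SBE_norm_def Let_def k[symmetric] Lp_norm_2 m by (simp add: epowr_two)
  also have "\<dots> = energy k (\<alpha> + real DIM('a)) x s t"
    unfolding energy_def
  proof (intro nn_integral_cong)
    fix y
    have "(\<integral>\<^sup>+ r. ennreal ((r powr (- \<alpha> - real DIM('a)) * \<bar>Delta_occupation k x s t y r\<bar>)\<^sup>2) \<partial>log_measure)
       = (\<integral>\<^sup>+ r. indicator {0<..} r * ennreal (1 / r) * ennreal ((r powr (- \<alpha> - real DIM('a)) * \<bar>Delta_occupation k x s t y r\<bar>)\<^sup>2) \<partial>lborel)"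
      unfolding log_measure_def by (subst nn_integral_density) auto
    also have "\<dots> = (\<integral>\<^sup>+ r. ennreal (indicator {0<..} r * r powr (- 2 * (\<alpha> + real DIM('a)) - 1) * (Delta_occupation k x s t y r)\<^sup>2) \<partial>lborel)"
    proof (intro nn_integral_cong)
      fix r :: real
      show "indicator {0<..} r * ennreal (1 / r) * ennreal ((r powr (- \<alpha> - real DIM('a)) * \<bar>Delta_occupation k x s t y r\<bar>)\<^sup>2)
         = ennreal (indicator {0<..} r * r powr (- 2 * (\<alpha> + real DIM('a)) - 1) * (Delta_occupation k x s t y r)\<^sup>2)"
      proof (cases "0 < r")
        case True
        have "1 / r = r powr (- 1)" using True by (simp add: powr_minus_divide)
        moreover have "(r powr (- \<alpha> - real DIM('a)))\<^sup>2 = r powr (- 2 * (\<alpha> + real DIM('a)))"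
          using True by (simp add: power2_eq_square powr_add[symmetric])
        ultimately have "1 / r * (r powr (- \<alpha> - real DIM('a)))\<^sup>2 = r powr (- 2 * (\<alpha> + real DIM('a)) - 1)"
          by (simp only: powr_add[symmetric]) simp
        then show ?thesis
          using True by (simp add: ennreal_mult''[symmetric] power_mult_distrib mult.assoc[symmetric])
      qed simp
    qed
    finally show "(\<integral>\<^sup>+ r. ennreal ((r powr (- \<alpha> - real DIM('a)) * \<bar>Delta_occupation k x s t y r\<bar>)\<^sup>2) \<partial>log_measure)
       = (\<integral>\<^sup>+ r. ennreal (indicator {0<..} r * r powr (- 2 * (\<alpha> + real DIM('a)) - 1) * (Delta_occupation k x s t y r)\<^sup>2) \<partial>lborel)" .
  qed
  finally show ?thesis .
qed

text \<open>
  The scalar chaining inequality, applied for each centre \<open>y\<close> and radius \<open>r\<close> to the continuous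
  function \<open>\<tau> \<mapsto> Delta_occupation k x a \<tau> y r\<close>, and integrated in \<open>y\<close> and \<open>r\<close>.
\<close>
lemma sum_energy_le_dyadic:
  fixes x :: "real \<Rightarrow> 'a::euclidean_space"
  assumes x [measurable]: "x \<in> borel_measurable borel" and "a \<le> b" "1 < \<kappa>"
    and mono: "\<And>h. h < l \<Longrightarrow> t h \<le> t (Suc h)" and first: "a \<le> t 0" and last: "t l \<le> b"
  shows "(\<Sum>h<l. energy k \<sigma> x (t h) (t (Suc h)))
     \<le> (\<Sum>n. \<Sum>i<2 ^ n. ennreal (4 * \<kappa> / (\<kappa> - 1) * \<kappa> ^ n) *
           energy k \<sigma> x (a + (b - a) * real i / 2 ^ n) (a + (b - a) * real (i + 1) / 2 ^ n))"
proof -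
  let ?wt = "\<lambda>r. ennreal (indicator {0<..} r * r powr (- 2 * \<sigma> - 1))"
  let ?p = "\<lambda>n i. a + (b - a) * real i / 2 ^ n"
  let ?c = "\<lambda>n. ennreal (4 * \<kappa> / (\<kappa> - 1) * \<kappa> ^ n)"
  have [measurable]: "(\<lambda>(y, r). Delta_occupation k x s t y r) \<in> borel_measurable (borel \<Otimes>\<^sub>M borel)" for s t
    using measurable_Delta_occupation_pair[OF x] by (simp add: case_prod_unfold)
  have [measurable]: "(\<lambda>r. Delta_occupation k x s t y r) \<in> borel_measurable borel" for s t y by measurable
  have energy: "energy k \<sigma> x s t = (\<integral>\<^sup>+ y. \<integral>\<^sup>+ r. ?wt r * ennreal ((Delta_occupation k x s t y r)\<^sup>2) \<partial>lborel \<partial>lborel)" for s t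
    unfolding energy_def by (simp add: ennreal_mult)
  have t_ge: "a \<le> t h" if "h \<le> l" for h
    using that
  proof (induction h)
    case (Suc h)
    then show ?case using mono[of h] by auto
  qed (use first in simp)
  have pointwise: "(\<Sum>h<l. ennreal ((Delta_occupation k x (t h) (t (Suc h)) y r)\<^sup>2))
     \<le> (\<Sum>n. \<Sum>i<2 ^ n. ?c n * ennreal ((Delta_occupation k x (?p n i) (?p n (i + 1)) y r)\<^sup>2))" for y r
  proof -
    have 1: "Delta_occupation k x a (t (Suc h)) y r - Delta_occupation k x a (t h) y r = Delta_occupation k x (t h) (t (Suc h)) y r"
      if "h < l" for h
      using that by (intro Delta_occupation_diff x t_ge mono) auto
    have p_mono: "?p n i \<le> ?p n (i + 1)" for n i
      using \<open>a \<le> b\<close> by (intro add_left_mono divide_right_mono mult_left_mono) auto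
    have 2: "Delta_occupation k x a (?p n (i + 1)) y r - Delta_occupation k x a (?p n i) y r = Delta_occupation k x (?p n i) (?p n (i + 1)) y r" for n i
      using \<open>a \<le> b\<close> by (intro Delta_occupation_diff x p_mono) auto
    have "(\<Sum>h<l. ennreal ((Delta_occupation k x (t h) (t (Suc h)) y r)\<^sup>2))
       = (\<Sum>h<l. ennreal ((Delta_occupation k x a (t (Suc h)) y r - Delta_occupation k x a (t h) y r)\<^sup>2))"
      by (intro sum.cong) (auto simp: 1)
    also have "\<dots> \<le> (\<Sum>n. \<Sum>i<2 ^ n. ennreal (4 * \<kappa> / (\<kappa> - 1) * \<kappa> ^ n *
        (Delta_occupation k x a (?p n (i + 1)) y r - Delta_occupation k x a (?p n i) y r)\<^sup>2))"
      by (rule square_variation_le_dyadic[OF \<open>a \<le> b\<close> continuous_on_Delta_occupation[OF x] \<open>1 < \<kappa>\<close> mono first last])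
    also have "\<dots> = (\<Sum>n. \<Sum>i<2 ^ n. ?c n * ennreal ((Delta_occupation k x (?p n i) (?p n (i + 1)) y r)\<^sup>2))"
      unfolding 2 using \<open>1 < \<kappa>\<close> by (intro suminf_cong sum.cong refl ennreal_mult) auto
    finally show ?thesis .
  qed
  have "(\<Sum>h<l. energy k \<sigma> x (t h) (t (Suc h)))
      = (\<integral>\<^sup>+ y. \<integral>\<^sup>+ r. ?wt r * (\<Sum>h<l. ennreal ((Delta_occupation k x (t h) (t (Suc h)) y r)\<^sup>2)) \<partial>lborel \<partial>lborel)"
    unfolding energy sum_distrib_left by (simp add: nn_integral_sum)
  also have "\<dots> \<le> (\<integral>\<^sup>+ y. \<integral>\<^sup>+ r. ?wt r * (\<Sum>n. \<Sum>i<2 ^ n. ?c n * ennreal ((Delta_occupation k x (?p n i) (?p n (i + 1)) y r)\<^sup>2)) \<partial>lborel \<partial>lborel)"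
    by (intro nn_integral_mono mult_left_mono pointwise) simp
  also have "\<dots> = (\<integral>\<^sup>+ y. \<integral>\<^sup>+ r. (\<Sum>n. \<Sum>i<2 ^ n. ?c n * (?wt r * ennreal ((Delta_occupation k x (?p n i) (?p n (i + 1)) y r)\<^sup>2))) \<partial>lborel \<partial>lborel)"
    unfolding ennreal_suminf_cmult[symmetric] sum_distrib_left
    by (intro nn_integral_cong suminf_cong sum.cong refl mult.left_commute)
  also have "\<dots> = (\<integral>\<^sup>+ y. (\<Sum>n. \<Sum>i<2 ^ n. ?c n * (\<integral>\<^sup>+ r. ?wt r * ennreal ((Delta_occupation k x (?p n i) (?p n (i + 1)) y r)\<^sup>2) \<partial>lborel)) \<partial>lborel)"
    by (intro nn_integral_cong) (simp add: nn_integral_suminf nn_integral_sum nn_integral_cmult)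
  also have "\<dots> = (\<Sum>n. \<Sum>i<2 ^ n. ?c n * energy k \<sigma> x (?p n i) (?p n (i + 1)))"
    unfolding energy by (simp add: nn_integral_suminf nn_integral_sum nn_integral_cmult)
  finally show ?thesis .
qed

section \<open>Expected energies\<close>

lemma nn_integral_indicator_cball_shift:
  fixes c :: "'a::euclidean_space"
  assumes "0 \<le> r"
  shows "(\<integral>\<^sup>+ y. ennreal (indicat_real (cball 0 r) (y - c)) \<partial>lborel)
    = ennreal (unit_ball_vol (real DIM('a)) * r ^ DIM('a))"
proof -
  have "(\<integral>\<^sup>+ y. ennreal (indicat_real (cball 0 r) (y - c)) \<partial>lborel) = (\<integral>\<^sup>+ y. indicator (cball c r) y \<partial>lborel)"
    by (intro nn_integral_cong) (auto simp: indicator_def dist_norm norm_minus_commute)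
  also have "\<dots> = ennreal (unit_ball_vol (real DIM('a)) * r ^ DIM('a))"
    using assms by (simp add: emeasure_cball)
  finally show ?thesis .
qed

text \<open>
  One of the two factors of the square is bounded by its supremum \<open>Delta_mass k * (t - s)\<close>; integrating the other
  one over \<open>y\<close> first leaves the volume of a ball for each time \<open>\<tau>\<close>. The absolute value stands
  inside the time integral because this bound also justifies Fubini below.
\<close>
lemma nn_integral_square_Delta_kernel_le:
  fixes x :: "real \<Rightarrow> 'a::euclidean_space"
  assumes x [measurable]: "x \<in> borel_measurable borel" and "s \<le> t" "0 < r"
  shows "(\<integral>\<^sup>+ y. (\<integral>\<^sup>+ \<tau>. ennreal \<bar>indicator {s..t} \<tau> * Delta_kernel k r (y - x \<tau>)\<bar> \<partial>lborel)\<^sup>2 \<partial>lborel)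
    \<le> ennreal ((Delta_mass k)\<^sup>2 * unit_ball_vol (real DIM('a)) * r ^ DIM('a) * (t - s)\<^sup>2)"
proof -
  let ?D = "Delta_mass k"
  have D: "0 < ?D" by (rule Delta_mass_pos)
  have [measurable]: "cball (0::'a) r \<in> sets borel" by simp
  have ball_meas [measurable]: "(\<lambda>p. indicat_real (cball 0 r) (fst p - x (snd p))) \<in> borel_measurable (lborel \<Otimes>\<^sub>M lborel)"
    by measurable
  define L where "L y = (\<integral>\<^sup>+ \<tau>. ennreal (indicat_real {s..t} \<tau>) * ennreal (indicat_real (cball 0 r) (y - x \<tau>)) \<partial>lborel)" for y
  have L_meas [measurable]: "L \<in> borel_measurable lborel"
    unfolding L_def using ball_meas by (intro lborel.borel_measurable_nn_integral) (simp add: case_prod_unfold)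
  have "(\<integral>\<^sup>+ \<tau>. ennreal \<bar>indicator {s..t} \<tau> * Delta_kernel k r (y - x \<tau>)\<bar> \<partial>lborel)\<^sup>2
      \<le> ennreal (?D * (t - s)) * (ennreal ?D * L y)" for y
  proof -
    have "(\<integral>\<^sup>+ \<tau>. ennreal \<bar>indicator {s..t} \<tau> * Delta_kernel k r (y - x \<tau>)\<bar> \<partial>lborel)
        \<le> (\<integral>\<^sup>+ \<tau>. ennreal ?D * indicator {s..t} \<tau> \<partial>lborel)"
      using abs_Delta_kernel_le[of k r] by (intro nn_integral_mono) (auto simp: indicator_def intro!: ennreal_leI)
    also have "\<dots> = ennreal (?D * (t - s))"
      using D \<open>s \<le> t\<close> by (simp add: nn_integral_cmult ennreal_mult)
    finally have 1: "(\<integral>\<^sup>+ \<tau>. ennreal \<bar>indicator {s..t} \<tau> * Delta_kernel k r (y - x \<tau>)\<bar> \<partial>lborel) \<le> \<dots>" .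
    have "(\<integral>\<^sup>+ \<tau>. ennreal \<bar>indicator {s..t} \<tau> * Delta_kernel k r (y - x \<tau>)\<bar> \<partial>lborel)
        \<le> (\<integral>\<^sup>+ \<tau>. ennreal ?D * (ennreal (indicat_real {s..t} \<tau>) * ennreal (indicat_real (cball 0 r) (y - x \<tau>))) \<partial>lborel)"
    proof (intro nn_integral_mono)
      fix \<tau>
      have "\<bar>indicator {s..t} \<tau> * Delta_kernel k r (y - x \<tau>)\<bar> \<le> ?D * (indicat_real {s..t} \<tau> * indicat_real (cball 0 r) (y - x \<tau>))"
        using abs_Delta_kernel_le_indicator[OF \<open>0 < r\<close>, of k "y - x \<tau>"] by (auto simp: indicator_def)
      then show "ennreal \<bar>indicator {s..t} \<tau> * Delta_kernel k r (y - x \<tau>)\<bar>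
          \<le> ennreal ?D * (ennreal (indicat_real {s..t} \<tau>) * ennreal (indicat_real (cball 0 r) (y - x \<tau>)))"
        using D by (simp add: ennreal_mult[symmetric] ennreal_leI)
    qed
    also have "\<dots> = ennreal ?D * L y"
      unfolding L_def
    proof (rule nn_integral_cmult)
      show "(\<lambda>\<tau>. ennreal (indicat_real {s..t} \<tau>) * ennreal (indicat_real (cball 0 r) (y - x \<tau>))) \<in> borel_measurable lborel"
        by measurable
    qed
    finally show ?thesis using 1 by (simp add: power2_eq_square mult_mono)
  qed
  then have "(\<integral>\<^sup>+ y. (\<integral>\<^sup>+ \<tau>. ennreal \<bar>indicator {s..t} \<tau> * Delta_kernel k r (y - x \<tau>)\<bar> \<partial>lborel)\<^sup>2 \<partial>lborel)
     \<le> (\<integral>\<^sup>+ y. ennreal (?D * (t - s)) * (ennreal ?D * L y) \<partial>lborel)"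
    by (intro nn_integral_mono)
  also have "\<dots> = ennreal (?D * (t - s)) * (ennreal ?D * (\<integral>\<^sup>+ y. L y \<partial>lborel))"
    by (simp add: nn_integral_cmult)
  also have "(\<integral>\<^sup>+ y. L y \<partial>lborel) = (\<integral>\<^sup>+ \<tau>. \<integral>\<^sup>+ y. ennreal (indicat_real {s..t} \<tau>) * ennreal (indicat_real (cball 0 r) (y - x \<tau>)) \<partial>lborel \<partial>lborel)"
    unfolding L_def
    by (rule lborel_pair.Fubini') measurable
  also have "\<dots> = (\<integral>\<^sup>+ \<tau>. ennreal (unit_ball_vol (real DIM('a)) * r ^ DIM('a)) * indicator {s..t} \<tau> \<partial>lborel)"
  proof (intro nn_integral_cong)
    fix \<tau>
    have "(\<integral>\<^sup>+ y. ennreal (indicat_real {s..t} \<tau>) * ennreal (indicat_real (cball 0 r) (y - x \<tau>)) \<partial>lborel)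
       = ennreal (indicat_real {s..t} \<tau>) * (\<integral>\<^sup>+ y. ennreal (indicat_real (cball 0 r) (y - x \<tau>)) \<partial>lborel)"
      by (rule nn_integral_cmult) measurable
    then show "(\<integral>\<^sup>+ y. ennreal (indicat_real {s..t} \<tau>) * ennreal (indicat_real (cball 0 r) (y - x \<tau>)) \<partial>lborel)
       = ennreal (unit_ball_vol (real DIM('a)) * r ^ DIM('a)) * indicator {s..t} \<tau>"
      using \<open>0 < r\<close> nn_integral_indicator_cball_shift[of r "x \<tau>"] by (auto simp: indicator_def)
  qed
  also have "\<dots> = ennreal (unit_ball_vol (real DIM('a)) * r ^ DIM('a) * (t - s))"
    using \<open>s \<le> t\<close> \<open>0 < r\<close> by (simp add: nn_integral_cmult ennreal_mult)
  also have "ennreal (?D * (t - s)) * (ennreal ?D * ennreal (unit_ball_vol (real DIM('a)) * r ^ DIM('a) * (t - s)))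
      = ennreal (?D\<^sup>2 * unit_ball_vol (real DIM('a)) * r ^ DIM('a) * (t - s)\<^sup>2)"
    using D \<open>s \<le> t\<close> \<open>0 < r\<close> by (simp add: ennreal_mult[symmetric] power2_eq_square mult_ac)
  finally show ?thesis .
qed

lemma nn_integral_product_pair:
  fixes f :: "real \<Rightarrow> ennreal"
  assumes [measurable]: "f \<in> borel_measurable borel"
  shows "(\<integral>\<^sup>+ q. f (fst q) * f (snd q) \<partial>(lborel \<Otimes>\<^sub>M lborel)) = (\<integral>\<^sup>+ \<tau>. f \<tau> \<partial>lborel)\<^sup>2"
proof -
  have "(\<integral>\<^sup>+ q. f (fst q) * f (snd q) \<partial>(lborel \<Otimes>\<^sub>M lborel)) = (\<integral>\<^sup>+ u. \<integral>\<^sup>+ v. f u * f v \<partial>lborel \<partial>lborel)"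
    by (subst lborel.nn_integral_fst[symmetric]) auto
  then show ?thesis by (simp add: nn_integral_cmult nn_integral_multc power2_eq_square)
qed

lemma integral_product_pair:
  fixes g :: "real \<Rightarrow> real"
  assumes g: "integrable lborel g"
  shows "(LINT q|(lborel \<Otimes>\<^sub>M lborel). g (fst q) * g (snd q)) = (LINT \<tau>|lborel. g \<tau>)\<^sup>2"
proof -
  have [measurable]: "g \<in> borel_measurable borel" using g by auto
  have "integrable (lborel \<Otimes>\<^sub>M lborel) (\<lambda>q. g (fst q) * g (snd q))"
  proof (rule integrableI_bounded)
    have "(\<integral>\<^sup>+ q. ennreal (norm (g (fst q) * g (snd q))) \<partial>(lborel \<Otimes>\<^sub>M lborel))
        = (\<integral>\<^sup>+ q. ennreal (norm (g (fst q))) * ennreal (norm (g (snd q))) \<partial>(lborel \<Otimes>\<^sub>M lborel))"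
      by (simp add: abs_mult ennreal_mult)
    also have "\<dots> = (\<integral>\<^sup>+ \<tau>. ennreal (norm (g \<tau>)) \<partial>lborel)\<^sup>2"
      by (rule nn_integral_product_pair) measurable
    also have "\<dots> < \<infinity>"
      using g unfolding integrable_iff_bounded by (simp add: power2_eq_square ennreal_mult_less_top)
    finally show "(\<integral>\<^sup>+ q. ennreal (norm (g (fst q) * g (snd q))) \<partial>(lborel \<Otimes>\<^sub>M lborel)) < \<infinity>" .
  qed measurable
  then have "(LINT q|(lborel \<Otimes>\<^sub>M lborel). g (fst q) * g (snd q)) = (LINT u|lborel. LINT v|lborel. g u * g v)"
    by (subst lborel_pair.integral_fst'[symmetric]) auto
  then show ?thesis by (simp add: power2_eq_square)
qed

lemma (in prob_space) integrable_Delta_kernel_product: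
  fixes U W :: "'a \<Rightarrow> 'b::euclidean_space"
  assumes [measurable]: "U \<in> borel_measurable M" "W \<in> borel_measurable M" and "0 < r"
  shows "integrable (M \<Otimes>\<^sub>M lborel) (\<lambda>p. Delta_kernel k r (snd p - U (fst p)) * Delta_kernel k r (snd p - W (fst p)))"
proof (rule integrableI_bounded)
  interpret P: pair_sigma_finite M lborel ..
  have [measurable]: "cball (0::'b) r \<in> sets borel" by simp
  have "norm (Delta_kernel k r (y - U w) * Delta_kernel k r (y - W w)) \<le> (Delta_mass k)\<^sup>2 * indicat_real (cball 0 r) (y - U w)" for w y
    unfolding norm_mult real_norm_def power2_eq_square
    using mult_mono[OF abs_Delta_kernel_le_indicator[OF \<open>0 < r\<close>, of k "y - U w"] abs_Delta_kernel_le[of k r "y - W w"]]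
      Delta_mass_pos[of k] by (simp add: abs_mult mult_ac)
  then have "(\<integral>\<^sup>+ p. ennreal (norm (Delta_kernel k r (snd p - U (fst p)) * Delta_kernel k r (snd p - W (fst p)))) \<partial>(M \<Otimes>\<^sub>M lborel))
      \<le> (\<integral>\<^sup>+ p. ennreal ((Delta_mass k)\<^sup>2) * ennreal (indicat_real (cball 0 r) (snd p - U (fst p))) \<partial>(M \<Otimes>\<^sub>M lborel))"
    by (intro nn_integral_mono) (simp add: ennreal_mult[symmetric] ennreal_leI)
  also have "\<dots> = ennreal ((Delta_mass k)\<^sup>2) * (\<integral>\<^sup>+ w. \<integral>\<^sup>+ y. ennreal (indicat_real (cball 0 r) (y - U w)) \<partial>lborel \<partial>M)"
    by (simp add: nn_integral_cmult lborel.nn_integral_fst[symmetric])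
  also have "\<dots> < \<infinity>"
    using \<open>0 < r\<close> by (simp add: nn_integral_indicator_cball_shift emeasure_space_1 ennreal_mult_less_top)
  finally show "(\<integral>\<^sup>+ p. ennreal (norm (Delta_kernel k r (snd p - U (fst p)) * Delta_kernel k r (snd p - W (fst p)))) \<partial>(M \<Otimes>\<^sub>M lborel)) < \<infinity>" .
qed measurable

text \<open>
  Translating \<open>y\<close> by \<open>U\<close> leaves only the increment \<open>W - U\<close> in the second factor, whose expectation
  is \<open>\<Delta>\<^sub>k\<close> of the ball masses of the law of the increment.
\<close>
lemma (in prob_space) integral_Delta_kernel_product:
  fixes U W :: "'a \<Rightarrow> 'b::euclidean_space"
  assumes [measurable]: "U \<in> borel_measurable M" "W \<in> borel_measurable M" and "0 < r"
  shows "(LINT p|(M \<Otimes>\<^sub>M lborel). Delta_kernel k r (snd p - U (fst p)) * Delta_kernel k r (snd p - W (fst p)))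
    = (LINT z|lborel. Delta_kernel k r z * Delta k (\<lambda>\<rho>. measure (distr M borel (\<lambda>w. W w - U w)) (cball z \<rho>)) r)"
proof -
  interpret P: pair_sigma_finite M lborel ..
  have int: "integrable (M \<Otimes>\<^sub>M lborel) (\<lambda>(w, z). Delta_kernel k r z * Delta_kernel k r (z - (W w - U w)))"
  proof -
    have "integrable (M \<Otimes>\<^sub>M lborel) (\<lambda>p. Delta_kernel k r (snd p - (\<lambda>_. 0) (fst p)) * Delta_kernel k r (snd p - (\<lambda>w. W w - U w) (fst p)))"
      by (rule integrable_Delta_kernel_product) (use assms in auto)
    then show ?thesis by (simp add: case_prod_unfold)
  qed
  have "(LINT p|(M \<Otimes>\<^sub>M lborel). Delta_kernel k r (snd p - U (fst p)) * Delta_kernel k r (snd p - W (fst p)))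
     = (LINT w|M. LINT y|lborel. Delta_kernel k r (y - U w) * Delta_kernel k r (y - W w))"
    by (subst P.integral_fst'[symmetric]) (use integrable_Delta_kernel_product[OF assms] in auto)
  also have "\<dots> = (LINT w|M. LINT z|lborel. Delta_kernel k r z * Delta_kernel k r (z - (W w - U w)))"
  proof (rule Bochner_Integration.integral_cong[OF refl])
    fix w
    show "(LINT y|lborel. Delta_kernel k r (y - U w) * Delta_kernel k r (y - W w)) = (LINT z|lborel. Delta_kernel k r z * Delta_kernel k r (z - (W w - U w)))"
      by (subst lborel_integral_affine[of _ 1 "U w"]) (auto simp: algebra_simps)
  qed
  also have "\<dots> = (LINT z|lborel. LINT w|M. Delta_kernel k r z * Delta_kernel k r (z - (W w - U w)))"
    using P.Fubini_integral[OF int] by simp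
  also have "\<dots> = (LINT z|lborel. Delta_kernel k r z * Delta k (\<lambda>\<rho>. measure (distr M borel (\<lambda>w. W w - U w)) (cball z \<rho>)) r)"
  proof (rule Bochner_Integration.integral_cong[OF refl])
    fix z
    have "Delta k (\<lambda>\<rho>. measure (distr M borel (\<lambda>w. W w - U w)) (cball z \<rho>)) r
       = (LINT x|distr M borel (\<lambda>w. W w - U w). Delta_kernel k r (z - x))"
      by (rule integral_Delta_kernel_eq_Delta[symmetric]) (auto intro!: finite_measure_distr)
    also have "\<dots> = (LINT w|M. Delta_kernel k r (z - (W w - U w)))"
      by (rule integral_distr) measurable
    finally show "(LINT w|M. Delta_kernel k r z * Delta_kernel k r (z - (W w - U w)))
      = Delta_kernel k r z * Delta k (\<lambda>\<rho>. measure (distr M borel (\<lambda>w. W w - U w)) (cball z \<rho>)) r"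
      by simp
  qed
  finally show ?thesis .
qed

text \<open>
  One factor \<open>Delta_mass k * unit_ball_vol d\<close> comes from the integral of the kernel, the rest from
  the cancellation estimate for a density.
\<close>
definition increment_constant :: "nat \<Rightarrow> nat \<Rightarrow> real \<Rightarrow> real" where
  "increment_constant d k \<beta> = (Delta_mass k * unit_ball_vol (real d))\<^sup>2 * real d ^ (nat \<lceil>\<beta>\<rceil> - 1)"

lemma (in prob_space) abs_integral_Delta_kernel_product_le:
  fixes U W :: "'a \<Rightarrow> 'b::euclidean_space"
  assumes [measurable]: "U \<in> borel_measurable M" "W \<in> borel_measurable M" and "0 < r" "0 < \<beta>"
    and k: "DIM('b) + (nat \<lceil>\<beta>\<rceil> - 1) \<le> k"
  shows "ennreal (\<bar>LINT p|(M \<Otimes>\<^sub>M lborel). Delta_kernel k r (snd p - U (fst p)) * Delta_kernel k r (snd p - W (fst p))\<bar>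
           / (increment_constant DIM('b) k \<beta> * r powr (2 * real DIM('b) + \<beta>)))
         \<le> density_holder_norm \<beta> (distr M borel (\<lambda>w. W w - U w))"
    (is "ennreal (\<bar>?I\<bar> / ?c) \<le> density_holder_norm \<beta> ?\<nu>")
proof (cases "density_holder_norm \<beta> ?\<nu> = \<top>")
  case False
  then obtain H where H: "density_holder_norm \<beta> ?\<nu> = ennreal H" "0 \<le> H" by (cases "density_holder_norm \<beta> ?\<nu>") auto
  let ?V = "unit_ball_vol (real DIM('b))"
  have V: "0 < ?V" by simp
  have D: "0 < Delta_mass k" by (rule Delta_mass_pos)
  define e where "e = ?V * Delta_mass k * real DIM('b) ^ (nat \<lceil>\<beta>\<rceil> - 1) * r powr (real DIM('b) + \<beta>)"
  have e: "0 < e" unfolding e_def using V D \<open>0 < r\<close> by simp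
  have Delta_le: "\<bar>Delta k (\<lambda>\<rho>. measure ?\<nu> (cball z \<rho>)) r\<bar> \<le> e * H" for z
  proof -
    have "ennreal (\<bar>Delta k (\<lambda>\<rho>. measure ?\<nu> (cball z \<rho>)) r\<bar> / e) \<le> ennreal H"
      using abs_Delta_measure_cball_le_density_holder_norm[OF \<open>0 < \<beta>\<close> \<open>0 < r\<close> k, of ?\<nu> z]
      by (simp add: H e_def content_cball)
    then have "\<bar>Delta k (\<lambda>\<rho>. measure ?\<nu> (cball z \<rho>)) r\<bar> / e \<le> H" using H by (simp add: ennreal_le_iff)
    then show ?thesis using e by (simp add: divide_le_eq mult.commute)
  qed
  have "\<bar>?I\<bar> \<le> (LINT z|lborel. \<bar>Delta_kernel k r z * Delta k (\<lambda>\<rho>. measure ?\<nu> (cball z \<rho>)) r\<bar>)"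
    unfolding integral_Delta_kernel_product[OF assms(1-3)] by (rule integral_abs_bound)
  also have "\<dots> \<le> (LINT z|lborel. (Delta_mass k * e * H) * indicat_real (cball (0::'b) r) z)"
  proof (rule integral_mono_AE')
    show "integrable lborel (\<lambda>z. (Delta_mass k * e * H) * indicat_real (cball (0::'b) r) z)"
      by (intro integrable_mult_right integrable_real_indicator emeasure_bounded_finite) auto
    show "AE z in lborel. \<bar>Delta_kernel k r z * Delta k (\<lambda>\<rho>. measure ?\<nu> (cball z \<rho>)) r\<bar> \<le> (Delta_mass k * e * H) * indicat_real (cball (0::'b) r) z"
    proof (rule AE_I2)
      fix z
      show "\<bar>Delta_kernel k r z * Delta k (\<lambda>\<rho>. measure ?\<nu> (cball z \<rho>)) r\<bar> \<le> (Delta_mass k * e * H) * indicat_real (cball (0::'b) r) z"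
        using mult_mono[OF abs_Delta_kernel_le_indicator[OF \<open>0 < r\<close>, of k z] Delta_le[of z]] D
        by (simp add: abs_mult mult_ac)
    qed
  qed (use D e H in auto)
  also have "\<dots> = (Delta_mass k * e * H) * (?V * r ^ DIM('b))"
    using \<open>0 < r\<close> by (simp add: content_cball)
  also have "r ^ DIM('b) = r powr real DIM('b)" using \<open>0 < r\<close> by (simp add: powr_realpow)
  also have "(Delta_mass k * e * H) * (?V * r powr real DIM('b)) = H * ?c"
  proof -
    have "r powr (2 * real DIM('b) + \<beta>) = r powr real DIM('b) * r powr (real DIM('b) + \<beta>)"
      unfolding powr_add[symmetric] by simp
    then show ?thesis by (simp add: e_def increment_constant_def power2_eq_square)
  qed
  finally have "\<bar>?I\<bar> / ?c \<le> H"
  proof (subst pos_divide_le_eq)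
    show "0 < ?c" unfolding increment_constant_def
      by (intro mult_pos_pos zero_less_power V D) (use \<open>0 < r\<close> in auto)
  qed
  then show ?thesis using H by (simp add: ennreal_leI)
qed simp

text \<open>
  Expand the square as a double time integral and exchange it with the integral in the outcome and
  the centre. The expression \<open>density_holder_norm\<close> need not be measurable in \<open>(u, v)\<close>, so it enters
  only at the end, as a pointwise bound of a measurable function.
\<close>
lemma (in prob_space) nn_integral_square_Delta_occupation_le:
  fixes X :: "'a \<Rightarrow> real \<Rightarrow> 'b::euclidean_space"
  assumes X: "(\<lambda>(w, \<tau>). X w \<tau>) \<in> borel_measurable (M \<Otimes>\<^sub>M borel)"
    and "s \<le> t" "0 < r" "0 < \<beta>" and k: "DIM('b) + (nat \<lceil>\<beta>\<rceil> - 1) \<le> k"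
    and bound: "(\<integral>\<^sup>+ (u, v) \<in> {s..t} \<times> {s..t}. density_holder_norm \<beta> (distr M borel (\<lambda>w. X w v - X w u)) \<partial>(lborel \<Otimes>\<^sub>M lborel))
        \<le> ennreal B"
  shows "(\<integral>\<^sup>+ w. \<integral>\<^sup>+ y. ennreal ((Delta_occupation k (X w) s t y r)\<^sup>2) \<partial>lborel \<partial>M)
     \<le> ennreal (increment_constant DIM('b) k \<beta> * r powr (2 * real DIM('b) + \<beta>)) * ennreal B"
proof -
  define c where "c = increment_constant DIM('b) k \<beta> * r powr (2 * real DIM('b) + \<beta>)"
  have c: "0 < c" using \<open>0 < r\<close> Delta_mass_pos[of k]
    by (auto simp: c_def increment_constant_def intro!: mult_pos_pos zero_less_power)
  interpret P: pair_sigma_finite M "lborel :: 'b measure" ..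
  interpret R: pair_sigma_finite "M \<Otimes>\<^sub>M (lborel :: 'b measure)" "lborel \<Otimes>\<^sub>M lborel :: (real \<times> real) measure" ..
  have Q_finite: "sigma_finite_measure (lborel \<Otimes>\<^sub>M lborel :: (real \<times> real) measure)"
    by (rule pair_sigma_finite.axioms(2)[OF R.pair_sigma_finite_axioms])
  have X_comp [measurable (raw)]: "(\<lambda>n. X (f n) (g n)) \<in> borel_measurable N"
    if "f \<in> measurable N M" "g \<in> borel_measurable N" for f g and N :: "'c measure"
    using measurable_compose[OF measurable_Pair[OF that] X] by simp
  have X_path [measurable]: "X w \<in> borel_measurable borel" if "w \<in> space M" for w
    using measurable_compose[OF measurable_Pair1'[OF that] X] by simp
  have X_at: "(\<lambda>w. X w u) \<in> borel_measurable M" for u by (rule X_comp) auto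
  let ?P = "M \<Otimes>\<^sub>M (lborel :: 'b measure)" and ?Q = "lborel \<Otimes>\<^sub>M lborel :: (real \<times> real) measure"
  define g where "g p \<tau> = indicator {s..t} \<tau> * Delta_kernel k r (snd p - X (fst p) \<tau>)" for p \<tau>
  have g_pair [measurable]: "(\<lambda>z. g (fst z) (snd z)) \<in> borel_measurable (?P \<Otimes>\<^sub>M lborel)"
    unfolding g_def by measurable
  have g_comp [measurable (raw)]: "(\<lambda>n. g (f n) (h n)) \<in> borel_measurable N"
    if "f \<in> measurable N ?P" "h \<in> measurable N lborel" for f h and N :: "'c measure"
    using measurable_compose[OF measurable_Pair[OF that] g_pair] by simp
  define N where "N p = (\<integral>\<^sup>+ \<tau>. ennreal \<bar>g p \<tau>\<bar> \<partial>lborel)" for p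
  have N_meas [measurable]: "N \<in> borel_measurable ?P"
    unfolding N_def by measurable
  have N_fin: "(\<integral>\<^sup>+ p. (N p)\<^sup>2 \<partial>?P) < \<infinity>"
  proof -
    have "(\<integral>\<^sup>+ p. (N p)\<^sup>2 \<partial>?P) = (\<integral>\<^sup>+ w. \<integral>\<^sup>+ y. (N (w, y))\<^sup>2 \<partial>lborel \<partial>M)"
      by (rule lborel.nn_integral_fst[symmetric]) measurable
    also have "\<dots> \<le> (\<integral>\<^sup>+ w. ennreal ((Delta_mass k)\<^sup>2 * unit_ball_vol (real DIM('b)) * r ^ DIM('b) * (t - s)\<^sup>2) \<partial>M)"
      unfolding N_def g_def using nn_integral_square_Delta_kernel_le[OF X_path \<open>s \<le> t\<close> \<open>0 < r\<close>]
      by (intro nn_integral_mono) simp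
    also have "\<dots> < \<infinity>" by (simp add: emeasure_space_1)
    finally show ?thesis .
  qed
  \<comment> \<open>A point \<open>p\<close> consists of an outcome and a centre, a point \<open>q\<close> of two times.\<close>
  define h where "h p q = g p (fst q) * g p (snd q)" for p q
  have h_meas [measurable]: "(\<lambda>(p, q). h p q) \<in> borel_measurable (?P \<Otimes>\<^sub>M ?Q)"
    unfolding h_def by measurable
  have h_int: "integrable (?P \<Otimes>\<^sub>M ?Q) (\<lambda>(p, q). h p q)"
  proof (rule integrableI_bounded)
    have "(\<integral>\<^sup>+ z. ennreal (norm (case z of (p, q) \<Rightarrow> h p q)) \<partial>(?P \<Otimes>\<^sub>M ?Q))
        = (\<integral>\<^sup>+ p. \<integral>\<^sup>+ q. ennreal (norm (h p q)) \<partial>?Q \<partial>?P)"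
      by (subst sigma_finite_measure.nn_integral_fst[OF Q_finite, symmetric]) auto
    also have "\<dots> = (\<integral>\<^sup>+ p. (N p)\<^sup>2 \<partial>?P)"
    proof (rule nn_integral_cong)
      fix p assume p: "p \<in> space ?P"
      have [measurable]: "g p \<in> borel_measurable borel"
        using g_comp[of "\<lambda>_. p" lborel "\<lambda>\<tau>. \<tau>"] p by simp
      have "(\<integral>\<^sup>+ q. ennreal (norm (h p q)) \<partial>?Q) = (\<integral>\<^sup>+ q. ennreal \<bar>g p (fst q)\<bar> * ennreal \<bar>g p (snd q)\<bar> \<partial>?Q)"
        by (simp add: h_def abs_mult ennreal_mult)
      also have "\<dots> = (N p)\<^sup>2"
        unfolding N_def by (rule nn_integral_product_pair) measurable
      finally show "(\<integral>\<^sup>+ q. ennreal (norm (h p q)) \<partial>?Q) = (N p)\<^sup>2" .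
    qed
    finally show "(\<integral>\<^sup>+ z. ennreal (norm (case z of (p, q) \<Rightarrow> h p q)) \<partial>(?P \<Otimes>\<^sub>M ?Q)) < \<infinity>"
      using N_fin by simp
  qed (rule h_meas)
  have Delta_occupation_sq: "(Delta_occupation k (X (fst p)) s t (snd p) r)\<^sup>2 = (LINT q|?Q. h p q)" if "p \<in> space ?P" for p
  proof -
    have "fst p \<in> space M" using that by (auto simp: space_pair_measure)
    then have "integrable lborel (g p)" unfolding g_def by (intro integrable_Delta_occupation X_path)
    from integral_product_pair[OF this] show ?thesis unfolding h_def by (simp add: Delta_occupation_def g_def)
  qed
  have Delta_occupation_meas [measurable]: "(\<lambda>p. Delta_occupation k (X (fst p)) s t (snd p) r) \<in> borel_measurable ?P"
    by (rule measurable_Delta_occupation) measurable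
  have Delta_occupation_int: "integrable ?P (\<lambda>p. (Delta_occupation k (X (fst p)) s t (snd p) r)\<^sup>2)"
    using R.integrable_fst[OF h_int] by (subst Bochner_Integration.integrable_cong[OF refl Delta_occupation_sq])
  have h_P: "\<bar>LINT p|?P. h p q\<bar> \<le> indicat_real ({s..t} \<times> {s..t}) q *
      \<bar>LINT p|?P. Delta_kernel k r (snd p - X (fst p) (fst q)) * Delta_kernel k r (snd p - X (fst p) (snd q))\<bar>" for q
  proof -
    have "h p q = indicat_real ({s..t} \<times> {s..t}) q *
       (Delta_kernel k r (snd p - X (fst p) (fst q)) * Delta_kernel k r (snd p - X (fst p) (snd q)))" for p
      by (cases q) (auto simp: h_def g_def indicator_def)
    then show ?thesis by (simp add: abs_mult)
  qed
  have "(\<integral>\<^sup>+ w. \<integral>\<^sup>+ y. ennreal ((Delta_occupation k (X w) s t y r)\<^sup>2) \<partial>lborel \<partial>M)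
      = (\<integral>\<^sup>+ p. ennreal ((Delta_occupation k (X (fst p)) s t (snd p) r)\<^sup>2) \<partial>?P)"
    by (subst lborel.nn_integral_fst[symmetric]) auto
  also have "\<dots> = ennreal (LINT p|?P. (Delta_occupation k (X (fst p)) s t (snd p) r)\<^sup>2)"
    by (rule nn_integral_eq_integral[OF Delta_occupation_int]) simp
  also have "(LINT p|?P. (Delta_occupation k (X (fst p)) s t (snd p) r)\<^sup>2) = (LINT p|?P. LINT q|?Q. h p q)"
    by (rule Bochner_Integration.integral_cong[OF refl Delta_occupation_sq])
  also have "\<dots> = (LINT q|?Q. LINT p|?P. h p q)"
    using R.Fubini_integral[OF h_int] by simp
  also have "ennreal \<dots> \<le> ennreal \<bar>LINT q|?Q. LINT p|?P. h p q\<bar>" by (rule ennreal_leI) simp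
  also have "\<dots> \<le> (\<integral>\<^sup>+ q. ennreal \<bar>LINT p|?P. h p q\<bar> \<partial>?Q)"
    using integral_norm_bound_ennreal[OF R.integrable_snd[OF h_int]] by simp
  also have "\<dots> = (\<integral>\<^sup>+ q. ennreal c * ennreal (\<bar>LINT p|?P. h p q\<bar> / c) \<partial>?Q)"
    using c by (simp add: ennreal_mult[symmetric])
  also have "\<dots> = ennreal c * (\<integral>\<^sup>+ q. ennreal (\<bar>LINT p|?P. h p q\<bar> / c) \<partial>?Q)"
    by (rule nn_integral_cmult) (use borel_measurable_integrable[OF R.integrable_snd[OF h_int]] in measurable)
  also have "\<dots> \<le> ennreal c * (\<integral>\<^sup>+ (u, v) \<in> {s..t} \<times> {s..t}. density_holder_norm \<beta> (distr M borel (\<lambda>w. X w v - X w u)) \<partial>?Q)"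
  proof (intro mult_left_mono nn_integral_mono)
    fix q :: "real \<times> real"
    obtain u v where q: "q = (u, v)" by (cases q)
    have "\<bar>LINT p|?P. h p q\<bar> / c \<le> indicat_real ({s..t} \<times> {s..t}) q *
      \<bar>LINT p|?P. Delta_kernel k r (snd p - X (fst p) (fst q)) * Delta_kernel k r (snd p - X (fst p) (snd q))\<bar> / c"
      using h_P c by (intro divide_right_mono) auto
    then have "ennreal (\<bar>LINT p|?P. h p q\<bar> / c) \<le> ennreal (\<bar>LINT p|?P. Delta_kernel k r (snd p - X (fst p) u) * Delta_kernel k r (snd p - X (fst p) v)\<bar> / c)
         * indicator ({s..t} \<times> {s..t}) q"
      by (auto simp: q indicator_def ennreal_neg split: if_splits intro!: ennreal_leI)
    also have "\<dots> \<le> density_holder_norm \<beta> (distr M borel (\<lambda>w. X w v - X w u)) * indicator ({s..t} \<times> {s..t}) q"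
      unfolding c_def
      by (intro mult_right_mono abs_integral_Delta_kernel_product_le X_at k \<open>0 < r\<close> \<open>0 < \<beta>\<close>) simp
    finally show "ennreal (\<bar>LINT p|?P. h p q\<bar> / c)
      \<le> (case q of (u, v) \<Rightarrow> density_holder_norm \<beta> (distr M borel (\<lambda>w. X w v - X w u))) * indicator ({s..t} \<times> {s..t}) q"
      by (simp add: q)
  qed simp
  also have "\<dots> \<le> ennreal c * ennreal B" by (intro mult_left_mono bound) simp
  finally show ?thesis unfolding c_def .
qed

lemma (in prob_space) nn_integral_square_Delta_occupation_le_trivial:
  fixes X :: "'a \<Rightarrow> real \<Rightarrow> 'b::euclidean_space"
  assumes X: "(\<lambda>(w, \<tau>). X w \<tau>) \<in> borel_measurable (M \<Otimes>\<^sub>M borel)" and "s \<le> t" "0 < r"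
  shows "(\<integral>\<^sup>+ w. \<integral>\<^sup>+ y. ennreal ((Delta_occupation k (X w) s t y r)\<^sup>2) \<partial>lborel \<partial>M)
     \<le> ennreal ((Delta_mass k)\<^sup>2 * unit_ball_vol (real DIM('b)) * r ^ DIM('b) * (t - s)\<^sup>2)"
proof -
  have "(\<integral>\<^sup>+ w. \<integral>\<^sup>+ y. ennreal ((Delta_occupation k (X w) s t y r)\<^sup>2) \<partial>lborel \<partial>M)
     \<le> (\<integral>\<^sup>+ w. ennreal ((Delta_mass k)\<^sup>2 * unit_ball_vol (real DIM('b)) * r ^ DIM('b) * (t - s)\<^sup>2) \<partial>M)"
  proof (rule nn_integral_mono)
    fix w assume w: "w \<in> space M"
    have x: "X w \<in> borel_measurable borel"
      using measurable_compose[OF measurable_Pair1'[OF w] X] by simp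
    have "(\<integral>\<^sup>+ y. ennreal ((Delta_occupation k (X w) s t y r)\<^sup>2) \<partial>lborel)
       \<le> (\<integral>\<^sup>+ y. (\<integral>\<^sup>+ \<tau>. ennreal \<bar>indicator {s..t} \<tau> * Delta_kernel k r (y - X w \<tau>)\<bar> \<partial>lborel)\<^sup>2 \<partial>lborel)"
    proof (rule nn_integral_mono)
      fix y
      have "ennreal \<bar>Delta_occupation k (X w) s t y r\<bar> \<le> (\<integral>\<^sup>+ \<tau>. ennreal \<bar>indicator {s..t} \<tau> * Delta_kernel k r (y - X w \<tau>)\<bar> \<partial>lborel)"
        unfolding Delta_occupation_def using integral_norm_bound_ennreal[OF integrable_Delta_occupation[OF x]] by simp
      then have "(ennreal \<bar>Delta_occupation k (X w) s t y r\<bar>)\<^sup>2 \<le> (\<integral>\<^sup>+ \<tau>. ennreal \<bar>indicator {s..t} \<tau> * Delta_kernel k r (y - X w \<tau>)\<bar> \<partial>lborel)\<^sup>2"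
        by (simp add: power2_eq_square mult_mono)
      then show "ennreal ((Delta_occupation k (X w) s t y r)\<^sup>2) \<le> (\<integral>\<^sup>+ \<tau>. ennreal \<bar>indicator {s..t} \<tau> * Delta_kernel k r (y - X w \<tau>)\<bar> \<partial>lborel)\<^sup>2"
        by (simp add: ennreal_power)
    qed
    also have "\<dots> \<le> ennreal ((Delta_mass k)\<^sup>2 * unit_ball_vol (real DIM('b)) * r ^ DIM('b) * (t - s)\<^sup>2)"
      by (rule nn_integral_square_Delta_kernel_le[OF x \<open>s \<le> t\<close> \<open>0 < r\<close>])
    finally show "(\<integral>\<^sup>+ y. ennreal ((Delta_occupation k (X w) s t y r)\<^sup>2) \<partial>lborel)
       \<le> ennreal ((Delta_mass k)\<^sup>2 * unit_ball_vol (real DIM('b)) * r ^ DIM('b) * (t - s)\<^sup>2)" .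
  qed
  then show ?thesis by (simp add: emeasure_space_1)
qed

lemma measurable_Delta_occupation_process:
  fixes X :: "'a \<Rightarrow> real \<Rightarrow> 'b::euclidean_space"
  assumes X: "(\<lambda>(w, \<tau>). X w \<tau>) \<in> borel_measurable (M \<Otimes>\<^sub>M borel)"
    and [measurable]: "f \<in> measurable N M" "g \<in> measurable N lborel" "h \<in> measurable N lborel"
  shows "(\<lambda>n. Delta_occupation k (X (f n)) s t (g n) (h n)) \<in> borel_measurable N"
proof (rule measurable_Delta_occupation)
  have "(\<lambda>z. (f (fst z), snd z)) \<in> measurable (N \<Otimes>\<^sub>M borel) (M \<Otimes>\<^sub>M borel)" by measurable
  from measurable_compose[OF this X] show "(\<lambda>(n, \<tau>). X (f n) \<tau>) \<in> borel_measurable (N \<Otimes>\<^sub>M borel)"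
    by (simp add: case_prod_unfold)
qed (use assms in auto)

lemma measurable_energy:
  fixes X :: "'a \<Rightarrow> real \<Rightarrow> 'b::euclidean_space"
  assumes "(\<lambda>(w, \<tau>). X w \<tau>) \<in> borel_measurable (M \<Otimes>\<^sub>M borel)"
  shows "(\<lambda>w. energy k \<sigma> (X w) s t) \<in> borel_measurable M"
proof -
  note measurable_Delta_occupation_process[OF assms, measurable (raw)]
  show ?thesis unfolding energy_def by measurable
qed

definition energy_constant :: "nat \<Rightarrow> nat \<Rightarrow> real \<Rightarrow> real \<Rightarrow> real" where
  "energy_constant d k \<alpha> \<beta> =
     (Delta_mass k)\<^sup>2 * unit_ball_vol (real d) / (2 * \<alpha> + real d) + increment_constant d k \<beta> / (\<beta> - 2 * \<alpha>)"

text \<open>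
  Small radii are treated with the density bound, large ones with the trivial bound. The two
  contributions, as functions of the threshold \<open>\<rho>\<close>, balance at \<open>\<rho> powr (\<beta> + d) = (t - s) / C\<close>, and
  both are integrable powers of \<open>r\<close> because \<open>2 \<alpha> < \<beta>\<close> and \<open>0 < 2 \<alpha> + d\<close>.
\<close>
lemma (in prob_space) expectation_energy_le:
  fixes X :: "'a \<Rightarrow> real \<Rightarrow> 'b::euclidean_space"
  assumes X: "(\<lambda>(w, \<tau>). X w \<tau>) \<in> borel_measurable (M \<Otimes>\<^sub>M borel)"
    and "s \<le> t" "0 < \<alpha>" "2 * \<alpha> < \<beta>" "0 < C" and k: "DIM('b) + (nat \<lceil>\<beta>\<rceil> - 1) \<le> k"
    and bound: "(\<integral>\<^sup>+ (u, v) \<in> {s..t} \<times> {s..t}. density_holder_norm \<beta> (distr M borel (\<lambda>w. X w v - X w u)) \<partial>(lborel \<Otimes>\<^sub>M lborel))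
        \<le> ennreal (C * (t - s))"
  defines "\<theta> \<equiv> (\<beta> - 2 * \<alpha>) / (\<beta> + real DIM('b))"
  shows "(\<integral>\<^sup>+ w. energy k (\<alpha> + real DIM('b)) (X w) s t \<partial>M)
     \<le> ennreal (energy_constant DIM('b) k \<alpha> \<beta> * C powr (1 - \<theta>) * (t - s) powr (1 + \<theta>))"
proof -
  let ?d = "real DIM('b)"
  let ?wt = "\<lambda>r. ennreal (indicator {0<..} r * r powr (- 2 * (\<alpha> + ?d) - 1))"
  define c1 where "c1 = (Delta_mass k)\<^sup>2 * unit_ball_vol ?d"
  define c2 where "c2 = increment_constant DIM('b) k \<beta>"
  define E where "E r = (\<integral>\<^sup>+ w. \<integral>\<^sup>+ y. ennreal ((Delta_occupation k (X w) s t y r)\<^sup>2) \<partial>lborel \<partial>M)" for r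
  define L where "L = t - s"
  have c_nonneg: "0 \<le> c1" "0 \<le> c2" by (simp_all add: c1_def c2_def increment_constant_def)
  have L: "0 \<le> L" using \<open>s \<le> t\<close> by (simp add: L_def)
  interpret P: pair_sigma_finite M "lborel :: 'b measure" ..
  interpret R: pair_sigma_finite M "lborel :: real measure" ..
  note measurable_Delta_occupation_process[OF X, measurable (raw)]
  have energy: "(\<integral>\<^sup>+ w. energy k (\<alpha> + ?d) (X w) s t \<partial>M) = (\<integral>\<^sup>+ r. ?wt r * E r \<partial>lborel)"
  proof -
    have "(\<integral>\<^sup>+ w. energy k (\<alpha> + ?d) (X w) s t \<partial>M)
        = (\<integral>\<^sup>+ w. \<integral>\<^sup>+ r. \<integral>\<^sup>+ y. ?wt r * ennreal ((Delta_occupation k (X w) s t y r)\<^sup>2) \<partial>lborel \<partial>lborel \<partial>M)"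
      unfolding energy_def
    proof (rule nn_integral_cong)
      fix w assume [measurable]: "w \<in> space M"
      show "(\<integral>\<^sup>+ y. \<integral>\<^sup>+ r. ennreal (indicator {0<..} r * r powr (- 2 * (\<alpha> + ?d) - 1) * (Delta_occupation k (X w) s t y r)\<^sup>2) \<partial>lborel \<partial>lborel)
          = (\<integral>\<^sup>+ r. \<integral>\<^sup>+ y. ?wt r * ennreal ((Delta_occupation k (X w) s t y r)\<^sup>2) \<partial>lborel \<partial>lborel)"
        by (subst lborel_pair.Fubini') (auto simp: ennreal_mult)
    qed
    also have "\<dots> = (\<integral>\<^sup>+ r. \<integral>\<^sup>+ w. \<integral>\<^sup>+ y. ?wt r * ennreal ((Delta_occupation k (X w) s t y r)\<^sup>2) \<partial>lborel \<partial>M \<partial>lborel)"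
      by (rule R.Fubini'[symmetric]) measurable
    also have "\<dots> = (\<integral>\<^sup>+ r. ?wt r * E r \<partial>lborel)"
    proof (rule nn_integral_cong)
      fix r :: real
      have "(\<integral>\<^sup>+ w. \<integral>\<^sup>+ y. ?wt r * ennreal ((Delta_occupation k (X w) s t y r)\<^sup>2) \<partial>lborel \<partial>M)
          = (\<integral>\<^sup>+ w. ?wt r * (\<integral>\<^sup>+ y. ennreal ((Delta_occupation k (X w) s t y r)\<^sup>2) \<partial>lborel) \<partial>M)"
        by (intro nn_integral_cong nn_integral_cmult) measurable
      also have "\<dots> = ?wt r * E r"
        unfolding E_def by (rule nn_integral_cmult) measurable
      finally show "(\<integral>\<^sup>+ w. \<integral>\<^sup>+ y. ?wt r * ennreal ((Delta_occupation k (X w) s t y r)\<^sup>2) \<partial>lborel \<partial>M) = ?wt r * E r" .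
    qed
    finally show ?thesis .
  qed
  have E1: "E r \<le> ennreal (c1 * r powr ?d * L\<^sup>2)" if "0 < r" for r
    using nn_integral_square_Delta_occupation_le_trivial[OF X \<open>s \<le> t\<close> that, of k] that
    by (simp add: E_def c1_def L_def powr_realpow)
  have E2: "E r \<le> ennreal (c2 * r powr (2 * ?d + \<beta>) * (C * L))" if "0 < r" for r
    using nn_integral_square_Delta_occupation_le[OF X \<open>s \<le> t\<close> that _ k bound] assms c_nonneg that L
    by (simp add: E_def c2_def[symmetric] L_def ennreal_mult[symmetric])
  show ?thesis
  proof (cases "L = 0")
    case True
    have zero: "?wt r * E r = 0" for r
      using E1[of r] True by (cases "0 < r") auto
    show ?thesis unfolding energy zero by simp
  next
    case False
    then have "0 < L" using L by simp
    define \<rho> where "\<rho> = (L / C) powr (1 / (\<beta> + ?d))"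
    have \<rho>: "0 < \<rho>" using \<open>0 < L\<close> \<open>0 < C\<close> by (simp add: \<rho>_def)
    have den: "0 < \<beta> + ?d" using assms(3,4) by simp
    have \<rho>1: "\<rho> powr (\<beta> - 2 * \<alpha>) = (L / C) powr \<theta>"
      unfolding \<rho>_def \<theta>_def powr_powr by simp
    have \<rho>2: "\<rho> powr (- (2 * \<alpha> + ?d)) = (L / C) powr (\<theta> - 1)"
    proof -
      have "1 / (\<beta> + ?d) * - (2 * \<alpha> + ?d) = \<theta> - 1"
        using den by (simp add: \<theta>_def field_simps)
      then show ?thesis unfolding \<rho>_def powr_powr by (simp only:)
    qed
    have "(\<integral>\<^sup>+ r. ?wt r * E r \<partial>lborel)
       \<le> (\<integral>\<^sup>+ r. ennreal (c2 * (C * L)) * ennreal (indicator {0<..\<rho>} r * r powr (\<beta> - 2 * \<alpha> - 1))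
              + ennreal (c1 * L\<^sup>2) * ennreal (indicator {\<rho><..} r * r powr (- 2 * \<alpha> - ?d - 1)) \<partial>lborel)"
    proof (rule nn_integral_mono)
      fix r :: real
      consider "r \<le> 0" | "0 < r" "r \<le> \<rho>" | "\<rho> < r" by linarith
      then show "?wt r * E r \<le> ennreal (c2 * (C * L)) * ennreal (indicator {0<..\<rho>} r * r powr (\<beta> - 2 * \<alpha> - 1))
              + ennreal (c1 * L\<^sup>2) * ennreal (indicator {\<rho><..} r * r powr (- 2 * \<alpha> - ?d - 1))"
      proof cases
        case 2
        have "?wt r * E r \<le> ?wt r * ennreal (c2 * r powr (2 * ?d + \<beta>) * (C * L))"
          using 2 by (intro mult_left_mono E2) auto
        also have "\<dots> = ennreal (r powr (- 2 * (\<alpha> + ?d) - 1) * (c2 * r powr (2 * ?d + \<beta>) * (C * L)))"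
          using 2 c_nonneg L \<open>0 < C\<close> by (simp add: ennreal_mult[symmetric])
        also have "r powr (- 2 * (\<alpha> + ?d) - 1) * (c2 * r powr (2 * ?d + \<beta>) * (C * L))
             = c2 * (C * L) * (r powr (- 2 * (\<alpha> + ?d) - 1) * r powr (2 * ?d + \<beta>))"
          by (simp only: mult_ac)
        also have "r powr (- 2 * (\<alpha> + ?d) - 1) * r powr (2 * ?d + \<beta>) = r powr (\<beta> - 2 * \<alpha> - 1)"
          unfolding powr_add[symmetric] by (rule arg_cong[where f = "(powr) r"]) simp
        finally show ?thesis using 2 c_nonneg L \<open>0 < C\<close> by (simp add: ennreal_mult[symmetric])
      next
        case 3
        then have "0 < r" using \<rho> by simp
        have "?wt r * E r \<le> ?wt r * ennreal (c1 * r powr ?d * L\<^sup>2)"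
          using \<open>0 < r\<close> by (intro mult_left_mono E1) auto
        also have "\<dots> = ennreal (r powr (- 2 * (\<alpha> + ?d) - 1) * (c1 * r powr ?d * L\<^sup>2))"
          using \<open>0 < r\<close> c_nonneg by (simp add: ennreal_mult[symmetric])
        also have "r powr (- 2 * (\<alpha> + ?d) - 1) * (c1 * r powr ?d * L\<^sup>2)
             = c1 * L\<^sup>2 * (r powr (- 2 * (\<alpha> + ?d) - 1) * r powr ?d)"
          by (simp only: mult_ac)
        also have "r powr (- 2 * (\<alpha> + ?d) - 1) * r powr ?d = r powr (- 2 * \<alpha> - ?d - 1)"
          unfolding powr_add[symmetric] by (rule arg_cong[where f = "(powr) r"]) simp
        finally show ?thesis using 3 c_nonneg by (simp add: ennreal_mult[symmetric])
      qed simp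
    qed
    also have "\<dots> = ennreal (c2 * (C * L)) * ennreal (\<rho> powr (\<beta> - 2 * \<alpha>) / (\<beta> - 2 * \<alpha>))
        + ennreal (c1 * L\<^sup>2) * ennreal (\<rho> powr (- (2 * \<alpha> + ?d)) / (2 * \<alpha> + ?d))"
    proof -
      have 1: "(\<integral>\<^sup>+ r. ennreal (indicator {0<..\<rho>} r * r powr (\<beta> - 2 * \<alpha> - 1)) \<partial>lborel) = ennreal (\<rho> powr (\<beta> - 2 * \<alpha>) / (\<beta> - 2 * \<alpha>))"
        using nn_integral_powr_Ioc[of "\<beta> - 2 * \<alpha> - 1" \<rho>] assms(4) \<rho> by simp
      have "- 2 * \<alpha> - ?d - 1 + 1 = - (2 * \<alpha> + ?d)" by simp
      then have 2: "(\<integral>\<^sup>+ r. ennreal (indicator {\<rho><..} r * r powr (- 2 * \<alpha> - ?d - 1)) \<partial>lborel) = ennreal (\<rho> powr (- (2 * \<alpha> + ?d)) / (2 * \<alpha> + ?d))"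
        using nn_integral_powr_Ioi[of "- 2 * \<alpha> - ?d - 1" \<rho>] assms(3) \<rho> by (simp only:) simp
      have 3: "(\<integral>\<^sup>+ r. ennreal u * ennreal (indicator S r * r powr v) \<partial>lborel)
          = ennreal u * (\<integral>\<^sup>+ r. ennreal (indicator S r * r powr v) \<partial>lborel)"
        if [measurable]: "S \<in> sets borel" for u v :: real and S :: "real set"
        by (rule nn_integral_cmult) measurable
      show ?thesis
        unfolding 1[symmetric] 2[symmetric] using 3[of "{0<..\<rho>}"] 3[of "{\<rho><..}"]
        by (subst nn_integral_add) simp_all
    qed
    also have "\<dots> = ennreal (c2 * (C * L) * ((L / C) powr \<theta> / (\<beta> - 2 * \<alpha>)) + c1 * L\<^sup>2 * ((L / C) powr (\<theta> - 1) / (2 * \<alpha> + ?d)))"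
      unfolding \<rho>1 \<rho>2 using assms(3,4) c_nonneg L \<open>0 < C\<close>
      by (simp add: ennreal_mult[symmetric] ennreal_plus[symmetric] del: ennreal_plus)
    also have "c2 * (C * L) * ((L / C) powr \<theta> / (\<beta> - 2 * \<alpha>)) + c1 * L\<^sup>2 * ((L / C) powr (\<theta> - 1) / (2 * \<alpha> + ?d))
       = energy_constant DIM('b) k \<alpha> \<beta> * C powr (1 - \<theta>) * L powr (1 + \<theta>)"
    proof -
      have 1: "C * L * (L / C) powr \<theta> = C powr (1 - \<theta>) * L powr (1 + \<theta>)"
        using \<open>0 < C\<close> \<open>0 < L\<close> by (simp add: powr_divide powr_diff powr_add)
      have 2: "L\<^sup>2 * (L / C) powr (\<theta> - 1) = C powr (1 - \<theta>) * L powr (1 + \<theta>)"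
        using \<open>0 < C\<close> \<open>0 < L\<close> by (simp add: powr_divide powr_diff powr_add power2_eq_square)
      have "c2 * (C * L) * ((L / C) powr \<theta> / (\<beta> - 2 * \<alpha>)) + c1 * L\<^sup>2 * ((L / C) powr (\<theta> - 1) / (2 * \<alpha> + ?d))
          = c2 / (\<beta> - 2 * \<alpha>) * (C * L * (L / C) powr \<theta>) + c1 / (2 * \<alpha> + ?d) * (L\<^sup>2 * (L / C) powr (\<theta> - 1))"
        by simp
      also have "\<dots> = energy_constant DIM('b) k \<alpha> \<beta> * (C powr (1 - \<theta>) * L powr (1 + \<theta>))"
        unfolding 1 2 energy_constant_def c1_def c2_def by (simp only: distrib_right add.commute)
      finally show ?thesis by (simp only: mult.assoc)
    qed
    finally show ?thesis unfolding energy L_def .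
  qed
qed

section \<open>Dyadic energies of a continuous process\<close>

text \<open>
  Paths are continuous, so the process is the limit of its values at the dyadic times below \<open>\<tau>\<close>.
  Clamping the time to \<open>[a, b]\<close> gives a path on the whole line, so that no restricted measure spaces
  occur in the Fubini arguments.
\<close>
lemma continuous_process_measurable:
  fixes \<omega> :: "real \<Rightarrow> 'w \<Rightarrow> 'a::euclidean_space"
  assumes "continuous_process a b M \<omega>" and "a \<le> b"
  shows "(\<lambda>(w, \<tau>). \<omega> (max a (min b \<tau>)) w) \<in> borel_measurable (M \<Otimes>\<^sub>M borel)"
proof (rule borel_measurable_LIMSEQ_metric)
  let ?c = "\<lambda>\<tau>::real. max a (min b \<tau>)"
  let ?f = "\<lambda>n z. \<omega> (?c (of_int \<lfloor>snd z * 2 ^ n :: real\<rfloor> / 2 ^ n)) (fst z)"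
  have c_in: "?c \<tau> \<in> {a..b}" for \<tau> using \<open>a \<le> b\<close> by auto
  show "?f n \<in> borel_measurable (M \<Otimes>\<^sub>M borel)" for n :: nat
  proof (rule measurable_compose_countable[where f = "\<lambda>i z. \<omega> (?c (of_int i / 2 ^ n)) (fst z)" and g = "\<lambda>z. \<lfloor>snd z * 2 ^ n :: real\<rfloor>"])
    fix i :: int
    have "\<omega> (?c (of_int i / 2 ^ n)) \<in> borel_measurable M"
      using assms(1) c_in by (auto simp: continuous_process_def)
    then show "(\<lambda>z. \<omega> (?c (of_int i / 2 ^ n)) (fst z)) \<in> borel_measurable (M \<Otimes>\<^sub>M borel)"
      by (rule measurable_compose[OF measurable_fst])
  qed measurable
  fix z assume "z \<in> space (M \<Otimes>\<^sub>M (borel :: real measure))"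
  then have w: "fst z \<in> space M" by (auto simp: space_pair_measure)
  have cont: "continuous_on {a..b} (\<lambda>t. \<omega> t (fst z))"
    using assms(1) w by (auto simp: continuous_process_def)
  have "(\<lambda>n. ?c (of_int \<lfloor>snd z * 2 ^ n\<rfloor> / 2 ^ n)) \<longlonglongrightarrow> ?c (snd z)"
    by (intro tendsto_max tendsto_min tendsto_const floor_dyadic_tendsto)
  then have "(\<lambda>n. ?f n z) \<longlonglongrightarrow> \<omega> (?c (snd z)) (fst z)"
    by (rule continuous_on_tendsto_compose[OF cont]) (use c_in in auto)
  then show "(\<lambda>n. ?f n z) \<longlonglongrightarrow> (case z of (w, \<tau>) \<Rightarrow> \<omega> (?c \<tau>) w)"
    by (simp add: case_prod_unfold)
qed

text \<open>
  The right-hand side of the chaining inequality: the pathwise majorant of the squared 2-variation.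
\<close>
definition dyadic_energy :: "nat \<Rightarrow> real \<Rightarrow> real \<Rightarrow> real \<Rightarrow> real \<Rightarrow> (real \<Rightarrow> 'a::euclidean_space) \<Rightarrow> ennreal" where
  "dyadic_energy k \<sigma> \<kappa> a b x = (\<Sum>n. \<Sum>i<2 ^ n. ennreal (4 * \<kappa> / (\<kappa> - 1) * \<kappa> ^ n) *
      energy k \<sigma> x (a + (b - a) * real i / 2 ^ n) (a + (b - a) * real (i + 1) / 2 ^ n))"

lemma measurable_dyadic_energy:
  fixes X :: "'w \<Rightarrow> real \<Rightarrow> 'a::euclidean_space"
  assumes "(\<lambda>(w, \<tau>). X w \<tau>) \<in> borel_measurable (M \<Otimes>\<^sub>M borel)"
  shows "(\<lambda>w. dyadic_energy k \<sigma> \<kappa> a b (X w)) \<in> borel_measurable M"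
proof -
  note measurable_energy[OF assms, measurable]
  show ?thesis unfolding dyadic_energy_def by measurable
qed

text \<open>
  Equality would make \<open>\<alpha>\<close> an integer.
\<close>
lemma ceiling_strict:
  fixes \<alpha> :: real
  assumes "0 < \<alpha>" "2 * \<alpha> \<notin> \<nat>" "1 \<le> d"
  shows "\<alpha> + real d < real (nat \<lceil>\<alpha> + real d - 1\<rceil> + 1)"
proof -
  define k where "k = nat \<lceil>\<alpha> + real d - 1\<rceil>"
  have "\<alpha> + real d - 1 \<le> real k" unfolding k_def by linarith
  moreover have "\<alpha> + real d - 1 \<noteq> real k"
  proof
    assume eq: "\<alpha> + real d - 1 = real k"
    then have "real d < real (k + 1)" using assms(1) by simp
    then have "d \<le> k + 1" by simp
    then have "2 * \<alpha> = real (2 * (k + 1 - d))" using eq by (simp add: of_nat_diff)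
    then show False using assms(2) by (metis of_nat_in_Nats)
  qed
  ultimately show ?thesis unfolding k_def[symmetric] by simp
qed

text \<open>
  Each of the \<open>2 ^ n\<close> intervals of level \<open>n\<close> has mean energy of order \<open>2 powr (- n (1 + \<theta>))\<close>, and the
  weight \<open>\<kappa> ^ n\<close> uses up only half of the gain: the terms decay like \<open>2 powr (- n \<theta> / 2)\<close>. The order of
  the difference is raised to \<open>l\<close> beforehand, where the cancellation of order \<open>\<beta>\<close> is available.
\<close>
lemma expectation_dyadic_energy_le:
  fixes a b \<alpha> \<beta> :: real
  defines "d \<equiv> DIM('a::euclidean_space)"
  defines "\<theta> \<equiv> (\<beta> - 2 * \<alpha>) / (\<beta> + real d)"
  defines "\<kappa> \<equiv> 2 powr (\<theta> / 2)"
  assumes "a \<le> b" "0 < \<alpha>" "2 * \<alpha> < \<beta>" "2 * \<alpha> \<notin> \<nat>"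
  shows "\<exists>K\<ge>0. \<forall>(M :: 'w measure) (X :: 'w \<Rightarrow> real \<Rightarrow> 'a) C.
     prob_space M \<longrightarrow> (\<lambda>(w, \<tau>). X w \<tau>) \<in> borel_measurable (M \<Otimes>\<^sub>M borel) \<longrightarrow> 0 < C \<longrightarrow>
     (\<forall>s t. a \<le> s \<longrightarrow> s \<le> t \<longrightarrow> t \<le> b \<longrightarrow>
        (\<integral>\<^sup>+ (u, v) \<in> {s..t} \<times> {s..t}. density_holder_norm \<beta> (distr M borel (\<lambda>w. X w v - X w u)) \<partial>(lborel \<Otimes>\<^sub>M lborel))
          \<le> ennreal (C * (t - s))) \<longrightarrow>
     (\<integral>\<^sup>+ w. dyadic_energy (nat \<lceil>\<alpha> + real d - 1\<rceil>) (\<alpha> + real d) \<kappa> a b (X w) \<partial>M)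
        \<le> ennreal (K * C powr (1 - \<theta>))"
proof -
  define k where "k = nat \<lceil>\<alpha> + real d - 1\<rceil>"
  define l where "l = max k (d + (nat \<lceil>\<beta>\<rceil> - 1))"
  have d: "1 \<le> d" unfolding d_def by (simp add: Suc_le_eq)
  have \<sigma>: "\<alpha> + real d < real (k + 1)" unfolding k_def by (rule ceiling_strict[OF assms(5,7) d])
  obtain R where R: "0 < R" "\<And>(x :: real \<Rightarrow> 'a) s t. x \<in> borel_measurable borel \<Longrightarrow>
      energy k (\<alpha> + real d) x s t \<le> ennreal R * energy l (\<alpha> + real d) x s t"
    using energy_le_higher[of "\<alpha> + real d" k l] \<sigma> assms(5) by (auto simp: l_def)
  have \<theta>: "0 < \<theta>" using assms(5,6) d by (simp add: \<theta>_def)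
  have \<kappa>: "1 < \<kappa>" unfolding \<kappa>_def using \<theta> by simp
  define q where "q = 2 powr (- \<theta> / 2)"
  have q: "0 < q" "q < 1" using \<theta> by (auto simp: q_def powr_less_one)
  define e where "e = energy_constant d l \<alpha> \<beta>"
  have e: "0 \<le> e" unfolding e_def energy_constant_def increment_constant_def using assms(5,6) by simp
  define A where "A = 4 * \<kappa> / (\<kappa> - 1) * R * e * (b - a) powr (1 + \<theta>)"
  have A: "0 \<le> A" using \<kappa> R(1) e by (simp add: A_def)
  show ?thesis unfolding k_def[symmetric]
  proof (intro exI[of _ "A / (1 - q)"] conjI allI impI)
    show "0 \<le> A / (1 - q)" using A q by simp
    fix M :: "'w measure" and X :: "'w \<Rightarrow> real \<Rightarrow> 'a" and C :: real
    assume "prob_space M" and X: "(\<lambda>(w, \<tau>). X w \<tau>) \<in> borel_measurable (M \<Otimes>\<^sub>M borel)" and C: "0 < C"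
      and bound: "\<forall>s t. a \<le> s \<longrightarrow> s \<le> t \<longrightarrow> t \<le> b \<longrightarrow>
        (\<integral>\<^sup>+ (u, v) \<in> {s..t} \<times> {s..t}. density_holder_norm \<beta> (distr M borel (\<lambda>w. X w v - X w u)) \<partial>(lborel \<Otimes>\<^sub>M lborel))
          \<le> ennreal (C * (t - s))"
    interpret prob_space M by fact
    note measurable_energy[OF X, measurable]
    define p where "p n i = a + (b - a) * real i / 2 ^ n" for n i
    have p_diff: "p n (i + 1) - p n i = (b - a) / 2 ^ n" for n i
      by (simp add: p_def field_simps)
    have p_in: "a \<le> p n i" "p n i \<le> p n (i + 1)" "p n (i + 1) \<le> b" if "i < 2 ^ n" for n i
    proof -
      show "a \<le> p n i" using assms(4) by (simp add: p_def)
      have "0 \<le> (b - a) / 2 ^ n" using assms(4) by simp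
      then show "p n i \<le> p n (i + 1)" using p_diff[of n i] by linarith
      have "i + 1 \<le> 2 ^ n" using that by simp
      then have "real (i + 1) \<le> real (2 ^ n)" unfolding of_nat_le_iff .
      then have "(b - a) * (real (i + 1) / 2 ^ n) \<le> (b - a) * 1"
        using assms(4) by (intro mult_left_mono) auto
      then show "p n (i + 1) \<le> b" by (simp add: p_def)
    qed
    have one: "(\<integral>\<^sup>+ w. energy k (\<alpha> + real d) (X w) (p n i) (p n (i + 1)) \<partial>M)
        \<le> ennreal (R * (e * C powr (1 - \<theta>) * ((b - a) / 2 ^ n) powr (1 + \<theta>)))" if i: "i < 2 ^ n" for n i
    proof -
      have "(\<integral>\<^sup>+ w. energy k (\<alpha> + real d) (X w) (p n i) (p n (i + 1)) \<partial>M)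
         \<le> (\<integral>\<^sup>+ w. ennreal R * energy l (\<alpha> + real d) (X w) (p n i) (p n (i + 1)) \<partial>M)"
      proof (intro nn_integral_mono R)
        fix w assume w: "w \<in> space M"
        show "X w \<in> borel_measurable borel"
          using measurable_compose[OF measurable_Pair1'[OF w] X] by simp
      qed
      also have "\<dots> = ennreal R * (\<integral>\<^sup>+ w. energy l (\<alpha> + real d) (X w) (p n i) (p n (i + 1)) \<partial>M)"
        by (rule nn_integral_cmult) measurable
      also have "\<dots> \<le> ennreal R * ennreal (e * C powr (1 - \<theta>) * (p n (i + 1) - p n i) powr (1 + \<theta>))"
        unfolding e_def \<theta>_def d_def
        using p_in[OF i] bound assms(5,6) C
        by (intro mult_left_mono expectation_energy_le[OF X]) (auto simp: l_def d_def)
      finally show ?thesis using R(1) e by (simp only: p_diff) (simp add: ennreal_mult)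
    qed
    have level: "(\<Sum>i<2 ^ n. ennreal (4 * \<kappa> / (\<kappa> - 1) * \<kappa> ^ n) * (\<integral>\<^sup>+ w. energy k (\<alpha> + real d) (X w) (p n i) (p n (i + 1)) \<partial>M))
        \<le> ennreal (A * C powr (1 - \<theta>) * q ^ n)" for n
    proof -
      have "(\<Sum>i<2 ^ n. ennreal (4 * \<kappa> / (\<kappa> - 1) * \<kappa> ^ n) * (\<integral>\<^sup>+ w. energy k (\<alpha> + real d) (X w) (p n i) (p n (i + 1)) \<partial>M))
         \<le> (\<Sum>i<(2::nat) ^ n. ennreal (4 * \<kappa> / (\<kappa> - 1) * \<kappa> ^ n) * ennreal (R * (e * C powr (1 - \<theta>) * ((b - a) / 2 ^ n) powr (1 + \<theta>))))"
        by (intro sum_mono mult_left_mono one) auto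
      also have "\<dots> = (\<Sum>i<(2::nat) ^ n. ennreal (4 * \<kappa> / (\<kappa> - 1) * \<kappa> ^ n * (R * (e * C powr (1 - \<theta>) * ((b - a) / 2 ^ n) powr (1 + \<theta>)))))"
        using R(1) e \<kappa> by (intro sum.cong refl ennreal_mult[symmetric]) auto
      also have "\<dots> = ennreal (2 ^ n * (4 * \<kappa> / (\<kappa> - 1) * \<kappa> ^ n * (R * (e * C powr (1 - \<theta>) * ((b - a) / 2 ^ n) powr (1 + \<theta>)))))"
        using R(1) e \<kappa> by (subst sum_ennreal) auto
      also have "2 ^ n * (4 * \<kappa> / (\<kappa> - 1) * \<kappa> ^ n * (R * (e * C powr (1 - \<theta>) * ((b - a) / 2 ^ n) powr (1 + \<theta>))))
         = A * C powr (1 - \<theta>) * q ^ n"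
      proof -
        have qn: "2 ^ n * \<kappa> ^ n / (2 ^ n) powr (1 + \<theta>) = q ^ n"
        proof -
          have 1: "(2::real) ^ n = 2 powr real n" by (simp add: powr_realpow)
          have 2: "\<kappa> ^ n = 2 powr (\<theta> / 2 * real n)"
            unfolding \<kappa>_def powr_powr[symmetric] by (simp add: powr_realpow)
          have "2 ^ n * \<kappa> ^ n / (2 ^ n) powr (1 + \<theta>) = 2 powr (real n + \<theta> / 2 * real n - real n * (1 + \<theta>))"
            unfolding 1 2 powr_powr by (simp only: powr_add powr_diff distrib_left)
          also have "real n + \<theta> / 2 * real n - real n * (1 + \<theta>) = - \<theta> / 2 * real n" by (simp add: field_simps)
          also have "2 powr (- \<theta> / 2 * real n) = q ^ n"
            unfolding q_def powr_powr[symmetric] by (simp add: powr_realpow)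
          finally show ?thesis .
        qed
        show ?thesis
          using assms(4) by (simp add: A_def powr_divide qn[symmetric] mult_ac)
      qed
      finally show ?thesis .
    qed
    have "(\<integral>\<^sup>+ w. dyadic_energy k (\<alpha> + real d) \<kappa> a b (X w) \<partial>M)
       = (\<Sum>n. \<Sum>i<2 ^ n. ennreal (4 * \<kappa> / (\<kappa> - 1) * \<kappa> ^ n) * (\<integral>\<^sup>+ w. energy k (\<alpha> + real d) (X w) (p n i) (p n (i + 1)) \<partial>M))"
      unfolding dyadic_energy_def p_def[symmetric]
      by (simp add: nn_integral_suminf nn_integral_sum nn_integral_cmult)
    also have "\<dots> \<le> (\<Sum>n. ennreal (A * C powr (1 - \<theta>) * q ^ n))"
      by (intro suminf_le level) auto
    also have "\<dots> = ennreal (A * C powr (1 - \<theta>) * (1 / (1 - q)))"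
    proof (rule suminf_ennreal_eq)
      show "(\<lambda>n. A * C powr (1 - \<theta>) * q ^ n) sums (A * C powr (1 - \<theta>) * (1 / (1 - q)))"
        using q by (intro sums_mult geometric_sums) auto
    qed (use A q in auto)
    finally show "(\<integral>\<^sup>+ w. dyadic_energy k (\<alpha> + real d) \<kappa> a b (X w) \<partial>M) \<le> ennreal (A / (1 - q) * C powr (1 - \<theta>))"
      by simp
  qed
qed

section \<open>Variation of the occupation path\<close>

lemma occupation_path_eq_clamped:
  assumes "t \<le> b" "a \<le> b"
  shows "occupation_path a \<omega> w t = measure (occupation_measure (\<lambda>\<tau>. \<omega> (max a (min b \<tau>)) w) a t)"
proof -
  have "occupation_measure (\<lambda>\<tau>. \<omega> \<tau> w) a t = occupation_measure (\<lambda>\<tau>. \<omega> (max a (min b \<tau>)) w) a t"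
    unfolding occupation_measure_def using assms
    by (intro distr_cong) (auto simp: space_restrict_space)
  then show ?thesis by (simp add: occupation_path_def)
qed

lemma compact_finite_occupation_measure:
  fixes x :: "real \<Rightarrow> 'a::euclidean_space"
  assumes x: "x \<in> borel_measurable borel" and cont: "continuous_on {s..t} x"
  shows "compact_finite_measure (occupation_measure x s t)"
  unfolding compact_finite_measure_def
proof (intro conjI exI[of _ "x ` {s..t}"])
  have [measurable]: "x \<in> borel_measurable (restrict_space lborel {s..t})"
    by (rule measurable_restrict_space1) (use x in simp)
  then show "finite_measure (occupation_measure x s t)" by (rule occupation_measure_finite)
  show "compact (x ` {s..t})" by (intro compact_continuous_image cont) simp
  then have "- x ` {s..t} \<in> sets borel" by (intro borel_open open_Compl compact_imp_closed)
  then have "emeasure (occupation_measure x s t) (- x ` {s..t})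
      = emeasure (restrict_space lborel {s..t}) (x -` (- x ` {s..t}) \<inter> {s..t})"
    unfolding occupation_measure_def by (subst emeasure_distr) (auto simp: space_restrict_space)
  also have "x -` (- x ` {s..t}) \<inter> {s..t} = {}" by auto
  finally show "emeasure (occupation_measure x s t) (- x ` {s..t}) = 0" by simp
qed (simp add: occupation_measure_def)

lemma occupation_measure_in_SBE:
  fixes x :: "real \<Rightarrow> 'a::euclidean_space"
  assumes "x \<in> borel_measurable borel" "continuous_on {s..t} x"
    and "SBE_norm \<alpha> p q (measure (occupation_measure x s t)) < \<top>"
  shows "measure (occupation_measure x s t) \<in> SBE \<alpha> p q"
proof -
  have "compact_finite_measure (null_measure (borel :: 'a measure))"
    unfolding compact_finite_measure_def
    by (auto intro!: finite_measureI exI[of _ "{}"])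
  moreover have "measure (occupation_measure x s t)
     = (\<lambda>A. measure (occupation_measure x s t) A - measure (null_measure (borel :: 'a measure)) A)"
    by (rule ext) (simp add: measure_def)
  ultimately show ?thesis
    unfolding SBE_def using compact_finite_occupation_measure[OF assms(1,2)] assms(3) by blast
qed

lemma epowr_less_top_iff: "epowr z p < \<top> \<longleftrightarrow> z < \<top>"
  by (auto simp: epowr_def less_top)

text \<open>
  The bound of the sum of energies holds for monotone sequences from \<open>[a, b]\<close>, not only for
  partitions; the sequence consisting of \<open>a\<close> and \<open>t\<close> gives the finiteness of the norm at time \<open>t\<close>.
\<close>
lemma occupation_path_variation:
  fixes \<omega> :: "real \<Rightarrow> 'w \<Rightarrow> 'a::euclidean_space"
  assumes "a \<le> b" "0 < \<alpha>" "1 < \<kappa>" and cont: "continuous_on {a..b} (\<lambda>\<tau>. \<omega> \<tau> w)"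
  defines "Z \<equiv> dyadic_energy (nat \<lceil>\<alpha> + real DIM('a) - 1\<rceil>) (\<alpha> + real DIM('a)) \<kappa> a b (\<lambda>\<tau>. \<omega> (max a (min b \<tau>)) w)"
  shows "Vp_norm (SBE_norm \<alpha> 2 2) 2 a b (occupation_path a \<omega> w) \<le> epowr Z (1 / 2)"
    and "Z < \<top> \<Longrightarrow> occupation_path a \<omega> w \<in> Vp (SBE \<alpha> 2 2) (SBE_norm \<alpha> 2 2) 2 a b"
proof -
  let ?f = "occupation_path a \<omega> w" and ?N = "SBE_norm \<alpha> 2 2 :: ('a set \<Rightarrow> real) \<Rightarrow> ennreal"
  define k where "k = nat \<lceil>\<alpha> + real DIM('a) - 1\<rceil>"
  define \<sigma> where "\<sigma> = \<alpha> + real DIM('a)"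
  define x where "x \<tau> = \<omega> (max a (min b \<tau>)) w" for \<tau>
  have x_cont: "continuous_on UNIV x"
    unfolding x_def using \<open>a \<le> b\<close>
    by (intro continuous_on_compose2[OF cont]) (auto intro!: continuous_intros)
  then have x: "x \<in> borel_measurable borel" by (rule borel_measurable_continuous_onI)
  have f: "?f t = measure (occupation_measure x a t)" if "t \<le> b" for t
    unfolding x_def by (rule occupation_path_eq_clamped[OF that \<open>a \<le> b\<close>])
  have sum_le: "(\<Sum>h<l. energy k \<sigma> x (t h) (t (Suc h))) \<le> Z"
    if "\<And>h. h < l \<Longrightarrow> t h \<le> t (Suc h)" "a \<le> t 0" "t l \<le> b" for l t
    unfolding Z_def k_def[symmetric] unfolding \<sigma>_def[symmetric] dyadic_energy_def x_def[symmetric]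
    by (rule sum_energy_le_dyadic[OF x \<open>a \<le> b\<close> \<open>1 < \<kappa>\<close> that])
  have increment: "epowr (?N (?f t - ?f s)) 2 = energy k \<sigma> x s t" if "a \<le> s" "s \<le> t" "t \<le> b" for s t
    unfolding \<sigma>_def
  proof (rule SBE_norm_square_eq_energy[OF x \<open>0 < \<alpha>\<close> k_def])
    fix y r
    have "s \<le> b" using that by simp
    then show "Delta k (\<lambda>r. (?f t - ?f s) (cball y r)) r = Delta_occupation k x s t y r"
      by (simp add: fun_diff_def f that Delta_diff Delta_occupation_eq_Delta_measure[OF x, symmetric] Delta_occupation_diff[OF x that(1,2)])
  qed
  have partition: "(\<Sum>h=1..l. epowr (?N (?f (t h) - ?f (t (h - 1)))) 2) \<le> Z"
    if "(l, t) \<in> partitions a b" for l t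
  proof -
    have t: "t 0 = a" "t l = b" and step: "\<And>h. h < l \<Longrightarrow> t h < t (Suc h)"
      using that by (auto simp: partitions_def)
    have mono: "t h \<le> t h'" if "h \<le> h'" "h' \<le> l" for h h'
      using that
    proof (induction h' rule: dec_induct)
      case (step h')
      then show ?case using \<open>\<And>h. h < l \<Longrightarrow> t h < t (Suc h)\<close>[of h'] by auto
    qed simp
    have "(\<Sum>h=1..l. epowr (?N (?f (t h) - ?f (t (h - 1)))) 2) = (\<Sum>h<l. epowr (?N (?f (t (Suc h)) - ?f (t h))) 2)"
      by (simp add: sum.atLeast1_atMost_eq)
    also have "\<dots> = (\<Sum>h<l. energy k \<sigma> x (t h) (t (Suc h)))"
      using t mono[of 0] mono[of _ l] step by (intro sum.cong refl increment) (auto simp: less_imp_le Suc_le_eq)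
    also have "\<dots> \<le> Z"
      using t step by (intro sum_le) (auto simp: less_imp_le)
    finally show ?thesis .
  qed
  show V: "Vp_norm ?N 2 a b ?f \<le> epowr Z (1 / 2)"
    unfolding Vp_norm_def by (intro epowr_mono SUP_least) (auto dest: partition)
  show "?f \<in> Vp (SBE \<alpha> 2 2) ?N 2 a b" if Z: "Z < \<top>"
    unfolding Vp_def
  proof (intro CollectI conjI ballI)
    show "Vp_norm ?N 2 a b ?f < \<top>"
      using V Z by (simp add: epowr_less_top_iff order_le_less_trans)
    fix t assume t: "t \<in> {a..b}"
    have "epowr (?N (measure (occupation_measure x a t))) 2 = energy k \<sigma> x a t"
      unfolding \<sigma>_def
      by (rule SBE_norm_square_eq_energy[OF x \<open>0 < \<alpha>\<close> k_def]) (simp add: Delta_occupation_eq_Delta_measure[OF x])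
    also have "\<dots> \<le> Z"
      using sum_le[of 1 "\<lambda>h. if h = 0 then a else t"] t by simp
    finally have "?N (measure (occupation_measure x a t)) < \<top>"
      using Z epowr_less_top_iff order_le_less_trans by blast
    then have "measure (occupation_measure x a t) \<in> SBE \<alpha> 2 2"
      by (intro occupation_measure_in_SBE x continuous_on_subset[OF x_cont]) auto
    then show "?f t \<in> SBE \<alpha> 2 2" using t by (simp add: f)
  qed
qed

text \<open>
  A substitute for Jensen's inequality: \<open>u powr p \<le> 1 + u\<close> for \<open>u = z / c\<close>. Taking \<open>c\<close> to be the
  order of magnitude of the mean of \<open>z\<close> loses only a constant factor.
\<close>
lemma epowr_le_affine:
  assumes "0 < p" "p \<le> 1" "0 < c"
  shows "epowr z p \<le> ennreal (c powr p) * (1 + ennreal (1 / c) * z)"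
proof (cases "z = \<top>")
  case True
  then show ?thesis using assms by (simp add: ennreal_mult_top)
next
  case False
  then obtain u where u: "z = ennreal u" "0 \<le> u" by (cases z) auto
  have "(u / c) powr p \<le> 1 + u / c"
  proof (cases "u / c \<le> 1")
    case True
    then have "(u / c) powr p \<le> 1" using u assms by (intro powr_le1) auto
    also have "\<dots> \<le> 1 + u / c" using u assms by simp
    finally show ?thesis .
  next
    case False
    then have "(u / c) powr p \<le> (u / c) powr 1" using assms by (intro powr_mono) auto
    then show ?thesis using u assms by simp
  qed
  then have "c powr p * (u / c) powr p \<le> c powr p * (1 + u / c)" by (intro mult_left_mono) auto
  then have "u powr p \<le> c powr p * (1 + u / c)" using u assms by (simp add: powr_divide)
  then show ?thesis
    using u assms by (simp add: epowr_def ennreal_mult[symmetric] ennreal_plus[symmetric] ennreal_1[symmetric] ennreal_leI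
        del: ennreal_plus ennreal_1)
qed

lemma increment_density_bound_subinterval:
  fixes \<omega> :: "real \<Rightarrow> 'w \<Rightarrow> 'a::euclidean_space"
  assumes "increment_density_bound a b \<beta> M \<omega> C" "C \<le> C'" "a \<le> s" "s \<le> t" "t \<le> b"
  shows "(\<integral>\<^sup>+ (u, v) \<in> {s..t} \<times> {s..t}. density_holder_norm \<beta>
            (distr M borel (\<lambda>w. \<omega> (max a (min b v)) w - \<omega> (max a (min b u)) w)) \<partial>(lborel \<Otimes>\<^sub>M lborel))
          \<le> ennreal (C' * (t - s))"
proof -
  have "(\<integral>\<^sup>+ (u, v) \<in> {s..t} \<times> {s..t}. density_holder_norm \<beta>
            (distr M borel (\<lambda>w. \<omega> (max a (min b v)) w - \<omega> (max a (min b u)) w)) \<partial>(lborel \<Otimes>\<^sub>M lborel))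
      = (\<integral>\<^sup>+ (u, v) \<in> {s..t} \<times> {s..t}. density_holder_norm \<beta> (increment_law M \<omega> u v) \<partial>(lborel \<Otimes>\<^sub>M lborel))"
    using assms(3-5)
    by (intro nn_integral_cong) (auto simp: indicator_def increment_law_def)
  also have "\<dots> \<le> ennreal (C * measure lborel {s..t})"
    using assms(1,3-5) unfolding increment_density_bound_def
    by (auto dest!: spec[of _ "{s..t}"] simp: is_interval_cc)
  also have "\<dots> \<le> ennreal (C' * (t - s))"
    using assms(2,4) by (intro ennreal_leI) (simp add: mult_right_mono)
  finally show ?thesis .
qed

lemma weighted_moment_le:
  fixes \<omega> :: "real \<Rightarrow> 'w \<Rightarrow> 'a::euclidean_space"
  assumes "a \<le> b" and process: "continuous_process a b M \<omega>" and "0 < q" "q \<le> 2" "0 < c" "0 \<le> K"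
    and V: "\<And>w. w \<in> space M \<Longrightarrow> Vp_norm (SBE_norm \<alpha> 2 2) 2 a b (occupation_path a \<omega> w) \<le> epowr (Z w) (1 / 2)"
    and Z [measurable]: "Z \<in> borel_measurable M" and Z_le: "(\<integral>\<^sup>+ w. Z w \<partial>M) \<le> ennreal (K * c)"
  shows "weighted_moment a b \<alpha> q M \<omega> \<le> ennreal ((1 + K) * c powr (q / 2))"
proof -
  interpret prob_space M using process by (simp add: continuous_process_def)
  have "weighted_moment a b \<alpha> q M \<omega> \<le> (\<integral>\<^sup>+ w. ennreal (c powr (q / 2)) * (1 + ennreal (1 / c) * Z w) \<partial>M)"
    unfolding weighted_moment_def
  proof (rule nn_integral_mono)
    fix w assume w: "w \<in> space M"
    let ?V = "Vp_norm (SBE_norm \<alpha> 2 2) 2 a b (occupation_path a \<omega> w)"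
    have cont: "continuous_on {a..b} (\<lambda>s. norm (\<omega> s w))"
      using process w by (auto simp: continuous_process_def intro!: continuous_intros)
    have "bdd_above ((\<lambda>s. norm (\<omega> s w)) ` {a..b})"
      by (intro bounded_imp_bdd_above compact_imp_bounded compact_continuous_image cont) simp
    then have "norm (\<omega> a w) \<le> (SUP s\<in>{a..b}. norm (\<omega> s w))"
      using \<open>a \<le> b\<close> by (intro cSUP_upper) auto
    then have "0 \<le> (SUP s\<in>{a..b}. norm (\<omega> s w))" using norm_ge_zero order_trans by blast
    then have weight: "(1 + (SUP s\<in>{a..b}. norm (\<omega> s w))) powr (- real DIM('a)) \<le> 1"
      by (simp add: powr_minus inverse_le_1_iff ge_one_powr_ge_zero)
    have "epowr ?V q * ennreal ((1 + (SUP s\<in>{a..b}. norm (\<omega> s w))) powr (- real DIM('a))) \<le> epowr ?V q * 1"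
      using weight by (intro mult_left_mono) (auto simp: ennreal_le_1)
    also have "\<dots> \<le> epowr (epowr (Z w) (1 / 2)) q"
      using V[OF w] \<open>0 < q\<close> by (simp add: epowr_mono)
    also have "\<dots> = epowr (Z w) (q / 2)" by (simp add: epowr_def powr_powr)
    also have "\<dots> \<le> ennreal (c powr (q / 2)) * (1 + ennreal (1 / c) * Z w)"
      using assms(3-5) by (intro epowr_le_affine) auto
    finally show "epowr ?V q * ennreal ((1 + (SUP s\<in>{a..b}. norm (\<omega> s w))) powr (- real DIM('a)))
        \<le> ennreal (c powr (q / 2)) * (1 + ennreal (1 / c) * Z w)" .
  qed
  also have "\<dots> = ennreal (c powr (q / 2)) * (1 + ennreal (1 / c) * (\<integral>\<^sup>+ w. Z w \<partial>M))"
    by (simp add: nn_integral_cmult nn_integral_add emeasure_space_1)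
  also have "\<dots> \<le> ennreal (c powr (q / 2)) * (1 + ennreal (1 / c) * ennreal (K * c))"
    by (intro mult_left_mono add_left_mono Z_le) auto
  also have "\<dots> = ennreal ((1 + K) * c powr (q / 2))"
    using assms(5,6) by (simp add: ennreal_mult[symmetric] ennreal_plus[symmetric] ennreal_1[symmetric] mult.commute
        del: ennreal_plus ennreal_1)
  finally show ?thesis .
qed

theorem theorem4p1:
  fixes a b \<alpha> \<beta> :: real
  assumes "a \<le> b" and "0 < \<beta>" and "0 < \<alpha>" and "\<alpha> < \<beta> / 2" and "2 * \<alpha> \<notin> \<nat>"
  shows
    "(\<forall>(M :: 'w measure) (\<omega> :: real \<Rightarrow> 'w \<Rightarrow> 'a::euclidean_space) C\<^sub>\<nu>.
        continuous_process a b M \<omega> \<and> increment_density_bound a b \<beta> M \<omega> C\<^sub>\<nu> \<longrightarrow>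
          (AE w in M. occupation_path a \<omega> w \<in> Vp (SBE \<alpha> 2 2) (SBE_norm \<alpha> 2 2) 2 a b))
     \<and> (\<forall>\<delta> q. 0 < \<delta> \<and> \<delta> < 1 \<and> 1 \<le> q \<and> q < 2 \<longrightarrow>
          (\<forall>(M :: 'w measure) (\<omega> :: real \<Rightarrow> 'w \<Rightarrow> 'a). continuous_process a b M \<omega> \<longrightarrow>
             (\<exists>K>0. \<forall>C\<^sub>\<nu>. increment_density_bound a b \<beta> M \<omega> C\<^sub>\<nu> \<longrightarrow>
                weighted_moment a b \<alpha> q M \<omega> \<le> ennreal (K * (1 + C\<^sub>\<nu> powr ((1 - \<delta>) * q / 2)))))
        \<and> (\<delta> * (\<beta> + real DIM('a)) \<le> \<beta> - 2 * \<alpha> \<longrightarrow>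
             (\<exists>K>0. \<forall>(M :: 'w measure) (\<omega> :: real \<Rightarrow> 'w \<Rightarrow> 'a) C\<^sub>\<nu>.
                continuous_process a b M \<omega> \<and> increment_density_bound a b \<beta> M \<omega> C\<^sub>\<nu> \<longrightarrow>
                weighted_moment a b \<alpha> q M \<omega> \<le> ennreal (K * (1 + C\<^sub>\<nu> powr ((1 - \<delta>) * q / 2))))))"
proof -
  let ?d = "real DIM('a)"
  define \<theta> where "\<theta> = (\<beta> - 2 * \<alpha>) / (\<beta> + ?d)"
  define \<kappa> where "\<kappa> = 2 powr (\<theta> / 2)"
  define X where "X \<omega> w \<tau> = \<omega> (max a (min b \<tau>)) w" for \<omega> :: "real \<Rightarrow> 'w \<Rightarrow> 'a" and w \<tau>
  define Z where "Z \<omega> w = dyadic_energy (nat \<lceil>\<alpha> + ?d - 1\<rceil>) (\<alpha> + ?d) \<kappa> a b (X \<omega> w)" for \<omega> w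
  have \<theta>: "0 < \<theta>" using assms by (simp add: \<theta>_def)
  have \<kappa>: "1 < \<kappa>" unfolding \<kappa>_def using \<theta> by simp
  obtain K where K: "0 \<le> K" "\<And>(M :: 'w measure) (X :: 'w \<Rightarrow> real \<Rightarrow> 'a) C.
     prob_space M \<Longrightarrow> (\<lambda>(w, \<tau>). X w \<tau>) \<in> borel_measurable (M \<Otimes>\<^sub>M borel) \<Longrightarrow> 0 < C \<Longrightarrow>
     (\<And>s t. a \<le> s \<Longrightarrow> s \<le> t \<Longrightarrow> t \<le> b \<Longrightarrow>
        (\<integral>\<^sup>+ (u, v) \<in> {s..t} \<times> {s..t}. density_holder_norm \<beta> (distr M borel (\<lambda>w. X w v - X w u)) \<partial>(lborel \<Otimes>\<^sub>M lborel))
          \<le> ennreal (C * (t - s))) \<Longrightarrow>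
     (\<integral>\<^sup>+ w. dyadic_energy (nat \<lceil>\<alpha> + ?d - 1\<rceil>) (\<alpha> + ?d) \<kappa> a b (X w) \<partial>M)
        \<le> ennreal (K * C powr (1 - \<theta>))"
    using expectation_dyadic_energy_le[of a b \<alpha> \<beta>, where 'a = 'a and 'w = 'w] assms
    unfolding \<theta>_def[symmetric] \<kappa>_def[symmetric] by auto
  have Z_meas: "Z \<omega> \<in> borel_measurable M" if "continuous_process a b M \<omega>" for M \<omega>
    unfolding Z_def X_def
    by (intro measurable_dyadic_energy continuous_process_measurable[OF that \<open>a \<le> b\<close>])
  \<comment> \<open>Replacing \<open>C\<close> by \<open>max C 1\<close> keeps the hypothesis and makes powers of it monotone in the exponent.\<close>
  have Z_le: "(\<integral>\<^sup>+ w. Z \<omega> w \<partial>M) \<le> ennreal (K * (max C 1) powr (1 - \<theta>))"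
    if "continuous_process a b M \<omega>" "increment_density_bound a b \<beta> M \<omega> C" for M \<omega> C
    unfolding Z_def X_def
    using that by (intro K continuous_process_measurable[OF that(1) \<open>a \<le> b\<close>]
        increment_density_bound_subinterval[OF that(2)]) (auto simp: continuous_process_def)
  have path: "Vp_norm (SBE_norm \<alpha> 2 2) 2 a b (occupation_path a \<omega> w) \<le> epowr (Z \<omega> w) (1 / 2)"
      "Z \<omega> w < \<top> \<Longrightarrow> occupation_path a \<omega> w \<in> Vp (SBE \<alpha> 2 2) (SBE_norm \<alpha> 2 2) 2 a b"
    if "continuous_process a b M \<omega>" "w \<in> space M" for M \<omega> w
  proof -
    have cont: "continuous_on {a..b} (\<lambda>\<tau>. \<omega> \<tau> w)"
      using that by (simp add: continuous_process_def)
    note variation = occupation_path_variation[where \<omega> = \<omega> and w = w, OF assms(1,3) \<kappa> cont]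
    show "Vp_norm (SBE_norm \<alpha> 2 2) 2 a b (occupation_path a \<omega> w) \<le> epowr (Z \<omega> w) (1 / 2)"
      unfolding Z_def X_def by (rule variation(1))
    show "occupation_path a \<omega> w \<in> Vp (SBE \<alpha> 2 2) (SBE_norm \<alpha> 2 2) 2 a b" if "Z \<omega> w < \<top>"
      using that unfolding Z_def X_def by (rule variation(2))
  qed
  have moment: "weighted_moment a b \<alpha> q M \<omega> \<le> ennreal ((1 + K) * (max C 1) powr ((1 - \<theta>) * q / 2))"
    if "continuous_process a b M \<omega>" "increment_density_bound a b \<beta> M \<omega> C" "1 \<le> q" "q < 2"
    for M :: "'w measure" and \<omega> :: "real \<Rightarrow> 'w \<Rightarrow> 'a" and C q
    using weighted_moment_le[OF \<open>a \<le> b\<close> that(1) _ _ _ K(1) path(1)[OF that(1)] Z_meas[OF that(1)] Z_le[OF that(1,2)], of q] that(3,4)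
    by (simp add: powr_powr)
  show ?thesis
  proof (intro conjI allI impI; (elim conjE)?)
    fix M :: "'w measure" and \<omega> :: "real \<Rightarrow> 'w \<Rightarrow> 'a" and C
    assume process: "continuous_process a b M \<omega>" and bound: "increment_density_bound a b \<beta> M \<omega> C"
    have "AE w in M. Z \<omega> w \<noteq> \<infinity>"
      using Z_le[OF process bound] by (intro nn_integral_PInf_AE Z_meas process) (auto simp: top_unique)
    then show "AE w in M. occupation_path a \<omega> w \<in> Vp (SBE \<alpha> 2 2) (SBE_norm \<alpha> 2 2) 2 a b"
      using AE_space by eventually_elim (rule path(2)[OF process], auto simp: less_top)
  next
    fix \<delta> q :: real and M :: "'w measure" and \<omega> :: "real \<Rightarrow> 'w \<Rightarrow> 'a"
    assume \<delta>q: "0 < \<delta>" "\<delta> < 1" "1 \<le> q" "q < 2" and process: "continuous_process a b M \<omega>"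
    let ?W = "weighted_moment a b \<alpha> q M \<omega>"
    show "\<exists>K>0. \<forall>C. increment_density_bound a b \<beta> M \<omega> C \<longrightarrow> ?W \<le> ennreal (K * (1 + C powr ((1 - \<delta>) * q / 2)))"
    proof (intro exI[of _ "enn2real ?W + 1"] conjI allI impI)
      show "0 < enn2real ?W + 1" by (simp add: add_nonneg_pos)
      fix C assume "increment_density_bound a b \<beta> M \<omega> C"
      then have "?W < \<top>" using moment[OF process _ \<delta>q(3,4)] by (meson ennreal_less_top order_le_less_trans)
      then have "?W = ennreal (enn2real ?W)" by simp
      also have "\<dots> \<le> ennreal ((enn2real ?W + 1) * (1 + C powr ((1 - \<delta>) * q / 2)))"
      proof (rule ennreal_leI)
        have "enn2real ?W \<le> (enn2real ?W + 1) * 1" by simp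
        also have "\<dots> \<le> (enn2real ?W + 1) * (1 + C powr ((1 - \<delta>) * q / 2))"
          by (intro mult_left_mono) auto
        finally show "enn2real ?W \<le> (enn2real ?W + 1) * (1 + C powr ((1 - \<delta>) * q / 2))" .
      qed
      finally show "?W \<le> ennreal ((enn2real ?W + 1) * (1 + C powr ((1 - \<delta>) * q / 2)))" .
    qed
  next
    fix \<delta> q :: real
    assume \<delta>q: "0 < \<delta>" "\<delta> < 1" "1 \<le> q" "q < 2" and le: "\<delta> * (\<beta> + ?d) \<le> \<beta> - 2 * \<alpha>"
    have "0 < \<beta> + ?d" using assms(2) by simp
    then have \<delta>: "\<delta> \<le> \<theta>" using le by (simp add: \<theta>_def pos_le_divide_eq)
    show "\<exists>K>0. \<forall>(M :: 'w measure) (\<omega> :: real \<Rightarrow> 'w \<Rightarrow> 'a) C.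
        continuous_process a b M \<omega> \<and> increment_density_bound a b \<beta> M \<omega> C \<longrightarrow>
        weighted_moment a b \<alpha> q M \<omega> \<le> ennreal (K * (1 + C powr ((1 - \<delta>) * q / 2)))"
    proof (intro exI[of _ "1 + K"] conjI allI impI; (elim conjE)?)
      show "0 < 1 + K" using K(1) by simp
      fix M :: "'w measure" and \<omega> :: "real \<Rightarrow> 'w \<Rightarrow> 'a" and C
      assume "continuous_process a b M \<omega>" "increment_density_bound a b \<beta> M \<omega> C"
      then have "weighted_moment a b \<alpha> q M \<omega> \<le> ennreal ((1 + K) * (max C 1) powr ((1 - \<theta>) * q / 2))"
        by (rule moment[OF _ _ \<delta>q(3,4)])
      also have "\<dots> \<le> ennreal ((1 + K) * (1 + C powr ((1 - \<delta>) * q / 2)))"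
      proof (intro ennreal_leI mult_left_mono)
        show "(max C 1) powr ((1 - \<theta>) * q / 2) \<le> 1 + C powr ((1 - \<delta>) * q / 2)"
        proof (cases "C \<le> 1")
          case False
          then have "C powr ((1 - \<theta>) * q / 2) \<le> C powr ((1 - \<delta>) * q / 2)"
            using \<delta> \<delta>q by (intro powr_mono divide_right_mono mult_right_mono) auto
          moreover have max: "max C 1 = C" using False by simp
          ultimately show ?thesis unfolding max by linarith
        qed simp
      qed (use K(1) in simp)
      finally show "weighted_moment a b \<alpha> q M \<omega> \<le> ennreal ((1 + K) * (1 + C powr ((1 - \<delta>) * q / 2)))" .
    qed
  qed
qed

end
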